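(* Let $k,c>0$, let $X=H^1(\mathbb{R})\times L^2(\mathbb{R})$, and for $(f,g)\in X$ let $u$ be the solution of $$u_{tt}+ku_t=c^2u_{xx},\qquad u(0)=f,\qquad u_t(0)=g,$$ and set $\Gamma_t(f,g)=(u(t),u_t(t))$. Then: 1. For every $(f,g)\in X$ and $t\ge0$, $\Gamma_t(f,g)=(u(t),u_t(t))\in X$. 2. The family $\{\Gamma_t\}_{t\ge0}$ has the semigroup property. 3. For every $t\in\mathbb{R}$ there exist constants $M_1,M_2,M_3,N_1,N_2,N_3,P_1,P_2>0$ such that for every $(f,g)\in X$, with $u,u_t,u_x$ evaluated at time $t$, (a) $\|u\|_{L^2(\mathbb{R})}\le e^{-\frac{k}{2}t}\left\{M_1\|f\|_{L^2(\mathbb{R})}+N_1\|g\|_{L^2(\mathbb{R})}\right\}$, (b) $\|u_t\|_{L^2(\mathbb{R})}\le e^{-\frac{k}{2}t}\left\{M_2\|f\|_{L^2(\mathbb{R})}+N_2\|g\|_{L^2(\mathbb{R})}+P_1\|f'\|_{L^2(\mathbb{R})}\right\}$, (c) $\|u_x\|_{L^2(\mathbb{R})}\le e^{-\frac{k}{2}t}\left\{M_3\|f\|_{L^2(\mathbb{R})}+N_3\|g\|_{L^2(\mathbb{R})}+P_2\|f'\|_{L^2(\mathbb{R})}\right\}$; that is, the semigroup acts continuously on $X$.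
   Context: The solution $u$ is the unique solution in $\mathcal{C}^1(\mathbb{R},\mathcal{D}'(\mathbb{R}))$ of the initial value problem, the equation being understood in $\mathcal{D}'(\mathbb{R}\times\mathbb{R})$ and the initial conditions in $\mathcal{D}'(\mathbb{R})$. ($\mathcal{C}^1(\mathbb{R},\mathcal{D}'(\mathbb{R}))$ is the space of maps $t\mapsto u(t)\in\mathcal{D}'(\mathbb{R})$ that are continuously differentiable when tested against each $\varphi\in\mathcal{C}_0^\infty(\mathbb{R})$, with derivative $u_t(t)\in\mathcal{D}'(\mathbb{R})$.) For $(f,g)\in X$ and $t\in\mathbb{R}$ it is given by $$u(x,t)=e^{-\frac{k}{2}t}\left\{\frac12\left[f(x+ct)+f(x-ct)\right]+\alpha ct\int_{x-ct}^{x+ct}\frac{I_0'(2\alpha\sqrt\lambda)}{\sqrt\lambda}f(y)\,dy+\int_{x-ct}^{x+ct}\frac{1}{2c}I_0(2\alpha\sqrt\lambda)\left[\frac{k}{2}f(y)+g(y)\right]dy\right\},$$ where $\alpha=\frac{k}{4c}$, $\lambda=c^2t^2-(x-y)^2$, and $I_0$ is the modified Bessel function of the first kind of order $0$ (for negative $t$, the first integral term is to be read with $\alpha c|t|$ and the interval $[x-c|t|,x+c|t|]$, i.e. with the same value as given by oriented integrals and $\alpha ct$). A family $\{\Gamma_t\}_{t\ge0}$ of bounded linear operators on a Banach space $X$ into itself has the semigroup property if $\Gamma_0=\mathrm{Id}$ and $\Gamma_t(\Gamma_s)=\Gamma_{t+s}$ for all $t,s\ge0$. *)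

theory Defs
  imports "HOL-Analysis.Analysis"
begin

section \<open>Test functions\<close>

definition dir_deriv :: "'a::euclidean_space \<Rightarrow> ('a \<Rightarrow> real) \<Rightarrow> 'a \<Rightarrow> real"
  where "dir_deriv v \<phi> = (\<lambda>x. frechet_derivative \<phi> (at x) v)"

text \<open>\<open>\<C>\<^sup>\<infinity>\<close>: all iterated directional derivatives exist and are totally differentiable
  (hence continuous).\<close>

definition smooth :: "('a::euclidean_space \<Rightarrow> real) \<Rightarrow> bool"
  where "smooth \<phi> \<longleftrightarrow> (\<forall>vs x. foldr dir_deriv vs \<phi> differentiable (at x))"

definition test_funs :: "('a::euclidean_space \<Rightarrow> real) set"
  where "test_funs = {\<phi>. smooth \<phi> \<and> compact (closure {x. \<phi> x \<noteq> 0})}"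

text \<open>Convergence to \<open>0\<close> of a sequence in \<open>\<C>\<^sub>0\<^sup>\<infinity>\<close>.\<close>

definition test_null_seq :: "(nat \<Rightarrow> 'a::euclidean_space \<Rightarrow> real) \<Rightarrow> bool"
  where "test_null_seq \<phi> \<longleftrightarrow>
    (\<forall>n. \<phi> n \<in> test_funs) \<and>
    (\<exists>K. compact K \<and> (\<forall>n. {x. \<phi> n x \<noteq> 0} \<subseteq> K)) \<and>
    (\<forall>vs. uniform_limit UNIV (\<lambda>n. foldr dir_deriv vs (\<phi> n)) (\<lambda>_. 0) sequentially)"

lemma compact_closed_subset:
  fixes A B :: "'a::euclidean_space set"
  shows "compact A \<Longrightarrow> closed B \<Longrightarrow> B \<subseteq> A \<Longrightarrow> compact B"
  by (metis compact_Int_closed inf.absorb_iff2)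

lemma dir_deriv_add:
  assumes "\<And>x. \<phi> differentiable (at x)" "\<And>x. \<psi> differentiable (at x)"
  shows "dir_deriv v (\<lambda>x. \<phi> x + \<psi> x) = (\<lambda>x. dir_deriv v \<phi> x + dir_deriv v \<psi> x)"
proof
  fix x
  have "((\<lambda>x. \<phi> x + \<psi> x) has_derivative
      (\<lambda>h. frechet_derivative \<phi> (at x) h + frechet_derivative \<psi> (at x) h)) (at x)"
    using assms[of x] by (intro has_derivative_add) (simp_all add: frechet_derivative_works[symmetric])
  then show "dir_deriv v (\<lambda>x. \<phi> x + \<psi> x) x = dir_deriv v \<phi> x + dir_deriv v \<psi> x"
    unfolding dir_deriv_def by (simp add: frechet_derivative_at[symmetric])
qed

lemma dir_deriv_cmult:
  assumes "\<And>x. \<phi> differentiable (at x)"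
  shows "dir_deriv v (\<lambda>x. a * \<phi> x) = (\<lambda>x. a * dir_deriv v \<phi> x)"
proof
  fix x
  have "((\<lambda>x. a * \<phi> x) has_derivative (\<lambda>h. a * frechet_derivative \<phi> (at x) h)) (at x)"
    using assms[of x]
    by (intro has_derivative_mult_right) (simp add: frechet_derivative_works[symmetric])
  then show "dir_deriv v (\<lambda>x. a * \<phi> x) x = a * dir_deriv v \<phi> x"
    unfolding dir_deriv_def by (simp add: frechet_derivative_at[symmetric])
qed

lemma smoothD: "smooth \<phi> \<Longrightarrow> foldr dir_deriv vs \<phi> differentiable (at x)"
  by (simp add: smooth_def)

lemma foldr_dir_deriv_add:
  assumes "smooth \<phi>" "smooth \<psi>"
  shows "foldr dir_deriv vs (\<lambda>x. \<phi> x + \<psi> x) =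
    (\<lambda>x. foldr dir_deriv vs \<phi> x + foldr dir_deriv vs \<psi> x)"
  by (induction vs) (simp_all add: dir_deriv_add smoothD assms)

lemma foldr_dir_deriv_cmult:
  assumes "smooth \<phi>"
  shows "foldr dir_deriv vs (\<lambda>x. a * \<phi> x) = (\<lambda>x. a * foldr dir_deriv vs \<phi> x)"
  by (induction vs) (simp_all add: dir_deriv_cmult smoothD assms)

lemma test_funs_add:
  assumes "\<phi> \<in> test_funs" "\<psi> \<in> test_funs"
  shows "(\<lambda>x. \<phi> x + \<psi> x) \<in> test_funs"
proof -
  have "closure {x. \<phi> x + \<psi> x \<noteq> 0} \<subseteq> closure ({x. \<phi> x \<noteq> 0} \<union> {x. \<psi> x \<noteq> 0})"
    by (rule closure_mono) auto
  also have "\<dots> = closure {x. \<phi> x \<noteq> 0} \<union> closure {x. \<psi> x \<noteq> 0}"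
    by simp
  finally have "compact (closure {x. \<phi> x + \<psi> x \<noteq> 0})"
    using assms unfolding test_funs_def
    by (metis (no_types, lifting) closed_closure compact_Un compact_closed_subset mem_Collect_eq)
  moreover have "smooth (\<lambda>x. \<phi> x + \<psi> x)"
    using assms unfolding test_funs_def
    by (subst smooth_def) (auto simp: foldr_dir_deriv_add intro!: smoothD differentiable_add)
  ultimately show ?thesis
    by (simp add: test_funs_def)
qed

lemma test_funs_cmult:
  assumes "\<phi> \<in> test_funs"
  shows "(\<lambda>x. a * \<phi> x) \<in> test_funs"
proof -
  have "closure {x. a * \<phi> x \<noteq> 0} \<subseteq> closure {x. \<phi> x \<noteq> 0}"
    by (rule closure_mono) auto
  then have "compact (closure {x. a * \<phi> x \<noteq> 0})"
    using assms unfolding test_funs_def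
    by (metis (no_types, lifting) closed_closure compact_closed_subset mem_Collect_eq)
  moreover have "smooth (\<lambda>x. a * \<phi> x)"
    using assms unfolding test_funs_def
    by (subst smooth_def) (auto simp: foldr_dir_deriv_cmult intro!: smoothD differentiable_mult)
  ultimately show ?thesis
    by (simp add: test_funs_def)
qed

lemma foldr_dir_deriv_snoc: "foldr dir_deriv vs (dir_deriv v \<phi>) = foldr dir_deriv (vs @ [v]) \<phi>"
  by simp

lemma dir_deriv_support:
  assumes "closed K" "{x. \<phi> x \<noteq> 0} \<subseteq> K"
  shows "{x. dir_deriv v \<phi> x \<noteq> 0} \<subseteq> K"
proof (rule ccontr)
  assume "\<not> ?thesis"
  then obtain x where x: "x \<notin> K" "dir_deriv v \<phi> x \<noteq> 0"
    by auto
  have "(\<phi> has_derivative (\<lambda>_. 0)) (at x)"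
    by (rule has_derivative_transform_within_open[OF has_derivative_const, of "- K" x 0])
      (use assms x in \<open>auto simp: open_Compl\<close>)
  then show False
    using x by (simp add: dir_deriv_def frechet_derivative_at[symmetric])
qed

lemma test_funs_dir_deriv:
  assumes "\<phi> \<in> test_funs"
  shows "dir_deriv v \<phi> \<in> test_funs"
proof -
  have "{x. dir_deriv v \<phi> x \<noteq> 0} \<subseteq> closure {x. \<phi> x \<noteq> 0}"
    by (rule dir_deriv_support) (auto simp: closure_subset)
  then have "closure {x. dir_deriv v \<phi> x \<noteq> 0} \<subseteq> closure {x. \<phi> x \<noteq> 0}"
    by (simp add: closure_minimal)
  then have "compact (closure {x. dir_deriv v \<phi> x \<noteq> 0})"
    using assms unfolding test_funs_def
    by (metis (no_types, lifting) closed_closure compact_closed_subset mem_Collect_eq)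
  moreover have "smooth (dir_deriv v \<phi>)"
    using assms unfolding test_funs_def
    by (subst smooth_def) (auto simp: foldr_dir_deriv_snoc simp del: foldr_append intro!: smoothD)
  ultimately show ?thesis
    by (simp add: test_funs_def)
qed

lemma test_null_seq_dir_deriv:
  assumes "test_null_seq \<phi>"
  shows "test_null_seq (\<lambda>n. dir_deriv v (\<phi> n))"
proof -
  obtain K where K: "compact K" "\<And>n. {x. \<phi> n x \<noteq> 0} \<subseteq> K"
    using assms by (auto simp: test_null_seq_def)
  have "\<forall>n. {x. dir_deriv v (\<phi> n) x \<noteq> 0} \<subseteq> K"
    using K by (intro allI dir_deriv_support) (simp_all add: compact_imp_closed)
  then show ?thesis
    using assms K unfolding test_null_seq_def
    by (auto simp: foldr_dir_deriv_snoc test_funs_dir_deriv simp del: foldr_append)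
qed


section \<open>Distributions\<close>

text \<open>A distribution is a (sequentially) continuous linear functional on the test functions. It is
  represented by a total function that vanishes outside the test functions, so that equality of the
  type is equality in \<open>\<D>'\<close>.\<close>

definition is_distribution :: "(('a::euclidean_space \<Rightarrow> real) \<Rightarrow> real) \<Rightarrow> bool"
  where "is_distribution T \<longleftrightarrow>
    (\<forall>\<phi>\<in>test_funs. \<forall>\<psi>\<in>test_funs. T (\<lambda>x. \<phi> x + \<psi> x) = T \<phi> + T \<psi>) \<and>
    (\<forall>a. \<forall>\<phi>\<in>test_funs. T (\<lambda>x. a * \<phi> x) = a * T \<phi>) \<and>
    (\<forall>\<phi>. test_null_seq \<phi> \<longrightarrow> (\<lambda>n. T (\<phi> n)) \<longlonglongrightarrow> 0) \<and>
    (\<forall>\<phi>. \<phi> \<notin> test_funs \<longrightarrow> T \<phi> = 0)"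

typedef (overloaded) 'a::euclidean_space distribution =
    "{T :: ('a \<Rightarrow> real) \<Rightarrow> real. is_distribution T}"
  morphisms pairing Abs_distribution
  by (rule exI[of _ "\<lambda>_. 0"]) (simp add: is_distribution_def)

setup_lifting type_definition_distribution

instantiation distribution :: (euclidean_space) real_vector
begin

lift_definition zero_distribution :: "'a distribution" is "\<lambda>_. 0"
  by (simp add: is_distribution_def)

lift_definition plus_distribution :: "'a distribution \<Rightarrow> 'a distribution \<Rightarrow> 'a distribution"
  is "\<lambda>S T \<phi>. S \<phi> + T \<phi>"
  unfolding is_distribution_def by (auto simp: algebra_simps intro: tendsto_add_zero)

lift_definition uminus_distribution :: "'a distribution \<Rightarrow> 'a distribution"
  is "\<lambda>T \<phi>. - T \<phi>"
  unfolding is_distribution_def by (auto simp flip: tendsto_minus_cancel_left)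

definition minus_distribution :: "'a distribution \<Rightarrow> 'a distribution \<Rightarrow> 'a distribution"
  where "minus_distribution S T = S + (- T)"

lift_definition scaleR_distribution :: "real \<Rightarrow> 'a distribution \<Rightarrow> 'a distribution"
  is "\<lambda>a T \<phi>. a * T \<phi>"
  unfolding is_distribution_def by (auto simp: algebra_simps intro: tendsto_mult_right_zero)

instance
  by standard (simp_all add: minus_distribution_def, (transfer; simp add: algebra_simps fun_eq_iff)+)

end

lift_definition dist_deriv :: "'a::euclidean_space \<Rightarrow> 'a distribution \<Rightarrow> 'a distribution"
  is "\<lambda>v T \<phi>. if \<phi> \<in> test_funs then - T (dir_deriv v \<phi>) else 0"
proof -
  fix v :: 'a and T :: "('a \<Rightarrow> real) \<Rightarrow> real"
  assume T: "is_distribution T"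
  have diff: "\<phi> differentiable (at x)" if "\<phi> \<in> test_funs" for \<phi> :: "'a \<Rightarrow> real" and x
    using that smoothD[of \<phi> "[]"] by (simp add: test_funs_def)
  have "(\<lambda>n. if \<phi> n \<in> test_funs then - T (dir_deriv v (\<phi> n)) else 0) \<longlonglongrightarrow> 0"
    if "test_null_seq \<phi>" for \<phi>
  proof -
    have "(\<lambda>n. - T (dir_deriv v (\<phi> n))) \<longlonglongrightarrow> - 0"
      using T test_null_seq_dir_deriv[OF that]
      by (intro tendsto_minus) (auto simp: is_distribution_def)
    then show ?thesis
      using that by (simp add: test_null_seq_def)
  qed
  then show "is_distribution (\<lambda>\<phi>. if \<phi> \<in> test_funs then - T (dir_deriv v \<phi>) else 0)"
    using T unfolding is_distribution_def
    by (auto simp: dir_deriv_add dir_deriv_cmult diff test_funs_add test_funs_cmult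
        test_funs_dir_deriv)
qed


section \<open>The spaces \<open>L\<^sup>2(\<real>)\<close> and \<open>H\<^sup>1(\<real>)\<close> as spaces of distributions\<close>

definition square_integrable :: "(real \<Rightarrow> real) \<Rightarrow> bool"
  where "square_integrable f \<longleftrightarrow>
    f \<in> borel_measurable borel \<and> integrable lborel (\<lambda>x. (f x)\<^sup>2)"

definition L2_repr :: "real distribution \<Rightarrow> (real \<Rightarrow> real) \<Rightarrow> bool"
  where "L2_repr T f \<longleftrightarrow>
    square_integrable f \<and> (\<forall>\<phi>\<in>test_funs. pairing T \<phi> = (LINT x|lborel. f x * \<phi> x))"

definition L2 :: "real distribution set"
  where "L2 = {T. \<exists>f. L2_repr T f}"

text \<open>The representative is unique up to null sets, so the choice below is immaterial. The value
  is meaningful only for \<open>T \<in> L2\<close>.\<close>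

definition L2_norm :: "real distribution \<Rightarrow> real"
  where "L2_norm T = sqrt (LINT x|lborel. ((SOME f. L2_repr T f) x)\<^sup>2)"

definition H1 :: "real distribution set"
  where "H1 = {T \<in> L2. dist_deriv 1 T \<in> L2}"

definition X :: "(real distribution \<times> real distribution) set"
  where "X = H1 \<times> L2"

definition X_norm :: "real distribution \<times> real distribution \<Rightarrow> real"
  where "X_norm = (\<lambda>(f, g).
    sqrt ((L2_norm f)\<^sup>2 + (L2_norm (dist_deriv 1 f))\<^sup>2 + (L2_norm g)\<^sup>2))"


section \<open>Bounded operators and semigroups on a normed space given by a carrier and a norm\<close>

definition bounded_operator_on ::
    "'v::real_vector set \<Rightarrow> ('v \<Rightarrow> real) \<Rightarrow> ('v \<Rightarrow> 'v) \<Rightarrow> bool"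
  where "bounded_operator_on V nrm A \<longleftrightarrow>
    (\<forall>p\<in>V. A p \<in> V) \<and>
    (\<forall>p\<in>V. \<forall>q\<in>V. A (p + q) = A p + A q) \<and>
    (\<forall>a. \<forall>p\<in>V. A (a *\<^sub>R p) = a *\<^sub>R A p) \<and>
    (\<exists>B. \<forall>p\<in>V. nrm (A p) \<le> B * nrm p)"

definition semigroup_property ::
    "'v::real_vector set \<Rightarrow> ('v \<Rightarrow> real) \<Rightarrow> (real \<Rightarrow> 'v \<Rightarrow> 'v) \<Rightarrow> bool"
  where "semigroup_property V nrm G \<longleftrightarrow>
    (\<forall>t\<ge>0. bounded_operator_on V nrm (G t)) \<and>
    (\<forall>p\<in>V. G 0 p = p) \<and>
    (\<forall>t\<ge>0. \<forall>s\<ge>0. \<forall>p\<in>V. G t (G s p) = G (t + s) p)"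


section \<open>The initial value problem\<close>

definition has_time_deriv ::
    "(real \<Rightarrow> real distribution) \<Rightarrow> real distribution \<Rightarrow> real \<Rightarrow> bool"
  where "has_time_deriv u v t \<longleftrightarrow>
    (\<forall>\<phi>\<in>test_funs. ((\<lambda>s. pairing (u s) \<phi>) has_real_derivative pairing v \<phi>) (at t))"

definition time_deriv :: "(real \<Rightarrow> real distribution) \<Rightarrow> real \<Rightarrow> real distribution"
  where "time_deriv u t = (THE v. has_time_deriv u v t)"

text \<open>The space \<open>\<C>\<^sup>1(\<real>, \<D>'(\<real>))\<close>.\<close>

definition C1_distribution :: "(real \<Rightarrow> real distribution) \<Rightarrow> bool"
  where "C1_distribution u \<longleftrightarrow>
    (\<exists>v. (\<forall>t. has_time_deriv u (v t) t) \<and>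
         (\<forall>\<phi>\<in>test_funs. continuous_on UNIV (\<lambda>t. pairing (v t) \<phi>)))"

text \<open>\<open>U\<close> is the family \<open>u\<close> regarded as an element of \<open>\<D>'(\<real> \<times> \<real>)\<close>, with points
  written as \<open>(t, x)\<close>.\<close>

definition spacetime_distribution ::
    "(real \<Rightarrow> real distribution) \<Rightarrow> (real \<times> real) distribution \<Rightarrow> bool"
  where "spacetime_distribution u U \<longleftrightarrow>
    (\<forall>\<Phi>\<in>test_funs. pairing U \<Phi> = (LINT t|lborel. pairing (u t) (\<lambda>x. \<Phi> (t, x))))"

abbreviation D_t :: "(real \<times> real) distribution \<Rightarrow> (real \<times> real) distribution"
  where "D_t \<equiv> dist_deriv (1, 0)"

abbreviation D_x :: "(real \<times> real) distribution \<Rightarrow> (real \<times> real) distribution"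
  where "D_x \<equiv> dist_deriv (0, 1)"

definition is_solution ::
    "real \<Rightarrow> real \<Rightarrow> real distribution \<Rightarrow> real distribution \<Rightarrow> (real \<Rightarrow> real distribution) \<Rightarrow> bool"
  where "is_solution k c f g u \<longleftrightarrow>
    C1_distribution u \<and>
    (\<exists>U. spacetime_distribution u U \<and>
         D_t (D_t U) + k *\<^sub>R D_t U = c\<^sup>2 *\<^sub>R D_x (D_x U)) \<and>
    u 0 = f \<and> time_deriv u 0 = g"

definition solution ::
    "real \<Rightarrow> real \<Rightarrow> real distribution \<Rightarrow> real distribution \<Rightarrow> real \<Rightarrow> real distribution"
  where "solution k c f g = (THE u. is_solution k c f g u)"

definition Gam ::
    "real \<Rightarrow> real \<Rightarrow> real \<Rightarrow> real distribution \<times> real distribution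
      \<Rightarrow> real distribution \<times> real distribution"
  where "Gam k c t = (\<lambda>(f, g). (solution k c f g t, time_deriv (solution k c f g) t))"

end

theory Submission
  imports Defs
begin

text \<open>The function \<open>e\<^bsup>kt/2\<^esup> u\<close> solves \<open>w\<^sub>t\<^sub>t = c\<^sup>2 w\<^sub>x\<^sub>x + (k/2)\<^sup>2 w\<close>, whose fundamental
  solution acts on test functions as an averaging operator with a Bessel kernel. Pairing a solution in
  \<open>\<C>\<^sup>1(\<real>, \<D>')\<close> with the adjoint evolution of a test function gives a quantity that is constant in time;
  this yields uniqueness together with the explicit formula, in which the solution operators are the
  transposes of those averaging operators. Differentiating such a pairing needs joint continuity of
  \<open>(T, \<phi>) \<mapsto> T \<phi>\<close> along sequences, i.e. Banach--Steinhaus for distributions. The semigroup law is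
  uniqueness for the restarted problem. The estimates hold because the averaging operators and
  their \<open>x\<close>-derivatives, after an integration by parts against the kernel, are bounded on \<open>L\<^sup>2\<close>.\<close>

section \<open>Smooth functions\<close>

text \<open>The weak equation says nothing at a single time. It is traded for the system u' = v, v'
  = c^2 u_xx - k v, read against each fixed test function of x; du Bois-Reymond's lemma supplies the
  time derivative of v that membership in C^1 does not give. The Bessel kernel is written as an
  entire power series in \<lambda> rather than through its square root, and the interval
  [x - ct, x + ct] is rescaled to [-1, 1]. Integrals over a fixed interval with a kernel smooth in t
  can be differentiated under the integral sign, and negative t is covered by the same formula. The
  critical terms of the estimates are c^2 f'' in u_t and g' in u_x, which for data in X need not lie
  in L2. The operator with kernel \<open>bessel\<close> gains one derivative: composed with d/dx it
  is again two translations plus a bounded kernel average, so these terms cost only f' and g.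
  Distributions are continuous along sequences, so differentiability of curves of test functions is
  also expressed along arbitrary null sequences of increments.\<close>

abbreviation dx :: "(real \<Rightarrow> real) \<Rightarrow> real \<Rightarrow> real"
  where "dx \<equiv> dir_deriv (1::real)"

lemma dir_deriv_eqI: "(\<phi> has_derivative \<phi>') (at x) \<Longrightarrow> dir_deriv v \<phi> x = \<phi>' v"
  by (simp add: dir_deriv_def frechet_derivative_at[symmetric])

lemma dx_eqI: "(\<phi> has_real_derivative d) (at x) \<Longrightarrow> dx \<phi> x = d"
  by (simp add: dir_deriv_eqI has_field_derivative_def)

lemma differentiable_dx:
  assumes "\<phi> differentiable (at x)"
  shows "(\<phi> has_real_derivative dx \<phi> x) (at x)"
  using assms dx_eqI real_differentiableE by metis

lemma dir_deriv_real: "\<phi> differentiable (at x) \<Longrightarrow> dir_deriv v \<phi> x = v * dx \<phi> x"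
  by (metis differentiable_dx dir_deriv_eqI has_field_derivative_def mult.commute)

lemma smooth_differentiable: "smooth \<phi> \<Longrightarrow> \<phi> differentiable (at x)"
  using smoothD[of \<phi> "[]"] by simp

lemma smooth_dir_deriv: "smooth \<phi> \<Longrightarrow> smooth (dir_deriv v \<phi>)"
  by (subst smooth_def) (auto simp: foldr_dir_deriv_snoc simp del: foldr_append intro!: smoothD)

text \<open>\<open>smooth\<close> speaks about all iterated derivatives at once. A class of
  differentiable functions closed under \<open>dir_deriv\<close> contains all of them, so smoothness
  proofs reduce to guessing such a class.\<close>

lemma smooth_coinduct:
  assumes "\<phi> \<in> A" "\<And>\<psi> x. \<psi> \<in> A \<Longrightarrow> \<psi> differentiable (at x)" "\<And>\<psi> v. \<psi> \<in> A \<Longrightarrow> dir_deriv v \<psi> \<in> A"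
  shows "smooth \<phi>"
proof -
  have "foldr dir_deriv vs \<phi> \<in> A" for vs
    by (induction vs) (simp_all add: assms(1,3))
  then show ?thesis
    unfolding smooth_def using assms(2) by blast
qed

lemma smooth_add: "smooth \<phi> \<Longrightarrow> smooth \<psi> \<Longrightarrow> smooth (\<lambda>x. \<phi> x + \<psi> x)"
  by (subst smooth_def) (auto simp: foldr_dir_deriv_add intro!: smoothD differentiable_add)

lemma smooth_cmult: "smooth \<phi> \<Longrightarrow> smooth (\<lambda>x. a * \<phi> x)"
  by (subst smooth_def) (auto simp: foldr_dir_deriv_cmult intro!: smoothD differentiable_mult)

lemma smooth_dx_pow: "smooth \<phi> \<Longrightarrow> smooth ((dx ^^ n) \<phi>)"
  by (induction n) (auto intro: smooth_dir_deriv)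

lemma smooth_has_deriv:
  "smooth \<phi> \<Longrightarrow> ((dx ^^ n) \<phi> has_real_derivative (dx ^^ Suc n) \<phi> x) (at x)"
  by (simp add: differentiable_dx smooth_differentiable smooth_dx_pow)

lemma smooth_has_deriv_0: "smooth \<phi> \<Longrightarrow> (\<phi> has_real_derivative dx \<phi> x) (at x)"
  by (simp add: differentiable_dx smooth_differentiable)

lemma smooth_continuous: "smooth \<phi> \<Longrightarrow> continuous_on A \<phi>"
  by (meson continuous_at_imp_continuous_on differentiable_imp_continuous_within smooth_differentiable)

text \<open>On the line a direction is a number and only rescales the derivative. Conditions on all
  lists of directions thus collapse to conditions on the powers of \<open>dx\<close>.\<close>

lemma foldr_dir_deriv_real:
  "smooth \<phi> \<Longrightarrow> foldr dir_deriv vs \<phi> = (\<lambda>x. prod_list vs * (dx ^^ length vs) \<phi> x)"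
proof (induction vs)
  case (Cons v vs)
  have "dir_deriv v (\<lambda>x. prod_list vs * (dx ^^ length vs) \<phi> x) =
      (\<lambda>x. prod_list vs * dir_deriv v ((dx ^^ length vs) \<phi>) x)"
    by (rule dir_deriv_cmult) (simp add: Cons.prems smooth_differentiable smooth_dx_pow)
  also have "\<dots> = (\<lambda>x. prod_list (v # vs) * (dx ^^ length (v # vs)) \<phi> x)"
    by (subst dir_deriv_real) (simp_all add: Cons.prems smooth_differentiable smooth_dx_pow mult_ac)
  finally show ?case
    by (simp add: Cons)
qed simp

text \<open>A ladder \<open>g\<close> in which each function differentiates to the next identifies
  all derivatives at once. Series, averages, sections and antiderivatives are shown smooth by
  writing down their ladder.\<close>

lemma
  assumes "\<And>n x. (g n has_real_derivative g (Suc n) x) (at x)"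
  shows smooth_realI: "smooth (g 0)" and dx_pow_eq: "(dx ^^ n) (g 0) = g n"
proof -
  have diff: "g n differentiable (at x)" for n x
    using assms real_differentiable_def by blast
  have dxg: "dx (g n) = g (Suc n)" for n
    by (rule ext) (rule dx_eqI[OF assms])
  have dv: "dir_deriv v (\<lambda>x. a * g n x) = (\<lambda>x. (v * a) * g (Suc n) x)" for v a n
  proof
    fix x
    have "dir_deriv v (\<lambda>x. a * g n x) x = a * dir_deriv v (g n) x"
      by (subst dir_deriv_cmult[OF diff]) (rule refl)
    also have "\<dots> = (v * a) * g (Suc n) x"
      by (subst dir_deriv_real[OF diff], subst dxg) (simp only: ac_simps)
    finally show "dir_deriv v (\<lambda>x. a * g n x) x = (v * a) * g (Suc n) x" .
  qed
  \<comment> \<open>Scalar factors are included because differentiating in direction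
    \<open>v\<close> multiplies by \<open>v\<close>.\<close>
  define A where "A = range (\<lambda>(a, n) x. a * g n x)"
  have AI: "(\<lambda>x. a * g n x) \<in> A" for a n
    by (auto simp: A_def image_iff)
  show "smooth (g 0)"
  proof (rule smooth_coinduct[of _ A])
    show "g 0 \<in> A"
      using AI[of 1 0] by simp
    show "\<psi> differentiable (at x)" if \<psi>: "\<psi> \<in> A" for \<psi> x
    proof -
      obtain a n where "\<psi> = (\<lambda>x. a * g n x)"
        using \<psi> by (auto simp: A_def)
      then show ?thesis
        by (simp only:) (intro differentiable_mult differentiable_const diff)
    qed
    show "dir_deriv v \<psi> \<in> A" if \<psi>: "\<psi> \<in> A" for \<psi> v
    proof -
      obtain a n where "\<psi> = (\<lambda>x. a * g n x)"
        using \<psi> by (auto simp: A_def)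
      then show ?thesis
        using AI by (simp only: dv)
    qed
  qed
  show "(dx ^^ n) (g 0) = g n"
  proof (induction n)
    case 0
    show ?case by (simp only: funpow.simps id_apply)
  next
    case (Suc n)
    then show ?case using dxg by (simp only: funpow.simps o_apply)
  qed
qed

text \<open>By the Leibniz rule the derivative of a product is a sum of two products, so single
  products are not closed under \<open>dir_deriv\<close>. Finite sums of products are; lists of
  pairs of factors encode them.\<close>

lemma smooth_mult:
  assumes "smooth \<phi>" "smooth \<psi>"
  shows "smooth (\<lambda>x. \<phi> x * \<psi> x)"
proof -
  define S where "S L = (\<lambda>x. \<Sum>(f, g)\<leftarrow>L. f x * g x)" for L :: "(('a \<Rightarrow> real) \<times> ('a \<Rightarrow> real)) list"
  define ok where "ok L \<longleftrightarrow> (\<forall>(f, g)\<in>set L. smooth f \<and> smooth g)"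
    for L :: "(('a \<Rightarrow> real) \<times> ('a \<Rightarrow> real)) list"
  have diff: "S L differentiable (at x)" if "ok L" for L x
    using that by (induction L) (auto simp: S_def ok_def intro!: differentiable_add differentiable_mult intro: smooth_differentiable)
  have dS: "\<exists>L'. ok L' \<and> dir_deriv v (S L) = S L'" if "ok L" for v L
    using that
  proof (induction L)
    case Nil
    show ?case
      by (rule exI[of _ "[]"]) (auto simp: S_def ok_def intro!: ext dir_deriv_eqI derivative_eq_intros)
  next
    case (Cons p L)
    obtain f g where p: "p = (f, g)" by force
    have fg: "smooth f" "smooth g" and L: "ok L"
      using Cons.prems by (auto simp: ok_def p)
    obtain L' where L': "ok L'" "dir_deriv v (S L) = S L'"
      using Cons.IH L by auto
    have "dir_deriv v (S (p # L)) = (\<lambda>x. dir_deriv v (\<lambda>x. f x * g x) x + dir_deriv v (S L) x)"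
      using dir_deriv_add[of "\<lambda>x. f x * g x" "S L" v] fg L diff
      by (simp add: S_def p smooth_differentiable)
    also have "dir_deriv v (\<lambda>x. f x * g x) = (\<lambda>x. f x * dir_deriv v g x + dir_deriv v f x * g x)"
    proof
      fix x
      have "((\<lambda>x. f x * g x) has_derivative (\<lambda>h. f x * frechet_derivative g (at x) h +
          frechet_derivative f (at x) h * g x)) (at x)"
        using fg by (intro has_derivative_mult) (simp_all add: smooth_differentiable frechet_derivative_works[symmetric])
      then show "dir_deriv v (\<lambda>x. f x * g x) x = f x * dir_deriv v g x + dir_deriv v f x * g x"
        by (subst dir_deriv_eqI) (simp_all add: dir_deriv_def)
    qed
    finally have "dir_deriv v (S (p # L)) = S ((f, dir_deriv v g) # (dir_deriv v f, g) # L')"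
      by (simp add: L'(2)) (simp add: S_def add.assoc)
    moreover have "ok ((f, dir_deriv v g) # (dir_deriv v f, g) # L')"
      using L' fg by (auto simp: ok_def smooth_dir_deriv)
    ultimately show ?case by blast
  qed
  show ?thesis
  proof (rule smooth_coinduct[of _ "S ` Collect ok"])
    show "(\<lambda>x. \<phi> x * \<psi> x) \<in> S ` Collect ok"
      using assms by (auto simp: S_def ok_def intro!: image_eqI[where x = "[(\<phi>, \<psi>)]"])
  next
    show "\<psi> differentiable (at x)" if "\<psi> \<in> S ` Collect ok" for \<psi> x
      using that diff by auto
    show "dir_deriv v \<psi> \<in> S ` Collect ok" if \<psi>: "\<psi> \<in> S ` Collect ok" for \<psi> v
    proof -
      obtain L where L: "ok L" "\<psi> = S L" using \<psi> by blast
      obtain L' where "ok L'" "dir_deriv v (S L) = S L'" using dS[OF L(1)] by blast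
      then show ?thesis using L(2) by blast
    qed
  qed
qed

lemma has_derivative_comp_affine:
  fixes \<phi> :: "real \<Rightarrow> real"
  assumes "smooth \<phi>" "bounded_linear l"
  shows "((\<lambda>x. \<phi> (l x + b)) has_derivative (\<lambda>h. l h * dx \<phi> (l x + b))) (at x)"
proof -
  have "(\<phi> has_derivative (\<lambda>h. h * dx \<phi> (l x + b))) (at (l x + b))"
    using smooth_has_deriv_0[OF assms(1), of "l x + b"] by (simp add: has_field_derivative_def mult_commute_abs)
  moreover have "((\<lambda>x. l x + b) has_derivative (\<lambda>h. l h + 0)) (at x)"
    using assms(2) by (rule has_derivative_add[OF bounded_linear_imp_has_derivative has_derivative_const])
  ultimately have "((\<lambda>x. \<phi> (l x + b)) has_derivative (\<lambda>h. (l h + 0) * dx \<phi> (l x + b))) (at x)"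
    by (rule has_derivative_compose[rotated])
  then show ?thesis by simp
qed

lemma dir_deriv_comp_affine:
  fixes \<phi> :: "real \<Rightarrow> real"
  assumes "smooth \<phi>" "bounded_linear l"
  shows "dir_deriv v (\<lambda>x. \<phi> (l x + b)) = (\<lambda>x. l v * dx \<phi> (l x + b))"
  by (rule ext, rule dir_deriv_eqI, rule has_derivative_comp_affine[OF assms])

lemma smooth_comp_affine:
  fixes \<phi> :: "real \<Rightarrow> real"
  assumes "smooth \<phi>" "bounded_linear l"
  shows "smooth (\<lambda>x. \<phi> (l x + b))"
\<comment> \<open>The scalar \<open>a\<close> absorbs the factor \<open>l v\<close> that the chain
  rule produces at each differentiation.\<close>
proof (rule smooth_coinduct[of _ "{\<lambda>x. a * \<psi> (l x + b) |a \<psi>. smooth \<psi>}"])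
  show "(\<lambda>x. \<phi> (l x + b)) \<in> {\<lambda>x. a * \<psi> (l x + b) |a \<psi>. smooth \<psi>}"
    using assms by (auto intro!: exI[of _ 1] exI[of _ \<phi>])
next
  fix \<psi> x assume "\<psi> \<in> {\<lambda>x. a * \<psi> (l x + b) |a \<psi>. smooth \<psi>}"
  then show "\<psi> differentiable (at x)"
    using has_derivative_comp_affine[OF _ assms(2)] by (fastforce intro!: differentiable_mult simp: differentiable_def)
next
  fix \<psi> v assume "\<psi> \<in> {\<lambda>x. a * \<psi> (l x + b) |a \<psi>. smooth \<psi>}"
  then obtain a \<theta> where \<psi>: "\<psi> = (\<lambda>x. a * \<theta> (l x + b))" and \<theta>: "smooth \<theta>" by auto
  have "dir_deriv v \<psi> = (\<lambda>x. (a * l v) * dx \<theta> (l x + b))"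
    unfolding \<psi> using has_derivative_comp_affine[OF \<theta> assms(2)]
    by (subst dir_deriv_cmult) (auto simp: dir_deriv_comp_affine[OF \<theta> assms(2)] differentiable_def mult_ac)
  then show "dir_deriv v \<psi> \<in> {\<lambda>x. a * \<psi> (l x + b) |a \<psi>. smooth \<psi>}"
    using smooth_dir_deriv[OF \<theta>] by blast
qed

section \<open>Test functions: supports, bounds and null sequences\<close>

lemma test_funsI:
  assumes "smooth \<phi>" "compact K" "\<And>x. \<phi> x \<noteq> 0 \<Longrightarrow> x \<in> K"
  shows "\<phi> \<in> test_funs"
proof -
  have "closure {x. \<phi> x \<noteq> 0} \<subseteq> K"
    using assms by (intro closure_minimal) (auto simp: compact_imp_closed)
  then have "compact (closure {x. \<phi> x \<noteq> 0})"
    using assms(2) compact_closed_subset closed_closure by blast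
  then show ?thesis
    using assms(1) by (simp add: test_funs_def del: compact_closure)
qed

lemma test_funs_support:
  assumes "\<phi> \<in> test_funs"
  obtains K where "compact K" "\<And>x. \<phi> x \<noteq> 0 \<Longrightarrow> x \<in> K"
proof (rule that)
  show "compact (closure {x. \<phi> x \<noteq> 0})"
    using assms by (simp add: test_funs_def del: compact_closure)
  show "x \<in> closure {x. \<phi> x \<noteq> 0}" if "\<phi> x \<noteq> 0" for x
    using that closure_subset[of "{x. \<phi> x \<noteq> 0}"] by blast
qed

lemma test_funs_smooth: "\<phi> \<in> test_funs \<Longrightarrow> smooth \<phi>"
  by (simp add: test_funs_def)

lemma test_funs_bounded:
  assumes "\<phi> \<in> test_funs"
  obtains B where "\<And>x. \<bar>\<phi> x\<bar> \<le> B"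
proof -
  obtain K where K: "compact K" "\<And>x. \<phi> x \<noteq> 0 \<Longrightarrow> x \<in> K"
    using assms test_funs_support by blast
  have "compact (\<phi> ` K)"
    using K assms by (intro compact_continuous_image smooth_continuous) (auto simp: test_funs_smooth)
  then obtain B where B: "\<And>y. y \<in> \<phi> ` K \<Longrightarrow> \<bar>y\<bar> \<le> B" by (metis compact_imp_bounded bounded_iff real_norm_def)
  have "\<bar>\<phi> x\<bar> \<le> max B 0" for x
    using B K by (cases "\<phi> x = 0") fastforce+
  then show ?thesis using that by blast
qed

lemma test_funs_dx_pow: "\<phi> \<in> test_funs \<Longrightarrow> (dx ^^ n) \<phi> \<in> test_funs"
  by (induction n) (auto intro: test_funs_dir_deriv)

lemma compact_real_interval:
  fixes K :: "real set"
  assumes "compact K"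
  obtains R where "R > 0" "K \<subseteq> {-R..R}"
proof -
  obtain B where "\<And>x. x \<in> K \<Longrightarrow> \<bar>x\<bar> \<le> B"
    using assms by (metis compact_imp_bounded bounded_iff real_norm_def)
  then have "K \<subseteq> {-(\<bar>B\<bar> + 1)..\<bar>B\<bar> + 1}" by force
  then show ?thesis using that[of "\<bar>B\<bar> + 1"] by simp
qed

lemma test_funs_interval:
  fixes \<phi> :: "real \<Rightarrow> real"
  assumes "\<phi> \<in> test_funs"
  obtains R where "R > 0" "\<And>x. \<phi> x \<noteq> 0 \<Longrightarrow> x \<in> {-R..R}"
proof -
  obtain K where K: "compact K" "\<And>x. \<phi> x \<noteq> 0 \<Longrightarrow> x \<in> K"
    using test_funs_support[OF assms] by blast
  obtain R where "R > 0" "K \<subseteq> {-R..R}"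
    using compact_real_interval[OF K(1)] by blast
  then show ?thesis
    using K(2) that by blast
qed

lemma test_null_seq_realI:
  fixes \<phi> :: "nat \<Rightarrow> real \<Rightarrow> real"
  assumes "\<And>n. \<phi> n \<in> test_funs" "compact K" "\<And>n x. \<phi> n x \<noteq> 0 \<Longrightarrow> x \<in> K"
    and "\<And>q. uniform_limit UNIV (\<lambda>n. (dx ^^ q) (\<phi> n)) (\<lambda>_. 0) sequentially"
  shows "test_null_seq \<phi>"
proof -
  have "uniform_limit UNIV (\<lambda>n. foldr dir_deriv vs (\<phi> n)) (\<lambda>_. 0) sequentially" for vs
  proof -
    have "uniform_limit UNIV (\<lambda>n x. prod_list vs * (dx ^^ length vs) (\<phi> n) x) (\<lambda>x. prod_list vs * 0) sequentially"
      by (rule bounded_linear.uniform_limit[OF bounded_linear_mult_right assms(4)])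
    then show ?thesis
      using assms(1) by (simp add: foldr_dir_deriv_real test_funs_smooth)
  qed
  then show ?thesis
    using assms by (auto simp: test_null_seq_def)
qed

lemma foldr_replicate: "foldr f (replicate n a) = (f a ^^ n)"
  by (induction n) auto

lemma test_null_seq_dx_pow:
  assumes "test_null_seq \<phi>"
  shows "uniform_limit UNIV (\<lambda>n. (dx ^^ q) (\<phi> n)) (\<lambda>_. 0) sequentially"
proof -
  have "uniform_limit UNIV (\<lambda>n. foldr dir_deriv (replicate q 1) (\<phi> n)) (\<lambda>_. 0) sequentially"
    using assms unfolding test_null_seq_def by blast
  then show ?thesis
    by (simp add: foldr_replicate)
qed

section \<open>Bump functions\<close>

definition flat :: "real \<Rightarrow> real"
  where "flat x = (if x > 0 then exp (- 1 / x) else 0)"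

text \<open>With y = 1/x, the x-derivative of p(y) exp(-y) is y^2 (p(y) - p'(y)) exp(-y), which is
  the recursion \<open>Q\<close> on polynomials. At 0 the right difference quotient becomes y p(y)
  exp(-y) with y = 1/h tending to infinity, hence tends to 0.\<close>

lemma smooth_flat: "smooth flat"
proof -
  define F where "F p x = (if x > 0 then poly p (1 / x) * exp (- 1 / x) else 0)" for p and x :: real
  define Q :: "real poly \<Rightarrow> real poly" where "Q p = monom 1 2 * (p - pderiv p)" for p
  have lim: "((\<lambda>y. poly p y * exp (- y)) \<longlongrightarrow> 0) at_top" for p :: "real poly"
  proof -
    have "((\<lambda>y. \<Sum>i\<le>degree p. coeff p i * (y ^ i / exp y)) \<longlongrightarrow> (\<Sum>i\<le>degree p. coeff p i * 0)) at_top"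
      by (intro tendsto_sum tendsto_mult tendsto_const tendsto_power_div_exp_0)
    then show ?thesis
      by (simp add: poly_altdef sum_distrib_right exp_minus divide_inverse mult.assoc)
  qed
  have F': "(F p has_real_derivative F (Q p) x) (at x)" for p x
  proof -
    consider "x > 0" | "x < 0" | "x = 0" by linarith
    then show ?thesis
    proof cases
      case 1
      have "((\<lambda>x. poly p (1 / x) * exp (- 1 / x)) has_real_derivative F (Q p) x) (at x)"
        using 1 by (auto intro!: derivative_eq_intros simp: F_def Q_def poly_monom power2_eq_square field_simps)
      then show ?thesis
        by (rule DERIV_cong_ev[THEN iffD1, OF refl _ refl, rotated])
          (use 1 eventually_nhds_in_open[of "{0<..}" x] in \<open>auto elim!: eventually_mono simp: F_def\<close>)
    next
      case 2
      have "((\<lambda>x. 0) has_real_derivative F (Q p) x) (at x)"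
        using 2 by (simp add: F_def)
      then show ?thesis
        by (rule DERIV_cong_ev[THEN iffD1, OF refl _ refl, rotated])
          (use 2 eventually_nhds_in_open[of "{..<0}" x] in \<open>auto elim!: eventually_mono simp: F_def\<close>)
    next
      case 3
      have "((\<lambda>h. F p h / h) \<longlongrightarrow> 0) (at_right 0)"
      proof -
        have "((\<lambda>y. poly (monom 1 1 * p) y * exp (- y)) \<longlongrightarrow> 0) at_top" by (rule lim)
        then have "((\<lambda>h. poly (monom 1 1 * p) (inverse h) * exp (- inverse h)) \<longlongrightarrow> 0) (at_right 0)"
          by (rule filterlim_compose[OF _ filterlim_inverse_at_top_right])
        then show ?thesis
          by (rule Lim_transform_eventually)
            (auto simp: eventually_at_right_field F_def poly_monom field_simps intro!: exI[of _ 1])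
      qed
      moreover have "((\<lambda>h. F p h / h) \<longlongrightarrow> 0) (at_left 0)"
        by (rule Lim_transform_eventually[OF tendsto_const])
          (auto simp: eventually_at_left_field F_def intro!: exI[of _ "-1"])
      ultimately have "((\<lambda>h. F p h / h) \<longlongrightarrow> 0) (at 0)"
        by (simp add: filterlim_split_at)
      then show ?thesis
        using 3 by (simp add: DERIV_def F_def)
    qed
  qed
  have "flat = F ((Q ^^ 0) 1)"
    by (auto simp: flat_def F_def)
  then show ?thesis
    using smooth_realI[of "\<lambda>n. F ((Q ^^ n) 1)"] F' by simp
qed

lemma flat_nonneg: "0 \<le> flat x" and flat_le_1: "flat x \<le> 1"
  and flat_eq_0: "x \<le> 0 \<Longrightarrow> flat x = 0"
  by (auto simp: flat_def)

text \<open>Smooth minorants of the indicator of (a, b) that converge to it pointwise as n grows;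
  they link test functions to integrals over intervals.\<close>

definition bump :: "real \<Rightarrow> real \<Rightarrow> real \<Rightarrow> real \<Rightarrow> real"
  where "bump n a b x = flat (n * (x - a)) * flat (n * (b - x))"

lemma bump_test_funs:
  assumes "n > 0" shows "bump n a b \<in> test_funs"
proof (rule test_funsI)
  have "smooth (\<lambda>x. flat (n * x + (- n * a)) * flat (- n * x + n * b))"
    by (intro smooth_mult smooth_comp_affine[OF smooth_flat]) (rule bounded_linear_mult_right)+
  then show "smooth (bump n a b)"
    by (simp add: bump_def[abs_def] algebra_simps)
  show "compact {a..b}" by simp
  show "x \<in> {a..b}" if "bump n a b x \<noteq> 0" for x
  proof -
    have "\<not> n * (x - a) \<le> 0" "\<not> n * (b - x) \<le> 0"
      using that flat_eq_0 by (auto simp: bump_def)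
    then show ?thesis
      using assms by (auto simp: mult_le_0_iff)
  qed
qed

lemma bump_zero: "n > 0 \<Longrightarrow> x \<notin> {a<..<b} \<Longrightarrow> bump n a b x = 0"
  by (auto simp: bump_def not_less flat_eq_0 mult_le_0_iff)

lemma bump_nonneg: "bump n a b x \<ge> 0"
  by (simp add: bump_def flat_nonneg)

lemma bump_le_indicator: "n > 0 \<Longrightarrow> bump n a b x \<le> indicator {a<..<b} x"
  by (auto simp: indicator_def bump_zero) (auto simp: bump_def intro!: mult_le_one flat_le_1 flat_nonneg)

lemma bump_tendsto: "(\<lambda>n. bump (real (Suc n)) a b x) \<longlonglongrightarrow> indicator {a<..<b} x"
proof (cases "x \<in> {a<..<b}")
  case True
  have "(\<lambda>n. flat (real (Suc n) * y)) \<longlonglongrightarrow> 1" if "y > 0" for y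
  proof -
    have "(\<lambda>n. exp (- (1 / y) * inverse (real (Suc n)))) \<longlonglongrightarrow> exp (- (1 / y) * 0)"
      by (intro tendsto_intros LIMSEQ_inverse_real_of_nat)
    then show ?thesis
      using that by (simp add: flat_def divide_inverse mult.commute)
  qed
  from tendsto_mult[OF this[of "x - a"] this[of "b - x"]] True show ?thesis
    by (simp add: bump_def)
qed (simp add: bump_zero)

section \<open>Representatives in \<open>L\<^sup>2(\<real>)\<close>\<close>

lemma test_funs_measurable [measurable_dest]:
  fixes \<phi> :: "real \<Rightarrow> real"
  shows "\<phi> \<in> test_funs \<Longrightarrow> \<phi> \<in> borel_measurable borel"
  by (intro borel_measurable_continuous_onI smooth_continuous test_funs_smooth)

lemma square_integrable_measurable [measurable_dest]:
  "square_integrable f \<Longrightarrow> f \<in> borel_measurable borel"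
  by (simp add: square_integrable_def)

lemma square_integrable_mult:
  assumes "square_integrable f" "square_integrable g"
  shows "integrable lborel (\<lambda>x. f x * g x)"
proof (rule Bochner_Integration.integrable_bound)
  show "integrable lborel (\<lambda>x. (f x)\<^sup>2 + (g x)\<^sup>2)"
    using assms by (simp add: square_integrable_def)
  show "(\<lambda>x. f x * g x) \<in> borel_measurable lborel"
    using assms[THEN square_integrable_measurable] by simp
  have "\<bar>a * b\<bar> \<le> a\<^sup>2 + b\<^sup>2" for a b :: real
  proof -
    have "0 \<le> (\<bar>a\<bar> - \<bar>b\<bar>)\<^sup>2" by simp
    then have "2 * (\<bar>a\<bar> * \<bar>b\<bar>) \<le> a\<^sup>2 + b\<^sup>2"
      by (simp add: power2_diff)
    moreover have "0 \<le> \<bar>a\<bar> * \<bar>b\<bar>" by simp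
    ultimately have "\<bar>a\<bar> * \<bar>b\<bar> \<le> a\<^sup>2 + b\<^sup>2" by linarith
    then show ?thesis by (simp add: abs_mult)
  qed
  then show "AE x in lborel. norm (f x * g x) \<le> norm ((f x)\<^sup>2 + (g x)\<^sup>2)"
    by simp
qed

lemma square_integrable_add:
  assumes "square_integrable f" "square_integrable g"
  shows "square_integrable (\<lambda>x. f x + g x)"
proof -
  have "integrable lborel (\<lambda>x. (f x)\<^sup>2 + 2 * (f x * g x) + (g x)\<^sup>2)"
    using assms square_integrable_mult[OF assms] by (simp add: square_integrable_def)
  then show ?thesis
    using assms[THEN square_integrable_measurable] by (simp add: square_integrable_def power2_sum algebra_simps)
qed

lemma square_integrable_cmult:
  assumes "square_integrable f"
  shows "square_integrable (\<lambda>x. a * f x)"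
  using assms square_integrable_measurable[OF assms] by (simp add: square_integrable_def power_mult_distrib)

lemma square_integrable_bounded_support:
  fixes f :: "real \<Rightarrow> real"
  assumes "f \<in> borel_measurable borel" "\<And>x. \<bar>f x\<bar> \<le> B" "\<And>x. f x \<noteq> 0 \<Longrightarrow> x \<in> {a..b}"
  shows "square_integrable f"
proof -
  have "integrable lborel (\<lambda>x. (f x)\<^sup>2)"
  proof (rule Bochner_Integration.integrable_bound)
    show "integrable lborel (\<lambda>x. B\<^sup>2 * indicator {a..b} x :: real)"
      by (intro integrable_mult_right integrable_real_indicator) (simp_all add: emeasure_lborel_Icc_eq)
    have "(f x)\<^sup>2 \<le> B\<^sup>2 * indicator {a..b} x" for x
      using assms(2)[of x] assms(3)[of x] by (cases "f x = 0") (auto simp: abs_le_square_iff[symmetric])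
    then show "AE x in lborel. norm ((f x)\<^sup>2) \<le> norm (B\<^sup>2 * indicator {a..b} x :: real)"
      by (simp add: order_trans[OF _ abs_ge_self])
  qed (use assms(1) in simp)
  then show ?thesis
    using assms(1) by (simp add: square_integrable_def)
qed

lemma square_integrable_test_funs:
  assumes "\<phi> \<in> test_funs"
  shows "square_integrable \<phi>"
proof -
  obtain B where B: "\<And>x. \<bar>\<phi> x\<bar> \<le> B"
    using test_funs_bounded[OF assms] by blast
  obtain R where R: "\<And>x. \<phi> x \<noteq> 0 \<Longrightarrow> x \<in> {-R..R}"
    using test_funs_interval[OF assms] by blast
  show ?thesis
    using test_funs_measurable[OF assms] B R by (rule square_integrable_bounded_support)
qed

text \<open>Testing with \<open>bump\<close> and dominated convergence give integral zero over every
  open interval. These intervals form an intersection-stable generator of the Borel sets, so the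
  truncation of \<open>h\<close> to (-R, R) has integral zero over all Borel sets and vanishes
  almost everywhere. The truncation accounts for \<open>h\<close> being only locally
  integrable.\<close>

lemma fundamental_lemma:
  fixes h :: "real \<Rightarrow> real"
  assumes h: "\<And>R. integrable lborel (\<lambda>x. indicator {-R<..<R} x * h x)"
    and [measurable]: "h \<in> borel_measurable borel"
    and zero: "\<And>\<phi>. \<phi> \<in> test_funs \<Longrightarrow> (LINT x|lborel. h x * \<phi> x) = 0"
  shows "AE x in lborel. h x = 0"
proof -
  have ind: "integrable lborel (\<lambda>x. indicator {a<..<b} x * h x)" for a b
  proof (rule Bochner_Integration.integrable_bound)
    show "integrable lborel (\<lambda>x. indicator {-(\<bar>a\<bar> + \<bar>b\<bar>)<..<\<bar>a\<bar> + \<bar>b\<bar>} x * h x)"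
      by (rule h)
  qed (auto simp: indicator_def abs_mult)
  have int0: "(LINT x|lborel. indicator {a<..<b} x * h x) = 0" for a b
  proof -
    have "(\<lambda>n. LINT x|lborel. h x * bump (real (Suc n)) a b x) \<longlonglongrightarrow> (LINT x|lborel. indicator {a<..<b} x * h x)"
    proof (rule integral_dominated_convergence)
      show "integrable lborel (\<lambda>x. \<bar>indicator {a<..<b} x * h x\<bar>)"
        using ind by (rule integrable_abs)
      show "(\<lambda>x. h x * bump (real (Suc n)) a b x) \<in> borel_measurable lborel" for n
        using test_funs_measurable[OF bump_test_funs[of "real (Suc n)" a b]] by simp
      show "AE x in lborel. (\<lambda>n. h x * bump (real (Suc n)) a b x) \<longlonglongrightarrow> indicator {a<..<b} x * h x"
        by (subst mult.commute) (intro always_eventually allI tendsto_mult tendsto_const bump_tendsto)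
      show "AE x in lborel. norm (h x * bump (real (Suc n)) a b x) \<le> \<bar>indicator {a<..<b} x * h x\<bar>" for n
      proof (intro always_eventually allI)
        fix x
        show "norm (h x * bump (real (Suc n)) a b x) \<le> \<bar>indicator {a<..<b} x * h x\<bar>"
          using bump_le_indicator[of "real (Suc n)" a b x] bump_nonneg[of "real (Suc n)" a b x]
          by (simp add: abs_mult mult.commute mult_left_mono)
      qed
    qed simp
    moreover have "(LINT x|lborel. h x * bump (real (Suc n)) a b x) = 0" for n
      by (intro zero bump_test_funs) simp
    ultimately show ?thesis
      using LIMSEQ_unique[OF _ tendsto_const] by simp
  qed
  have "AE x in lborel. indicator {-R<..<R} x * h x = 0" for R
  proof (rule density_unique_real)
    show "integrable lborel (\<lambda>x. indicator {-R<..<R} x * h x)" by (rule h)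
    fix A :: "real set" assume "A \<in> sets lborel"
    moreover have eq: "range (\<lambda>(a, b). box a b) = range (\<lambda>(a, b). {a<..<b::real})"
      by auto
    have "sets borel = sigma_sets UNIV (range (\<lambda>(a, b). {a<..<b::real}))"
      unfolding borel_eq_box[where 'a = real] eq by simp
    ultimately have A: "A \<in> sigma_sets UNIV (range (\<lambda>(a, b). {a<..<b}))"
      by simp
    have top_Pow: "range (\<lambda>(a, b). {a<..<b::real}) \<subseteq> Pow UNIV"
      by simp
    have stable: "Int_stable (range (\<lambda>(a, b). {a<..<b::real}))"
    proof (rule Int_stableI)
      fix A B assume "A \<in> range (\<lambda>(a, b). {a<..<b::real})" "B \<in> range (\<lambda>(a, b). {a<..<b::real})"
      then obtain a b c d where "A = {a<..<b}" "B = {c<..<d}" by auto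
      then have "A \<inter> B = (\<lambda>(a, b). {a<..<b}) (max a c, min b d)" by auto
      then show "A \<inter> B \<in> range (\<lambda>(a, b). {a<..<b})" by (metis rangeI)
    qed
    have "A \<in> sets borel \<and> (LINT x:A|lborel. indicator {-R<..<R} x * h x) = 0"
      using stable top_Pow A
    proof (induction A rule: sigma_sets_induct_disjoint)
      fix A assume "A \<in> range (\<lambda>(a, b). {a<..<b::real})"
      then obtain a b where A: "A = {a<..<b}" by auto
      have "(LINT x:A|lborel. indicator {-R<..<R} x * h x) =
          (LINT x|lborel. indicator {max a (-R)<..<min b R} x * h x)"
        unfolding set_lebesgue_integral_def A by (intro Bochner_Integration.integral_cong) (auto simp: indicator_def)
      then show "A \<in> sets borel \<and> (LINT x:A|lborel. indicator {-R<..<R} x * h x) = 0"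
        using int0 A by simp
    next
      fix A assume A: "A \<in> sigma_sets UNIV (range (\<lambda>(a, b). {a<..<b::real}))"
        "A \<in> sets borel \<and> (LINT x:A|lborel. indicator {-R<..<R} x * h x) = 0"
      then have [measurable]: "A \<in> sets borel" by simp
      have "(LINT x:UNIV - A|lborel. indicator {-R<..<R} x * h x) =
          (LINT x|lborel. indicator {-R<..<R} x * h x - indicator A x *\<^sub>R (indicator {-R<..<R} x * h x))"
        unfolding set_lebesgue_integral_def by (intro Bochner_Integration.integral_cong) (auto simp: indicator_def)
      also have "\<dots> = 0"
        using A(2) by (subst Bochner_Integration.integral_diff)
          (auto simp: h int0 set_lebesgue_integral_def simp del: real_scaleR_def intro!: integrable_mult_indicator)
      finally show "UNIV - A \<in> sets borel \<and> (LINT x:UNIV - A|lborel. indicator {-R<..<R} x * h x) = 0"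
        by auto
    next
      fix A :: "nat \<Rightarrow> real set"
      assume A: "disjoint_family A" "range A \<subseteq> sigma_sets UNIV (range (\<lambda>(a, b). {a<..<b}))"
        "\<And>i. A i \<in> sets borel \<and> (LINT x:A i|lborel. indicator {-R<..<R} x * h x) = 0"
      have "(LINT x:(\<Union>i. A i)|lborel. indicator {-R<..<R} x * h x) =
          (\<Sum>i. LINT x:A i|lborel. indicator {-R<..<R} x * h x)"
        using A by (intro lebesgue_integral_countable_add)
          (auto simp: disjoint_family_on_def set_integrable_def simp del: real_scaleR_def intro!: integrable_mult_indicator h)
      then show "(\<Union>i. A i) \<in> sets borel \<and> (LINT x:(\<Union>i. A i)|lborel. indicator {-R<..<R} x * h x) = 0"
        using A by auto
    qed (auto simp: set_lebesgue_integral_def)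
    then show "(LINT x:A|lborel. indicator {-R<..<R} x * h x) = (LINT x:A|lborel. 0)"
      by (simp add: set_lebesgue_integral_def)
  qed simp
  then have "AE x in lborel. \<forall>n. indicator {-real n<..<real n} x * h x = 0"
    by (subst AE_all_countable) blast
  then show ?thesis
  proof (rule eventually_mono)
    fix x assume *: "\<forall>n. indicator {-real n<..<real n} x * h x = 0"
    obtain n where "\<bar>x\<bar> < real n" using reals_Archimedean2 by blast
    then show "h x = 0" using *[rule_format, of n] by (auto simp: indicator_def)
  qed
qed

lemma L2_repr_unique:
  assumes "L2_repr T f" "L2_repr T g"
  shows "AE x in lborel. f x = g x"
proof -
  have fg: "square_integrable f" "square_integrable g"
    using assms by (simp_all add: L2_repr_def)
  have d: "square_integrable (\<lambda>x. f x - g x)"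
    using square_integrable_add[OF fg(1) square_integrable_cmult[OF fg(2), of "-1"]] by simp
  have "AE x in lborel. f x - g x = 0"
  proof (rule fundamental_lemma)
    show "(\<lambda>x. f x - g x) \<in> borel_measurable borel"
      using d by (rule square_integrable_measurable)
    show "integrable lborel (\<lambda>x. indicator {-R<..<R} x * (f x - g x))" for R
      by (intro square_integrable_mult d square_integrable_bounded_support[of _ 1 "-R" R])
        (auto simp: indicator_def)
    show "(LINT x|lborel. (f x - g x) * \<phi> x) = 0" if "\<phi> \<in> test_funs" for \<phi>
    proof -
      have "(LINT x|lborel. f x * \<phi> x - g x * \<phi> x) = 0"
        using assms that fg
        by (subst Bochner_Integration.integral_diff)
          (auto simp: L2_repr_def intro!: square_integrable_mult square_integrable_test_funs)
      then show ?thesis by (simp add: left_diff_distrib)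
    qed
  qed
  then show ?thesis by simp
qed

text \<open>Two representatives agree almost everywhere, so the choice made by \<open>SOME\<close>
  does not affect the integral.\<close>

lemma L2_norm_eq:
  assumes "L2_repr T f"
  shows "L2_norm T = sqrt (LINT x|lborel. (f x)\<^sup>2)"
proof -
  define g where "g = (SOME f. L2_repr T f)"
  have g: "L2_repr T g"
    unfolding g_def by (rule someI[of "L2_repr T", OF assms])
  have [measurable]: "f \<in> borel_measurable borel" "g \<in> borel_measurable borel"
    using assms g by (auto simp: L2_repr_def square_integrable_def)
  have "(LINT x|lborel. (g x)\<^sup>2) = (LINT x|lborel. (f x)\<^sup>2)"
    using L2_repr_unique[OF g assms] by (intro integral_cong_AE) auto
  then show ?thesis
    by (simp add: L2_norm_def g_def)
qed

lemma L2_norm_nonneg: "0 \<le> L2_norm T"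
  by (simp add: L2_norm_def)

lemma L2_norm_leI:
  assumes "L2_repr T f" "(LINT x|lborel. (f x)\<^sup>2) \<le> B\<^sup>2" "0 \<le> B"
  shows "L2_norm T \<le> B"
  using assms by (simp add: L2_norm_eq real_le_lsqrt)

lemma L2_norm_sq: "L2_repr T f \<Longrightarrow> (LINT x|lborel. (f x)\<^sup>2) = (L2_norm T)\<^sup>2"
  by (simp add: L2_norm_eq)

section \<open>Vector space operations on \<open>L2\<close>\<close>

lemma L2_repr_add:
  assumes "L2_repr S f" "L2_repr T g"
  shows "L2_repr (S + T) (\<lambda>x. f x + g x)"
proof -
  have fg: "square_integrable f" "square_integrable g"
    using assms by (simp_all add: L2_repr_def)
  have "pairing (S + T) \<phi> = (LINT x|lborel. (f x + g x) * \<phi> x)" if \<phi>: "\<phi> \<in> test_funs" for \<phi>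
  proof -
    have "pairing (S + T) \<phi> = (LINT x|lborel. f x * \<phi> x) + (LINT x|lborel. g x * \<phi> x)"
      using assms \<phi> by (simp add: L2_repr_def plus_distribution.rep_eq)
    also have "\<dots> = (LINT x|lborel. f x * \<phi> x + g x * \<phi> x)"
      using fg \<phi>
      by (subst Bochner_Integration.integral_add)
        (auto intro!: square_integrable_mult square_integrable_test_funs)
    finally show ?thesis by (simp add: distrib_right)
  qed
  then show ?thesis
    using square_integrable_add[OF fg] by (simp add: L2_repr_def)
qed

lemma L2_repr_scaleR:
  assumes "L2_repr T g"
  shows "L2_repr (a *\<^sub>R T) (\<lambda>x. a * g x)"
  using assms square_integrable_cmult
  by (simp add: L2_repr_def scaleR_distribution.rep_eq mult.assoc)

text \<open>The factor \<open>2\<close> avoids Minkowski's inequality; only boundedness matters here.\<close>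

lemma
  assumes "S \<in> L2" "T \<in> L2"
  shows L2_add: "S + T \<in> L2" and L2_norm_add: "L2_norm (S + T) \<le> 2 * (L2_norm S + L2_norm T)"
proof -
  obtain f g where fg: "L2_repr S f" "L2_repr T g"
    using assms by (auto simp: L2_def)
  note h = L2_repr_add[OF fg]
  show "S + T \<in> L2" using h by (auto simp: L2_def)
  have int: "integrable lborel (\<lambda>x. (f x)\<^sup>2)" "integrable lborel (\<lambda>x. (g x)\<^sup>2)"
    "integrable lborel (\<lambda>x. (f x + g x)\<^sup>2)"
    using fg h by (auto simp: L2_repr_def square_integrable_def)
  have "(LINT x|lborel. (f x + g x)\<^sup>2) \<le> (LINT x|lborel. 2 * (f x)\<^sup>2 + 2 * (g x)\<^sup>2)"
  proof (rule integral_mono)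
    fix x
    have "0 \<le> (f x - g x)\<^sup>2" by simp
    then show "(f x + g x)\<^sup>2 \<le> 2 * (f x)\<^sup>2 + 2 * (g x)\<^sup>2"
      by (simp add: power2_sum power2_diff)
  qed (use int in auto)
  also have "\<dots> = 2 * (L2_norm S)\<^sup>2 + 2 * (L2_norm T)\<^sup>2"
    using int fg by (simp add: L2_norm_sq)
  also have "\<dots> \<le> (2 * (L2_norm S + L2_norm T))\<^sup>2"
    using L2_norm_nonneg[of S] L2_norm_nonneg[of T] by (simp add: power_mult_distrib power2_sum)
  finally show "L2_norm (S + T) \<le> 2 * (L2_norm S + L2_norm T)"
    using h L2_norm_nonneg by (intro L2_norm_leI) auto
qed

lemma
  assumes "T \<in> L2"
  shows L2_scaleR: "a *\<^sub>R T \<in> L2" and L2_norm_scaleR: "L2_norm (a *\<^sub>R T) = \<bar>a\<bar> * L2_norm T"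
proof -
  obtain f where f: "L2_repr T f"
    using assms by (auto simp: L2_def)
  note h = L2_repr_scaleR[OF f, of a]
  show "a *\<^sub>R T \<in> L2" using h by (auto simp: L2_def)
  show "L2_norm (a *\<^sub>R T) = \<bar>a\<bar> * L2_norm T"
    using f h by (simp add: L2_norm_eq power_mult_distrib real_sqrt_mult)
qed

text \<open>Outside \<open>test_funs\<close> both sides are 0 by the convention in
  \<open>is_distribution\<close>.\<close>

lemma distribution_eqI:
  assumes "\<And>\<phi>. \<phi> \<in> test_funs \<Longrightarrow> pairing S \<phi> = pairing T \<phi>"
  shows "S = T"
proof -
  have "pairing S \<phi> = pairing T \<phi>" for \<phi>
    using assms pairing[of S] pairing[of T]
    by (cases "\<phi> \<in> test_funs") (auto simp: is_distribution_def)
  then show ?thesis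
    by (metis ext pairing_inject)
qed

section \<open>Uniform boundedness for distributions\<close>

lemma pairing_add:
  "\<phi> \<in> test_funs \<Longrightarrow> \<psi> \<in> test_funs \<Longrightarrow> pairing T (\<lambda>x. \<phi> x + \<psi> x) = pairing T \<phi> + pairing T \<psi>"
  using pairing[of T] by (simp add: is_distribution_def)

lemma pairing_cmult: "\<phi> \<in> test_funs \<Longrightarrow> pairing T (\<lambda>x. a * \<phi> x) = a * pairing T \<phi>"
  using pairing[of T] by (simp add: is_distribution_def)

lemma pairing_null_seq: "test_null_seq \<phi> \<Longrightarrow> (\<lambda>n. pairing T (\<phi> n)) \<longlonglongrightarrow> 0"
  using pairing[of T] by (simp add: is_distribution_def)

lemma pairing_dist_deriv: "\<phi> \<in> test_funs \<Longrightarrow> pairing (dist_deriv v T) \<phi> = - pairing T (dir_deriv v \<phi>)"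
  by (simp add: dist_deriv.rep_eq)

lemma test_funs_zero: "(\<lambda>x. 0) \<in> test_funs"
proof -
  have "dir_deriv v (\<lambda>x::'a. 0) = (\<lambda>x. 0)" for v
    by (rule ext, rule dir_deriv_eqI) (rule has_derivative_const)
  then have "smooth (\<lambda>x::'a. 0)"
    by (intro smooth_coinduct[of _ "{\<lambda>x. 0}"]) simp_all
  then show ?thesis
    by (rule test_funsI[of _ "{}"]) simp_all
qed

lemma dx_pow_add:
  "smooth \<phi> \<Longrightarrow> smooth \<psi> \<Longrightarrow> (dx ^^ q) (\<lambda>x. \<phi> x + \<psi> x) = (\<lambda>x. (dx ^^ q) \<phi> x + (dx ^^ q) \<psi> x)"
  using foldr_dir_deriv_add[of \<phi> \<psi> "replicate q 1"] by (simp add: foldr_replicate)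

lemma dx_pow_cmult: "smooth \<phi> \<Longrightarrow> (dx ^^ q) (\<lambda>x. a * \<phi> x) = (\<lambda>x. a * (dx ^^ q) \<phi> x)"
  using foldr_dir_deriv_cmult[of \<phi> "replicate q 1"] by (simp add: foldr_replicate)

lemma test_funs_diff:
  "\<phi> \<in> test_funs \<Longrightarrow> \<psi> \<in> test_funs \<Longrightarrow> (\<lambda>x. \<phi> x - \<psi> x) \<in> test_funs"
  using test_funs_add[of \<phi> "\<lambda>x. (-1) * \<psi> x"] test_funs_cmult[of \<psi> "-1"] by simp

lemma pairing_diff:
  "\<phi> \<in> test_funs \<Longrightarrow> \<psi> \<in> test_funs \<Longrightarrow> pairing T (\<lambda>x. \<phi> x - \<psi> x) = pairing T \<phi> - pairing T \<psi>"
  using pairing_add[of \<phi> "\<lambda>x. (-1) * \<psi> x" T] test_funs_cmult[of \<psi> "-1"] pairing_cmult[of \<psi> T "-1"] by simp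

lemma dx_pow_diff:
  assumes "smooth \<phi>" "smooth \<psi>"
  shows "(dx ^^ q) (\<lambda>x. \<phi> x - \<psi> x) = (\<lambda>x. (dx ^^ q) \<phi> x - (dx ^^ q) \<psi> x)"
  using dx_pow_add[OF assms(1) smooth_cmult[OF assms(2), of "-1"], of q] dx_pow_cmult[OF assms(2), of q "-1"]
  by simp

text \<open>The Weierstrass M-test applies to each derivative separately. Finitely many terms do not
  affect convergence, so the q-th derivatives are bounded only from index q on; this is what a
  diagonal choice of the terms can provide. The partial sums converge to the sum in the sense of
  \<open>test_null_seq\<close>, so every distribution acts termwise.\<close>

lemma test_series:
  fixes \<psi> :: "nat \<Rightarrow> real \<Rightarrow> real"
  assumes \<psi>: "\<And>i. \<psi> i \<in> test_funs" and K: "compact K" "\<And>i x. \<psi> i x \<noteq> 0 \<Longrightarrow> x \<in> K"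
    and bound: "\<And>i q x. q \<le> i \<Longrightarrow> \<bar>(dx ^^ q) (\<psi> i) x\<bar> \<le> (1/2) ^ i"
  shows "\<exists>\<Psi>\<in>test_funs. \<forall>T. (\<lambda>i. pairing T (\<psi> i)) sums pairing T \<Psi>"
proof -
  define g where "g q x = (\<Sum>i. (dx ^^ q) (\<psi> i) x)" for q x
  have sm: "smooth (\<psi> i)" for i
    using \<psi> by (rule test_funs_smooth)
  have ul: "uniform_limit UNIV (\<lambda>n x. \<Sum>i<n. (dx ^^ q) (\<psi> i) x) (g q) sequentially" for q
    unfolding g_def
  proof (rule Weierstrass_m_test_ev)
    show "\<forall>\<^sub>F i in sequentially. \<forall>x\<in>UNIV. norm ((dx ^^ q) (\<psi> i) x) \<le> (1/2) ^ i"
      using bound by (auto simp: eventually_sequentially)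
    show "summable (\<lambda>i. (1/2::real) ^ i)"
      by (intro summable_geometric) simp
  qed
  have g': "(g q has_real_derivative g (Suc q) x) (at x)" for q x
    unfolding g_def
  proof (rule has_field_derivative_series'(2)[where S = UNIV and ?x0.0 = 0])
    show "((dx ^^ q) (\<psi> i) has_real_derivative (dx ^^ Suc q) (\<psi> i) y) (at y within UNIV)" for i y
      using smooth_has_deriv[OF sm, of q i y] by simp
    show "uniformly_convergent_on UNIV (\<lambda>n x. \<Sum>i<n. (dx ^^ Suc q) (\<psi> i) x)"
      using ul[of "Suc q"] by (rule uniformly_convergentI)
    show "summable (\<lambda>i. (dx ^^ q) (\<psi> i) 0)"
    proof (rule summable_comparison_test_ev)
      show "\<forall>\<^sub>F i in sequentially. norm ((dx ^^ q) (\<psi> i) 0) \<le> (1/2) ^ i"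
        using bound by (auto simp: eventually_sequentially)
      show "summable (\<lambda>i. (1/2::real) ^ i)"
        by (intro summable_geometric) simp
    qed
  qed simp_all
  have g0K: "x \<in> K" if "g 0 x \<noteq> 0" for x
  proof (rule ccontr)
    assume "x \<notin> K"
    then have "\<psi> i x = 0" for i
      using K(2) by blast
    then show False
      using that by (simp add: g_def)
  qed
  have g0: "g 0 \<in> test_funs"
    by (rule test_funsI[OF smooth_realI[of g, OF g'] K(1) g0K])
  define P where "P n x = (\<Sum>i<n. \<psi> i x)" for n x
  have P: "P n \<in> test_funs \<and> (dx ^^ q) (P n) = (\<lambda>x. \<Sum>i<n. (dx ^^ q) (\<psi> i) x) \<and>
      (\<forall>T. pairing T (P n) = (\<Sum>i<n. pairing T (\<psi> i)))" for n q
  proof (induction n)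
    case 0
    have "dir_deriv v (\<lambda>x::real. 0) = (\<lambda>x. 0)" for v
      by (rule ext, rule dir_deriv_eqI) (rule has_derivative_const)
    then have "(dx ^^ q) (\<lambda>x. 0) = (\<lambda>x. 0)"
      by (induction q) simp_all
    moreover have "pairing T (\<lambda>x::real. 0) = 0" for T
      using pairing_cmult[OF test_funs_zero, of T 0] by simp
    ultimately show ?case
      by (simp add: P_def[abs_def] test_funs_zero)
  next
    case (Suc n)
    have "P (Suc n) = (\<lambda>x. P n x + \<psi> n x)"
      by (simp add: P_def[abs_def])
    then show ?case
      using Suc test_funs_add[of "P n" "\<psi> n"] \<psi>
      by (simp add: dx_pow_add pairing_add test_funs_smooth)
  qed
  have "test_null_seq (\<lambda>n x. P n x - g 0 x)"
  proof (rule test_null_seq_realI)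
    show "(\<lambda>x. P n x - g 0 x) \<in> test_funs" for n
      using P g0 by (intro test_funs_diff) auto
    show "compact K" by (rule K)
    show "x \<in> K" if "P n x - g 0 x \<noteq> 0" for n x
    proof (rule ccontr)
      assume "x \<notin> K"
      then have "P n x = 0"
        using K(2)[of _ x] unfolding P_def by (intro sum.neutral) blast
      with that g0K \<open>x \<notin> K\<close> show False by auto
    qed
    show "uniform_limit UNIV (\<lambda>n. (dx ^^ q) (\<lambda>x. P n x - g 0 x)) (\<lambda>_. 0) sequentially" for q
    proof -
      have "(dx ^^ q) (\<lambda>x. P n x - g 0 x) = (\<lambda>x. (\<Sum>i<n. (dx ^^ q) (\<psi> i) x) - g q x)" for n
        using P[of n q] g0 dx_pow_eq[of g q, OF g'] by (simp add: dx_pow_diff test_funs_smooth)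
      moreover have "uniform_limit UNIV (\<lambda>n x. (\<Sum>i<n. (dx ^^ q) (\<psi> i) x) - g q x) (\<lambda>x. 0) sequentially"
        using ul[of q] by (simp add: uniform_limit_iff dist_real_def)
      ultimately show ?thesis by simp
    qed
  qed
  then have "(\<lambda>n. pairing T (\<lambda>x. P n x - g 0 x)) \<longlonglongrightarrow> 0" for T
    by (rule pairing_null_seq)
  then have "(\<lambda>n. (\<Sum>i<n. pairing T (\<psi> i)) - pairing T (g 0)) \<longlonglongrightarrow> 0" for T
    using P g0 by (simp add: pairing_diff)
  then have "(\<lambda>i. pairing T (\<psi> i)) sums pairing T (g 0)" for T
    unfolding sums_def using LIM_zero_iff by blast
  then show ?thesis
    using g0 by blast
qed

text \<open>Banach--Steinhaus for distributions, by a gliding hump.\<close>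

lemma uniform_boundedness:
  fixes F :: "real distribution set"
  assumes bdd: "\<And>\<phi>. \<phi> \<in> test_funs \<Longrightarrow> \<exists>B. \<forall>T\<in>F. \<bar>pairing T \<phi>\<bar> \<le> B"
    and null: "test_null_seq \<phi>" and e: "e > 0"
  shows "\<forall>\<^sub>F n in sequentially. \<forall>T\<in>F. \<bar>pairing T (\<phi> n)\<bar> < e"
proof (rule ccontr)
  assume contr: "\<not> ?thesis"
  have \<phi>: "\<phi> n \<in> test_funs" for n
    using null by (simp add: test_null_seq_def)
  obtain K where K: "compact K" "\<And>n x. \<phi> n x \<noteq> 0 \<Longrightarrow> x \<in> K"
    using null unfolding test_null_seq_def by blast
  \<comment> \<open>The rate 4^-j leaves room for the factor 2^j below: after rescaling, the
    derivatives still decay like 2^-j while the pairings grow at least like 2^j e.\<close>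
  have "\<exists>n T. T \<in> F \<and> e \<le> \<bar>pairing T (\<phi> n)\<bar> \<and> (\<forall>q\<le>j. \<forall>x. \<bar>(dx ^^ q) (\<phi> n) x\<bar> \<le> (1/4) ^ j)" for j
  proof -
    have "\<forall>\<^sub>F n in sequentially. \<forall>x. \<bar>(dx ^^ q) (\<phi> n) x\<bar> \<le> (1/4) ^ j" for q
      using uniform_limitD[OF test_null_seq_dx_pow[OF null, of q], of "(1/4) ^ j"]
      by (auto simp: dist_real_def less_imp_le elim!: eventually_mono)
    then have ev: "\<forall>\<^sub>F n in sequentially. \<forall>q\<in>{..j}. \<forall>x. \<bar>(dx ^^ q) (\<phi> n) x\<bar> \<le> (1/4) ^ j"
      by (intro eventually_ball_finite) auto
    have "\<exists>\<^sub>F n in sequentially. \<exists>T\<in>F. e \<le> \<bar>pairing T (\<phi> n)\<bar>"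
      using contr by (simp add: not_eventually Bex_def not_less)
    then have "\<exists>\<^sub>F n in sequentially. (\<exists>T\<in>F. e \<le> \<bar>pairing T (\<phi> n)\<bar>) \<and> (\<forall>q\<in>{..j}. \<forall>x. \<bar>(dx ^^ q) (\<phi> n) x\<bar> \<le> (1/4) ^ j)"
      by (rule frequently_rev_mp) (use ev in \<open>auto elim!: eventually_mono\<close>)
    then show ?thesis
      by (auto dest!: frequently_ex)
  qed
  then obtain N \<T> where \<T>: "\<And>j. \<T> j \<in> F" "\<And>j. e \<le> \<bar>pairing (\<T> j) (\<phi> (N j))\<bar>"
    and bound: "\<And>j q x. q \<le> j \<Longrightarrow> \<bar>(dx ^^ q) (\<phi> (N j)) x\<bar> \<le> (1/4) ^ j"
    by metis
  define \<psi> where "\<psi> j x = 2 ^ j * \<phi> (N j) x" for j x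
  have \<psi>: "\<psi> j \<in> test_funs" for j
    unfolding \<psi>_def[abs_def] by (intro test_funs_cmult \<phi>)
  have \<psi>K: "x \<in> K" if "\<psi> j x \<noteq> 0" for j x
    using that K(2)[of "N j" x] by (auto simp: \<psi>_def)
  have \<psi>_bound: "\<bar>(dx ^^ q) (\<psi> j) x\<bar> \<le> (1/2) ^ j" if "q \<le> j" for q j x
  proof -
    have "\<bar>(dx ^^ q) (\<psi> j) x\<bar> = 2 ^ j * \<bar>(dx ^^ q) (\<phi> (N j)) x\<bar>"
      unfolding \<psi>_def[abs_def] using \<phi> by (simp add: dx_pow_cmult test_funs_smooth abs_mult)
    also have "\<dots> \<le> 2 ^ j * (1/4) ^ j"
      using bound[OF that] by (intro mult_left_mono) auto
    also have "\<dots> = (1/2) ^ j"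
      by (simp flip: power_mult_distrib)
    finally show ?thesis .
  qed
  have \<T>\<psi>: "2 ^ j * e \<le> \<bar>pairing (\<T> j) (\<psi> j)\<bar>" for j
    unfolding \<psi>_def[abs_def] using \<T>(2)[of j] \<phi> by (simp add: pairing_cmult abs_mult)
  have null_\<psi>: "test_null_seq \<psi>"
  proof (rule test_null_seq_realI[OF \<psi> K(1) \<psi>K])
    show "uniform_limit UNIV (\<lambda>j. (dx ^^ q) (\<psi> j)) (\<lambda>_. 0) sequentially" for q
    proof (rule uniform_limitI)
      fix d :: real assume "d > 0"
      then have "\<forall>\<^sub>F j in sequentially. (1/2) ^ j < d"
        by (intro order_tendstoD(2)[OF LIMSEQ_power_zero]) auto
      moreover have "\<forall>\<^sub>F j in sequentially. q \<le> j"
        by (rule eventually_ge_at_top)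
      ultimately show "\<forall>\<^sub>F j in sequentially. \<forall>x\<in>UNIV. dist ((dx ^^ q) (\<psi> j) x) 0 < d"
      proof eventually_elim
        case (elim j)
        then show ?case
          using le_less_trans[OF \<psi>_bound] by (simp add: dist_real_def)
      qed
    qed
  qed
  obtain B where B: "\<And>\<phi> T. \<phi> \<in> test_funs \<Longrightarrow> T \<in> F \<Longrightarrow> \<bar>pairing T \<phi>\<bar> \<le> B \<phi>"
    using bdd by metis
  \<comment> \<open>This describes an admissible next hump \<open>r\<close> after the indices
    \<open>f l\<close> with l < i. The functionals chosen so far barely see it, and its own
    functional sees it more strongly than the bounds \<open>B\<close> permit for all earlier humps
    together, with a surplus of i + 1.\<close>
  define P where "P f i r \<longleftrightarrow> i \<le> r \<and> (\<forall>l<i. \<bar>pairing (\<T> (f l)) (\<psi> r)\<bar> \<le> (1/2) ^ i) \<and>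
    real i + 1 + (\<Sum>l<i. B (\<psi> (f l))) \<le> \<bar>pairing (\<T> r) (\<psi> r)\<bar>" for f :: "nat \<Rightarrow> nat" and i r
  have "\<exists>J. \<forall>i. P J i (J i)"
  proof (rule dependent_wellorder_choice)
    show "P f i r = P g i r" if "\<And>y. y < i \<Longrightarrow> f y = g y" for r f g i
      using that by (simp add: P_def cong: conj_cong)
    show "\<exists>r. P f i r" for f i
    proof -
      have "\<forall>\<^sub>F r in sequentially. \<bar>pairing (\<T> (f l)) (\<psi> r)\<bar> < (1/2) ^ i" for l
        using tendstoD[OF pairing_null_seq[OF null_\<psi>], of "(1/2) ^ i"] by (simp add: dist_real_def)
      then have "\<forall>\<^sub>F r in sequentially. \<forall>l\<in>{..<i}. \<bar>pairing (\<T> (f l)) (\<psi> r)\<bar> < (1/2) ^ i"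
        by (intro eventually_ball_finite) auto
      moreover have "\<forall>\<^sub>F r in sequentially. i \<le> r"
        by (rule eventually_ge_at_top)
      moreover have "\<forall>\<^sub>F r in sequentially. real i + 1 + (\<Sum>l<i. B (\<psi> (f l))) \<le> 2 ^ r * e"
      proof -
        define Z where "Z = (i + 1 + (\<Sum>l<i. B (\<psi> (f l)))) / e"
        obtain n where n: "Z < 2 ^ n"
          using real_arch_pow[of 2 Z] by auto
        have "Z \<le> 2 ^ r" if "n \<le> r" for r
          using n power_increasing[OF that, of "2::real"] by linarith
        then have "\<forall>\<^sub>F r in sequentially. Z \<le> 2 ^ r"
          by (auto simp: eventually_sequentially)
        then show ?thesis
          using e by (simp add: Z_def pos_divide_le_eq add_ac)
      qed
      ultimately have "\<forall>\<^sub>F r in sequentially. P f i r"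
      proof eventually_elim
        case (elim r)
        have "2 ^ r * e \<le> \<bar>pairing (\<T> r) (\<psi> r)\<bar>"
          by (rule \<T>\<psi>)
        with elim show ?case
          by (simp add: P_def less_imp_le)
      qed
      then show ?thesis
        by (auto simp: eventually_sequentially)
    qed
  qed
  then obtain J :: "nat \<Rightarrow> nat" where J: "\<And>i. i \<le> J i" "\<And>i l. l < i \<Longrightarrow> \<bar>pairing (\<T> (J l)) (\<psi> (J i))\<bar> \<le> (1/2) ^ i"
    "\<And>i. real i + 1 + (\<Sum>l<i. B (\<psi> (J l))) \<le> \<bar>pairing (\<T> (J i)) (\<psi> (J i))\<bar>"
    by (auto simp: P_def)
  have J_bound: "\<bar>(dx ^^ q) (\<psi> (J i)) x\<bar> \<le> (1/2) ^ i" if "q \<le> i" for i q x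
  proof -
    have "\<bar>(dx ^^ q) (\<psi> (J i)) x\<bar> \<le> (1/2) ^ J i"
      using \<psi>_bound J(1)[of i] that by (intro \<psi>_bound) simp
    also have "\<dots> \<le> (1/2) ^ i"
      using J(1)[of i] by (intro power_decreasing) auto
    finally show ?thesis .
  qed
  obtain \<Psi> where \<Psi>: "\<Psi> \<in> test_funs" "\<And>T. (\<lambda>i. pairing T (\<psi> (J i))) sums pairing T \<Psi>"
    using test_series[of "\<lambda>i. \<psi> (J i)" K] \<psi> K(1) \<psi>K J_bound by blast
  \<comment> \<open>When the i-th functional is applied to \<Psi>, the earlier humps contribute at
    most the sum of the \<open>B\<close>, the later ones at most 1, and the i-th one at least i + 1
    plus that sum. The value has modulus at least i, more than \<open>B \<Psi>\<close>
    permits.\<close>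
  obtain i :: nat where i: "B \<Psi> < i"
    using reals_Archimedean2 by blast
  define a where "a l = pairing (\<T> (J i)) (\<psi> (J l))" for l
  have a: "a sums pairing (\<T> (J i)) \<Psi>"
    unfolding a_def by (rule \<Psi>)
  have tail: "\<bar>a (l + Suc i)\<bar> \<le> (1/2) ^ Suc l" for l
  proof -
    have "\<bar>a (l + Suc i)\<bar> \<le> (1/2) ^ (l + Suc i)"
      unfolding a_def by (rule J) simp
    also have "\<dots> \<le> (1/2) ^ Suc l"
      by (intro power_decreasing) auto
    finally show ?thesis .
  qed
  have "\<bar>\<Sum>l. a (l + Suc i)\<bar> \<le> (\<Sum>l. (1/2) ^ Suc l)"
    using tail power_half_series sums_summable
    by (intro norm_suminf_le[where 'a = real, unfolded real_norm_def]) auto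
  then have tail_sum: "\<bar>\<Sum>l. a (l + Suc i)\<bar> \<le> 1"
    using power_half_series by (simp add: sums_unique[symmetric])
  have "\<bar>\<Sum>l<i. a l\<bar> \<le> (\<Sum>l<i. B (\<psi> (J l)))"
    unfolding a_def using \<psi> \<T>(1) by (intro order_trans[OF sum_abs] sum_mono B) auto
  moreover have "pairing (\<T> (J i)) \<Psi> = (\<Sum>l. a (l + Suc i)) + ((\<Sum>l<i. a l) + a i)"
    using suminf_split_initial_segment[of a "Suc i"] a by (simp add: sums_iff)
  moreover have "\<bar>pairing (\<T> (J i)) \<Psi>\<bar> \<le> B \<Psi>"
    by (intro B \<Psi> \<T>)
  moreover have "real i + 1 + (\<Sum>l<i. B (\<psi> (J l))) \<le> \<bar>a i\<bar>"
    unfolding a_def by (rule J)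
  ultimately show False
    using i tail_sum by linarith
qed

section \<open>Differentiable curves of test functions\<close>

text \<open>Differentiability of t -> \<open>\<psi> t\<close> in the topology of test functions. It
  is expressed along sequences of increments because that topology is given by
  \<open>test_null_seq\<close>.\<close>

definition test_curve :: "(real \<Rightarrow> real \<Rightarrow> real) \<Rightarrow> (real \<Rightarrow> real \<Rightarrow> real) \<Rightarrow> bool"
  where "test_curve \<psi> \<psi>' \<longleftrightarrow> (\<forall>t. \<psi> t \<in> test_funs \<and> \<psi>' t \<in> test_funs) \<and>
    (\<forall>t h. h \<longlonglongrightarrow> 0 \<and> (\<forall>n. h n \<noteq> 0) \<longrightarrow>
      test_null_seq (\<lambda>n x. inverse (h n) * (\<psi> (t + h n) x - \<psi> t x) - \<psi>' t x))"

text \<open>The mean value inequality is used twice on the ball around \<open>t\<close>: on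
  \<open>w'\<close>, and then on w s - s w'(t), whose derivative w'(s) - w'(t) is at most C |h| by
  the first use.\<close>

lemma difference_quotient_bound:
  fixes w w' w'' :: "real \<Rightarrow> real"
  assumes w: "\<And>s. (w has_real_derivative w' s) (at s)" "\<And>s. (w' has_real_derivative w'' s) (at s)"
    and C: "\<And>s. \<bar>s\<bar> \<le> T \<Longrightarrow> \<bar>w'' s\<bar> \<le> C" and h: "\<bar>t\<bar> + \<bar>h\<bar> \<le> T" "h \<noteq> 0"
  shows "\<bar>inverse h * (w (t + h) - w t) - w' t\<bar> \<le> C * \<bar>h\<bar>"
proof -
  have in_T: "\<bar>s\<bar> \<le> T" if "s \<in> cball t \<bar>h\<bar>" for s
    using that h by (auto simp: dist_real_def)
  have w'_bound: "\<bar>w' s - w' t\<bar> \<le> C * \<bar>h\<bar>" if s: "s \<in> cball t \<bar>h\<bar>" for s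
  proof -
    have "norm (w' s - w' t) \<le> C * norm (s - t)"
    proof (rule field_differentiable_bound[where S = "cball t \<bar>h\<bar>" and f' = w''])
      show "norm (w'' z) \<le> C" if "z \<in> cball t \<bar>h\<bar>" for z
        using C[OF in_T[OF that]] by simp
    qed (use s w in \<open>auto intro: has_field_derivative_at_within\<close>)
    moreover have "0 \<le> C"
      using C[of t] h by (meson abs_ge_zero add_increasing2 order_trans abs_le_D1 dual_order.trans le_add_same_cancel1)
    moreover have "\<bar>s - t\<bar> \<le> \<bar>h\<bar>"
      using s by (auto simp: dist_real_def)
    ultimately show ?thesis
      by (smt (verit) mult_left_mono real_norm_def)
  qed
  have "norm ((w (t + h) - (t + h) * w' t) - (w t - t * w' t)) \<le> (C * \<bar>h\<bar>) * norm (t + h - t)"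
  proof (rule field_differentiable_bound[where S = "cball t \<bar>h\<bar>" and f' = "\<lambda>s. w' s - w' t" and f = "\<lambda>s. w s - s * w' t"])
    show "((\<lambda>s. w s - s * w' t) has_real_derivative w' z - w' t) (at z within cball t \<bar>h\<bar>)" for z
      by (rule has_field_derivative_at_within) (auto intro!: derivative_eq_intros w)
  qed (use w'_bound in \<open>auto simp: dist_real_def\<close>)
  then have "\<bar>w (t + h) - w t - h * w' t\<bar> \<le> C * \<bar>h\<bar> * \<bar>h\<bar>"
    by (simp add: algebra_simps)
  moreover have "inverse h * (w (t + h) - w t) - w' t = inverse h * (w (t + h) - w t - h * w' t)"
    using h by (simp add: field_simps)
  ultimately have "\<bar>inverse h * (w (t + h) - w t) - w' t\<bar> \<le> inverse \<bar>h\<bar> * (C * \<bar>h\<bar> * \<bar>h\<bar>)"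
    by (simp add: abs_mult mult_left_mono)
  also have "inverse \<bar>h\<bar> * (C * \<bar>h\<bar> * \<bar>h\<bar>) = C * \<bar>h\<bar>"
    using h by (simp add: field_simps)
  finally show ?thesis .
qed

text \<open>A locally bounded second time derivative makes the error of the difference quotient O(h)
  uniformly in x, for every number of x-derivatives. This is the uniform convergence that
  \<open>test_null_seq\<close> asks for.\<close>

lemma test_curveI:
  assumes \<psi>: "\<And>t. \<psi> t \<in> test_funs" "\<And>t. \<psi>' t \<in> test_funs"
    and d: "\<And>q t x. ((\<lambda>t. (dx ^^ q) (\<psi> t) x) has_real_derivative (dx ^^ q) (\<psi>' t) x) (at t)"
    and d': "\<And>q t x. ((\<lambda>t. (dx ^^ q) (\<psi>' t) x) has_real_derivative (dx ^^ q) (\<psi>'' t) x) (at t)"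
    and bound: "\<And>q T. \<exists>C. \<forall>t x. \<bar>t\<bar> \<le> T \<longrightarrow> \<bar>(dx ^^ q) (\<psi>'' t) x\<bar> \<le> C"
    and supp: "\<And>T. \<exists>K. compact K \<and> (\<forall>t x. \<bar>t\<bar> \<le> T \<and> x \<notin> K \<longrightarrow> \<psi> t x = 0 \<and> \<psi>' t x = 0)"
  shows "test_curve \<psi> \<psi>'"
  unfolding test_curve_def
proof (intro conjI allI impI \<psi>)
  fix t and h :: "nat \<Rightarrow> real"
  assume h: "h \<longlonglongrightarrow> 0 \<and> (\<forall>n. h n \<noteq> 0)"
  obtain H where H: "\<And>n. \<bar>h n\<bar> \<le> H"
    using h by (metis convergentI convergent_imp_Bseq BseqE real_norm_def)
  define T where "T = \<bar>t\<bar> + H"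
  have T: "\<bar>t\<bar> + \<bar>h n\<bar> \<le> T" for n
    using H by (simp add: T_def)
  obtain K where K: "compact K" "\<And>s x. \<bar>s\<bar> \<le> T \<Longrightarrow> x \<notin> K \<Longrightarrow> \<psi> s x = 0 \<and> \<psi>' s x = 0"
    using supp[of T] by blast
  have mem: "(\<lambda>x. inverse (h n) * (\<psi> (t + h n) x - \<psi> t x) - \<psi>' t x) \<in> test_funs" for n
    by (intro test_funs_diff[OF test_funs_cmult] test_funs_diff \<psi>)
  show "test_null_seq (\<lambda>n x. inverse (h n) * (\<psi> (t + h n) x - \<psi> t x) - \<psi>' t x)"
  proof (rule test_null_seq_realI[OF mem K(1)])
    show "x \<in> K" if nz: "inverse (h n) * (\<psi> (t + h n) x - \<psi> t x) - \<psi>' t x \<noteq> 0" for n x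
    proof (rule ccontr)
      assume x: "x \<notin> K"
      have "\<bar>t\<bar> \<le> T" "\<bar>t + h n\<bar> \<le> T"
        using T[of n] by linarith+
      then show False
        using nz K(2)[OF _ x] by auto
    qed
    fix q
    obtain C where C: "\<And>s x. \<bar>s\<bar> \<le> T \<Longrightarrow> \<bar>(dx ^^ q) (\<psi>'' s) x\<bar> \<le> C"
      using bound[of T q] by blast
    have eq: "(dx ^^ q) (\<lambda>x. inverse (h n) * (\<psi> (t + h n) x - \<psi> t x) - \<psi>' t x) =
        (\<lambda>x. inverse (h n) * ((dx ^^ q) (\<psi> (t + h n)) x - (dx ^^ q) (\<psi> t) x) - (dx ^^ q) (\<psi>' t) x)" for n
    proof -
      have s: "smooth (\<psi> s)" "smooth (\<psi>' s)" for s
        using \<psi> by (simp_all add: test_funs_smooth)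
      have s2: "smooth (\<lambda>x. \<psi> (t + h n) x - \<psi> t x)"
        using \<psi> by (intro test_funs_smooth test_funs_diff)
      show ?thesis
        by (simp add: dx_pow_diff[OF smooth_cmult[OF s2] s(2)] dx_pow_cmult[OF s2] dx_pow_diff[OF s(1) s(1)])
    qed
    show "uniform_limit UNIV (\<lambda>n. (dx ^^ q) (\<lambda>x. inverse (h n) * (\<psi> (t + h n) x - \<psi> t x) - \<psi>' t x)) (\<lambda>_. 0) sequentially"
    proof (rule uniform_limitI)
      fix e :: real assume e: "e > 0"
      have "(\<lambda>n. C * \<bar>h n\<bar>) \<longlonglongrightarrow> C * \<bar>0\<bar>"
        using h by (intro tendsto_intros) auto
      then have "\<forall>\<^sub>F n in sequentially. C * \<bar>h n\<bar> < e"
        using e by (intro order_tendstoD(2)) auto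
      then show "\<forall>\<^sub>F n in sequentially. \<forall>x\<in>UNIV.
          dist ((dx ^^ q) (\<lambda>x. inverse (h n) * (\<psi> (t + h n) x - \<psi> t x) - \<psi>' t x) x) 0 < e"
      proof eventually_elim
        case (elim n)
        have "\<bar>inverse (h n) * ((dx ^^ q) (\<psi> (t + h n)) x - (dx ^^ q) (\<psi> t) x) - (dx ^^ q) (\<psi>' t) x\<bar> \<le> C * \<bar>h n\<bar>" for x
          using h by (intro difference_quotient_bound[of "\<lambda>s. (dx ^^ q) (\<psi> s) x" _ "\<lambda>s. (dx ^^ q) (\<psi>'' s) x", OF d d' C T]) auto
        then show ?case
          using elim le_less_trans by (fastforce simp: dist_real_def eq)
      qed
    qed
  qed
qed

text \<open>By Banach--Steinhaus a pointwise bounded sequence of distributions is uniformly small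
  along a null sequence, so the diagonal pairing tends to 0. This is the joint sequential continuity
  used for pairings in which both arguments vary.\<close>

lemma pairing_seq_null:
  assumes "\<And>\<phi>. \<phi> \<in> test_funs \<Longrightarrow> Bseq (\<lambda>n. pairing (T n) \<phi>)" "test_null_seq Q"
  shows "(\<lambda>n. pairing (T n :: real distribution) (Q n)) \<longlonglongrightarrow> 0"
proof (rule tendstoI)
  fix e :: real assume e: "e > 0"
  have "\<forall>\<^sub>F n in sequentially. \<forall>S\<in>range T. \<bar>pairing S (Q n)\<bar> < e"
  proof (rule uniform_boundedness[OF _ assms(2) e])
    show "\<exists>B. \<forall>S\<in>range T. \<bar>pairing S \<phi>\<bar> \<le> B" if "\<phi> \<in> test_funs" for \<phi>
      using assms(1)[OF that] by (auto simp: Bseq_def)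
  qed
  then show "\<forall>\<^sub>F n in sequentially. dist (pairing (T n) (Q n)) 0 < e"
    by eventually_elim (simp add: dist_real_def)
qed

text \<open>The difference quotient splits into that of \<open>u\<close> on the fixed
  \<open>\<psi> t\<close>, the value of \<open>u (t + h)\<close> on \<open>\<psi>' t\<close>, and
  \<open>u (t + h)\<close> on the remainder \<open>Q\<close>. Only in the last term do both
  arguments move, and \<open>pairing_seq_null\<close> sends it to 0.\<close>

lemma pairing_curve_deriv:
  assumes u: "has_time_deriv u v t" and \<psi>: "test_curve \<psi> \<psi>'"
  shows "((\<lambda>s. pairing (u s) (\<psi> s)) has_real_derivative (pairing v (\<psi> t) + pairing (u t) (\<psi>' t))) (at t)"
proof -
  have mem: "\<psi> s \<in> test_funs" "\<psi>' s \<in> test_funs" for s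
    using \<psi> by (auto simp: test_curve_def)
  have ud: "((\<lambda>s. pairing (u s) \<phi>) has_real_derivative pairing v \<phi>) (at t)" if "\<phi> \<in> test_funs" for \<phi>
    using u that by (simp add: has_time_deriv_def)
  have "((\<lambda>h. (pairing (u (t + h)) (\<psi> (t + h)) - pairing (u t) (\<psi> t)) / h) \<circ> X) \<longlonglongrightarrow>
      pairing v (\<psi> t) + pairing (u t) (\<psi>' t)" if X: "\<forall>n. X n \<in> UNIV - {0}" "X \<longlonglongrightarrow> 0" for X
  proof -
    define Q where "Q n x = inverse (X n) * (\<psi> (t + X n) x - \<psi> t x) - \<psi>' t x" for n x
    have Q: "test_null_seq Q"
      unfolding Q_def[abs_def] using \<psi> X by (auto simp: test_curve_def)
    have conv: "(\<lambda>n. pairing (u (t + X n)) \<phi>) \<longlonglongrightarrow> pairing (u t) \<phi>" if "\<phi> \<in> test_funs" for \<phi>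
    proof -
      have "isCont (\<lambda>s. pairing (u s) \<phi>) t"
        using ud[OF that] by (rule DERIV_isCont)
      moreover have "(\<lambda>n. t + X n) \<longlonglongrightarrow> t + 0"
        using X by (intro tendsto_intros) auto
      ultimately show ?thesis
        by (intro isCont_tendsto_compose[of t "\<lambda>s. pairing (u s) \<phi>"]) auto
    qed
    have "(\<lambda>n. pairing (u (t + X n)) (Q n)) \<longlonglongrightarrow> 0"
    proof (rule pairing_seq_null[OF _ Q])
      show "Bseq (\<lambda>n. pairing (u (t + X n)) \<phi>)" if "\<phi> \<in> test_funs" for \<phi>
        using conv[OF that] by (intro convergent_imp_Bseq convergentI)
    qed
    moreover have "(\<lambda>n. (pairing (u (t + X n)) (\<psi> t) - pairing (u t) (\<psi> t)) / X n) \<longlonglongrightarrow> pairing v (\<psi> t)"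
    proof -
      have "((\<lambda>h. (pairing (u (t + h)) (\<psi> t) - pairing (u t) (\<psi> t)) / h) \<longlongrightarrow> pairing v (\<psi> t)) (at 0)"
        using ud[OF mem(1)] by (simp add: DERIV_def)
      then show ?thesis
        using X by (auto simp: tendsto_at_iff_sequentially o_def)
    qed
    ultimately have "(\<lambda>n. (pairing (u (t + X n)) (\<psi> t) - pairing (u t) (\<psi> t)) / X n +
        (pairing (u (t + X n)) (Q n) + pairing (u (t + X n)) (\<psi>' t))) \<longlonglongrightarrow> pairing v (\<psi> t) + (0 + pairing (u t) (\<psi>' t))"
      by (intro tendsto_add conv mem)
    moreover have "(pairing (u (t + X n)) (\<psi> t) - pairing (u t) (\<psi> t)) / X n +
        (pairing (u (t + X n)) (Q n) + pairing (u (t + X n)) (\<psi>' t)) =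
        (pairing (u (t + X n)) (\<psi> (t + X n)) - pairing (u t) (\<psi> t)) / X n" for n
    proof -
      have "pairing (u (t + X n)) (Q n) = inverse (X n) *
          (pairing (u (t + X n)) (\<psi> (t + X n)) - pairing (u (t + X n)) (\<psi> t)) - pairing (u (t + X n)) (\<psi>' t)"
        unfolding Q_def[abs_def]
        by (simp add: pairing_diff[OF test_funs_cmult[OF test_funs_diff]] pairing_cmult[OF test_funs_diff] pairing_diff mem)
      then show ?thesis
        by (simp add: divide_inverse algebra_simps)
    qed
    ultimately show ?thesis
      by (simp add: o_def)
  qed
  then show ?thesis
    unfolding DERIV_def tendsto_at_iff_sequentially by blast
qed

section \<open>Space-time test functions\<close>

lemma smooth_line_deriv:
  fixes \<Phi> :: "'a::euclidean_space \<Rightarrow> real" and l :: "real \<Rightarrow> 'a"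
  assumes \<Phi>: "smooth \<Phi>" and l: "(l has_derivative (\<lambda>h. h *\<^sub>R v)) (at x)"
  shows "((\<lambda>x. \<Phi> (l x)) has_real_derivative dir_deriv v \<Phi> (l x)) (at x)"
proof -
  have "(\<Phi> has_derivative frechet_derivative \<Phi> (at (l x))) (at (l x))"
    using \<Phi> by (simp add: frechet_derivative_works[symmetric] smooth_differentiable)
  with l have "((\<lambda>x. \<Phi> (l x)) has_derivative (\<lambda>h. frechet_derivative \<Phi> (at (l x)) (h *\<^sub>R v))) (at x)"
    by (rule has_derivative_compose)
  moreover have "frechet_derivative \<Phi> (at (l x)) (h *\<^sub>R v) = dir_deriv v \<Phi> (l x) * h" for h
    using linear_cmul[OF linear_frechet_derivative[OF smooth_differentiable[OF \<Phi>]]]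
    by (simp add: dir_deriv_def mult.commute)
  ultimately show ?thesis by (simp add: has_field_derivative_def)
qed

lemma
  assumes "smooth (\<Phi> :: real \<times> real \<Rightarrow> real)"
  shows smooth_space_deriv: "((\<lambda>x. \<Phi> (t, x)) has_real_derivative dir_deriv (0, 1) \<Phi> (t, x)) (at x)"
    and smooth_time_deriv: "((\<lambda>t. \<Phi> (t, x)) has_real_derivative dir_deriv (1, 0) \<Phi> (t, x)) (at t)"
  by (rule smooth_line_deriv[OF assms]; auto intro!: derivative_eq_intros)+

text \<open>Integrating \<Phi>_t over time and differentiating in x under the integral sign
  expresses a difference of \<Phi>_x at two times as the integral of \<Phi>_tx. Differentiation in
  the upper limit gives the claim; the lower limit \<open>t - 1\<close> keeps \<open>t\<close> in
  the interior of the time interval.\<close>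

lemma mixed_derivatives:
  assumes "smooth (\<Phi> :: real \<times> real \<Rightarrow> real)"
  shows "dir_deriv (0, 1) (dir_deriv (1, 0) \<Phi>) = dir_deriv (1, 0) (dir_deriv (0, 1) \<Phi>)"
proof
  fix p :: "real \<times> real"
  obtain t x where p: "p = (t, x)" by force
  define \<Phi>t where "\<Phi>t = dir_deriv (1, 0) \<Phi>"
  define \<Phi>tx where "\<Phi>tx = dir_deriv (0, 1) \<Phi>t"
  have sm: "smooth \<Phi>t" "smooth \<Phi>tx"
    unfolding \<Phi>t_def \<Phi>tx_def using assms by (auto intro: smooth_dir_deriv)
  have cont: "continuous_on A (\<lambda>s. \<Psi> (s, y))" if "smooth \<Psi>" for A \<Psi> and y :: real
    by (rule continuous_on_compose2[OF smooth_continuous[OF that, of UNIV]]) (auto intro: continuous_intros)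
  have integral_eq: "integral {t - 1..s} (\<lambda>r. \<Phi>t (r, y)) = \<Phi> (s, y) - \<Phi> (t - 1, y)" if "t - 1 \<le> s" for s y
    using that smooth_time_deriv[OF assms]
    by (intro integral_unique fundamental_theorem_of_calculus)
      (auto simp: \<Phi>t_def has_real_derivative_iff_has_vector_derivative[symmetric] intro: has_field_derivative_at_within)
  have d1: "((\<lambda>y. integral (cbox (t - 1) s) (\<lambda>r. \<Phi>t (r, y))) has_real_derivative
      integral (cbox (t - 1) s) (\<lambda>r. \<Phi>tx (r, x))) (at x within UNIV)" for s
  proof (rule leibniz_rule_field_derivative)
    show "((\<lambda>y. \<Phi>t (r, y)) has_real_derivative \<Phi>tx (r, y)) (at y within UNIV)" for r y
      unfolding \<Phi>tx_def using smooth_space_deriv[OF sm(1)] by simp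
    show "(\<lambda>r. \<Phi>t (r, y)) integrable_on cbox (t - 1) s" for y
      by (intro integrable_continuous cont sm)
    show "continuous_on (UNIV \<times> cbox (t - 1) s) (\<lambda>(y, r). \<Phi>tx (r, y))"
      unfolding split_beta
      by (rule continuous_on_compose2[OF smooth_continuous[OF sm(2), of UNIV]]) (auto intro!: continuous_intros)
  qed auto
  have d2: "((\<lambda>y. integral (cbox (t - 1) s) (\<lambda>r. \<Phi>t (r, y))) has_real_derivative
      dir_deriv (0, 1) \<Phi> (s, x) - dir_deriv (0, 1) \<Phi> (t - 1, x)) (at x)" if "t - 1 \<le> s" for s
    using integral_eq[OF that] by (auto intro!: derivative_intros smooth_space_deriv assms)
  have eq: "integral {t - 1..s} (\<lambda>r. \<Phi>tx (r, x)) = dir_deriv (0, 1) \<Phi> (s, x) - dir_deriv (0, 1) \<Phi> (t - 1, x)"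
    if "t - 1 \<le> s" for s
    using DERIV_unique[OF d1[of s] d2[OF that]] by simp
  have "((\<lambda>s. integral {t - 1..s} (\<lambda>r. \<Phi>tx (r, x))) has_real_derivative \<Phi>tx (t, x)) (at t within {t - 1..t + 1})"
    by (rule integral_has_real_derivative[OF cont[OF sm(2)]]) auto
  then have "((\<lambda>s. dir_deriv (0, 1) \<Phi> (s, x) - dir_deriv (0, 1) \<Phi> (t - 1, x)) has_real_derivative \<Phi>tx (t, x)) (at t within {t - 1..t + 1})"
    by (rule has_field_derivative_transform_within[of _ _ _ _ 1]) (auto simp: eq)
  then have "((\<lambda>s. dir_deriv (0, 1) \<Phi> (s, x) - dir_deriv (0, 1) \<Phi> (t - 1, x)) has_real_derivative \<Phi>tx (t, x)) (at t)"
    by (simp add: at_within_Icc_at)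
  moreover have "((\<lambda>s. dir_deriv (0, 1) \<Phi> (s, x) - dir_deriv (0, 1) \<Phi> (t - 1, x)) has_real_derivative
      dir_deriv (1, 0) (dir_deriv (0, 1) \<Phi>) (t, x) - 0) (at t)"
    by (intro derivative_intros smooth_time_deriv smooth_dir_deriv assms)
  ultimately show "dir_deriv (0, 1) (dir_deriv (1, 0) \<Phi>) p = dir_deriv (1, 0) (dir_deriv (0, 1) \<Phi>) p"
    using DERIV_unique by (fastforce simp: p \<Phi>tx_def \<Phi>t_def)
qed

lemma smooth_dir_deriv_pow: "smooth \<Phi> \<Longrightarrow> smooth ((dir_deriv v ^^ q) \<Phi>)"
  by (induction q) (auto intro: smooth_dir_deriv)

lemma test_funs_dir_deriv_pow: "\<Phi> \<in> test_funs \<Longrightarrow> (dir_deriv v ^^ q) \<Phi> \<in> test_funs"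
  by (induction q) (auto intro: test_funs_dir_deriv)

lemma mixed_derivatives_pow:
  assumes "smooth (\<Phi> :: real \<times> real \<Rightarrow> real)"
  shows "(dir_deriv (0, 1) ^^ q) (dir_deriv (1, 0) \<Phi>) = dir_deriv (1, 0) ((dir_deriv (0, 1) ^^ q) \<Phi>)"
  by (induction q) (simp_all add: mixed_derivatives smooth_dir_deriv_pow assms)

lemma
  assumes "smooth (\<Phi> :: real \<times> real \<Rightarrow> real)"
  shows smooth_section: "smooth (\<lambda>x. \<Phi> (t, x))"
    and dx_pow_section: "(dx ^^ q) (\<lambda>x. \<Phi> (t, x)) = (\<lambda>x. (dir_deriv (0, 1) ^^ q) \<Phi> (t, x))"
proof -
  define g where "g q x = (dir_deriv (0, 1) ^^ q) \<Phi> (t, x)" for q x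
  have g: "(g q has_real_derivative g (Suc q) x) (at x)" for q x
    unfolding g_def using smooth_space_deriv[OF smooth_dir_deriv_pow[OF assms]] by simp
  show "smooth (\<lambda>x. \<Phi> (t, x))"
    using smooth_realI[of g, OF g] by (simp add: g_def[abs_def])
  show "(dx ^^ q) (\<lambda>x. \<Phi> (t, x)) = (\<lambda>x. (dir_deriv (0, 1) ^^ q) \<Phi> (t, x))"
    using dx_pow_eq[of g q, OF g] by (simp add: g_def[abs_def])
qed

lemma test_funs_box:
  assumes "(\<Phi> :: real \<times> real \<Rightarrow> real) \<in> test_funs"
  shows "\<exists>R>0. \<forall>t x. \<Phi> (t, x) \<noteq> 0 \<longrightarrow> t \<in> {-R..R} \<and> x \<in> {-R..R}"
proof -
  obtain K where K: "compact K" "\<And>p. \<Phi> p \<noteq> 0 \<Longrightarrow> p \<in> K"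
    using test_funs_support[OF assms] by blast
  then obtain B where B: "\<And>p. p \<in> K \<Longrightarrow> norm p \<le> B"
    using compact_imp_bounded bounded_iff by metis
  have "t \<in> {-(\<bar>B\<bar> + 1)..\<bar>B\<bar> + 1} \<and> x \<in> {-(\<bar>B\<bar> + 1)..\<bar>B\<bar> + 1}" if "\<Phi> (t, x) \<noteq> 0" for t x
  proof -
    have "norm (t, x) \<le> B" using that K B by blast
    then show ?thesis
      using norm_fst_le[of t x] norm_snd_le[of x t] by auto
  qed
  moreover have "\<bar>B\<bar> + 1 > 0" by simp
  ultimately show ?thesis by blast
qed

lemma test_funs_section:
  assumes "(\<Phi> :: real \<times> real \<Rightarrow> real) \<in> test_funs"
  shows "(\<lambda>x. \<Phi> (t, x)) \<in> test_funs"
proof -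
  obtain R where R: "\<And>t x. \<Phi> (t, x) \<noteq> 0 \<Longrightarrow> t \<in> {-R..R} \<and> x \<in> {-R..R}"
    using test_funs_box[OF assms] by metis
  show ?thesis
  proof (rule test_funsI[OF smooth_section[OF test_funs_smooth[OF assms]]])
    show "x \<in> {-R..R}" if "\<Phi> (t, x) \<noteq> 0" for x
      using R[OF that] by blast
  qed simp
qed

text \<open>The time derivative has to be taken after any number of x-derivatives, which is where
  \<open>mixed_derivatives_pow\<close> enters. The bound on the second time derivative is the bound
  of a test function on the plane.\<close>

lemma section_curve:
  assumes "(\<Phi> :: real \<times> real \<Rightarrow> real) \<in> test_funs"
  shows "test_curve (\<lambda>t x. \<Phi> (t, x)) (\<lambda>t x. dir_deriv (1, 0) \<Phi> (t, x))"
proof -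
  have d: "((\<lambda>t. (dx ^^ q) (\<lambda>x. \<Psi> (t, x)) x) has_real_derivative (dx ^^ q) (\<lambda>x. dir_deriv (1, 0) \<Psi> (t, x)) x) (at t)"
    if "\<Psi> \<in> test_funs" for q t x and \<Psi> :: "real \<times> real \<Rightarrow> real"
  proof -
    have s: "smooth \<Psi>" using that by (rule test_funs_smooth)
    show ?thesis
      using smooth_time_deriv[OF smooth_dir_deriv_pow[OF s, where v = "(0, 1)" and q = q], of x t]
      by (simp add: dx_pow_section[OF s] dx_pow_section[OF smooth_dir_deriv[OF s]] mixed_derivatives_pow[OF s])
  qed
  have \<Phi>': "dir_deriv (1, 0) \<Phi> \<in> test_funs" "dir_deriv (1, 0) (dir_deriv (1, 0) \<Phi>) \<in> test_funs"
    using assms by (auto intro!: test_funs_dir_deriv)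
  obtain R where R: "\<And>t x. \<Phi> (t, x) \<noteq> 0 \<Longrightarrow> t \<in> {-R..R} \<and> x \<in> {-R..R}"
    using test_funs_box[OF assms] by blast
  obtain R' where R': "\<And>t x. dir_deriv (1, 0) \<Phi> (t, x) \<noteq> 0 \<Longrightarrow> t \<in> {-R'..R'} \<and> x \<in> {-R'..R'}"
    using test_funs_box[OF \<Phi>'(1)] by blast
  show ?thesis
  proof (rule test_curveI[OF _ _ d[OF assms] d[OF \<Phi>'(1)]])
    show "(\<lambda>x. \<Phi> (t, x)) \<in> test_funs" "(\<lambda>x. dir_deriv (1, 0) \<Phi> (t, x)) \<in> test_funs" for t
      using assms \<Phi>' by (auto intro: test_funs_section)
    fix T :: real and q
    obtain C where "\<And>p. \<bar>(dir_deriv (0, 1) ^^ q) (dir_deriv (1, 0) (dir_deriv (1, 0) \<Phi>)) p\<bar> \<le> C"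
      using test_funs_bounded[OF test_funs_dir_deriv_pow[OF \<Phi>'(2)]] by blast
    then show "\<exists>C. \<forall>t x. \<bar>t\<bar> \<le> T \<longrightarrow> \<bar>(dx ^^ q) (\<lambda>x. dir_deriv (1, 0) (dir_deriv (1, 0) \<Phi>) (t, x)) x\<bar> \<le> C"
      by (subst dx_pow_section[OF test_funs_smooth[OF \<Phi>'(2)]]) blast
    show "\<exists>K. compact K \<and> (\<forall>t x. \<bar>t\<bar> \<le> T \<and> x \<notin> K \<longrightarrow> \<Phi> (t, x) = 0 \<and> dir_deriv (1, 0) \<Phi> (t, x) = 0)"
    proof (intro exI conjI allI impI)
      show "compact ({-R..R} \<union> {-R'..R'})"
        by (intro compact_Un compact_Icc)
      show "\<Phi> (t, x) = 0" "dir_deriv (1, 0) \<Phi> (t, x) = 0" if "\<bar>t\<bar> \<le> T \<and> x \<notin> {-R..R} \<union> {-R'..R'}" for t x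
        using that R[of t x] R'[of t x] by blast+
    qed
  qed
qed

section \<open>The damped wave equation in weak and in classical form\<close>

lemma integral_continuous_support:
  fixes f :: "real \<Rightarrow> real"
  assumes f: "continuous_on UNIV f" "\<And>t. f t \<noteq> 0 \<Longrightarrow> t \<in> {-R..R}"
  shows "integrable lborel f" "(LINT t|lborel. f t) = integral {-R..R} f"
proof -
  have eq: "(\<lambda>t. indicator {-R..R} t *\<^sub>R f t) = f"
    using f(2) by (fastforce simp: indicator_def)
  have "set_integrable lborel {-R..R} f"
    unfolding set_integrable_def using f by (intro borel_integrable_compact) (auto intro: continuous_on_subset)
  from set_borel_integral_eq_integral(2)[OF this] this
  show "integrable lborel f" "(LINT t|lborel. f t) = integral {-R..R} f"
    by (simp_all only: set_integrable_def set_lebesgue_integral_def eq)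
qed

lemma integral_deriv_zero:
  fixes F f :: "real \<Rightarrow> real"
  assumes F: "\<And>t. (F has_real_derivative f t) (at t)" and supp: "\<And>t. F t \<noteq> 0 \<Longrightarrow> t \<in> {-R..R}"
    and f: "continuous_on UNIV f" and R: "0 \<le> R"
  shows "(LINT t|lborel. f t) = 0"
proof -
  have f_eq: "f = dx F"
    using dx_eqI[OF F] by auto
  have "{t. F t \<noteq> 0} \<subseteq> {-R..R}"
    using supp by blast
  then have "{t. f t \<noteq> 0} \<subseteq> {-R..R}"
    unfolding f_eq by (intro dir_deriv_support) auto
  \<comment> \<open>Enlarging the interval by 1 puts both endpoints outside {-R..R}, so the boundary
    values of \<open>F\<close> are 0 by \<open>supp\<close>.\<close>
  then have "t \<in> {-(R + 1)..R + 1}" if "f t \<noteq> 0" for t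
    using that by fastforce
  then have "(LINT t|lborel. f t) = integral {-(R + 1)..R + 1} f"
    by (intro integral_continuous_support f)
  also have "\<dots> = F (R + 1) - F (-(R + 1))"
    using F R by (intro integral_unique fundamental_theorem_of_calculus)
      (auto simp: has_real_derivative_iff_has_vector_derivative[symmetric] intro: has_field_derivative_at_within)
  also have "\<dots> = 0"
  proof -
    have "F (R + 1) = 0" "F (-(R + 1)) = 0"
      using supp[of "R + 1"] supp[of "-(R + 1)"] R by fastforce+
    then show ?thesis by simp
  qed
  finally show ?thesis .
qed

section \<open>Functions that vanish weakly, or whose weak derivative vanishes\<close>

lemma antiderivative:
  fixes f :: "real \<Rightarrow> real"
  assumes "continuous_on UNIV f"
  obtains G where "\<And>t. (G has_real_derivative f t) (at t)"
proof (rule that)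
  fix t :: real
  have "((\<lambda>u. LBINT y=ereal 0..ereal u. f y) has_vector_derivative f t) (at t within {-\<bar>t\<bar> - 1..\<bar>t\<bar> + 1})"
    by (rule interval_integral_FTC2) (auto intro: continuous_on_subset[OF assms])
  then show "((\<lambda>u. LBINT y=ereal 0..ereal u. f y) has_real_derivative f t) (at t)"
    by (simp add: has_real_derivative_iff_has_vector_derivative at_within_Icc_at)
qed

text \<open>The zero set is closed and of full measure; a nonempty open complement would have
  positive measure.\<close>

lemma continuous_weak_zero:
  fixes h :: "real \<Rightarrow> real"
  assumes h: "continuous_on UNIV h" and zero: "\<And>\<phi>. \<phi> \<in> test_funs \<Longrightarrow> (LINT x|lborel. h x * \<phi> x) = 0"
  shows "h x = 0"
proof -
  have meas: "h \<in> borel_measurable borel"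
    using h by (rule borel_measurable_continuous_onI)
  have "AE x in lborel. h x = 0"
  proof (rule fundamental_lemma[OF _ meas zero])
    show "integrable lborel (\<lambda>x. indicator {-R<..<R} x * h x)" for R
    proof (rule Bochner_Integration.integrable_bound)
      show "integrable lborel (\<lambda>x. indicator {-R..R} x *\<^sub>R h x)"
        by (intro borel_integrable_compact continuous_on_subset[OF h]) auto
      show "(\<lambda>x. indicator {-R<..<R} x * h x) \<in> borel_measurable lborel"
        using meas by simp
    qed (auto simp: indicator_def)
  qed
  then have "AE x in lebesgue. x \<in> {x. h x = 0}"
    by (auto intro: AE_completion)
  moreover have "closed {x. h x = 0}"
    using h by (intro closed_Collect_eq) auto
  ultimately show ?thesis
    using mem_closed_if_AE_lebesgue by blast
qed

lemma test_funs_translate: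
  fixes \<phi> :: "real \<Rightarrow> real"
  assumes "\<phi> \<in> test_funs"
  shows "(\<lambda>x. \<phi> (x + s)) \<in> test_funs"
proof -
  obtain R where R: "\<And>x. \<phi> x \<noteq> 0 \<Longrightarrow> x \<in> {-R..R}"
    using test_funs_interval[OF assms] by blast
  show ?thesis
  proof (rule test_funsI)
    show "smooth (\<lambda>x. \<phi> (x + s))"
      by (rule smooth_comp_affine[OF test_funs_smooth[OF assms] bounded_linear_ident])
    show "compact {-R - s..R - s}" by simp
    show "x \<in> {-R - s..R - s}" if "\<phi> (x + s) \<noteq> 0" for x
      using R[OF that] by auto
  qed
qed

lemma test_fun_antiderivative_const:
  fixes B :: "real \<Rightarrow> real"
  assumes B: "\<And>t. (B has_real_derivative b t) (at t)" and b: "\<And>t. t \<in> S \<Longrightarrow> b t = 0" and S: "convex S"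
  obtains c where "\<And>t. t \<in> S \<Longrightarrow> B t = c"
proof -
  have "\<exists>c. \<forall>t\<in>S. B t = c"
    using B b S by (intro has_field_derivative_zero_constant) (metis has_field_derivative_at_within)+
  then show ?thesis using that by blast
qed

text \<open>A difference of two translates of \<open>b\<close> has integral zero, so it is the
  derivative of a test function \<open>A\<close>. Testing with \<open>A\<close> shows that
  \<open>W (t + p) - W (t + q)\<close> vanishes weakly in t, and t = 0 gives the claim. Far out, the
  two translates of the antiderivative \<open>B\<close> take the same constant value and cancel,
  hence the compact support of \<open>A\<close>.\<close>

lemma du_bois_reymond:
  fixes W :: "real \<Rightarrow> real"
  assumes W: "continuous_on UNIV W" and zero: "\<And>a. a \<in> test_funs \<Longrightarrow> (LINT t|lborel. dx a t * W t) = 0"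
  shows "W p = W q"
proof -
  have "(LINT t|lborel. (W (t + p) - W (t + q)) * b t) = 0" if b: "b \<in> test_funs" for b
  proof -
    obtain B where B: "\<And>t. (B has_real_derivative b t) (at t)"
      using antiderivative[OF smooth_continuous[OF test_funs_smooth[OF b]]] by blast
    obtain R where R: "\<And>x. b x \<noteq> 0 \<Longrightarrow> x \<in> {-R..R}"
      using test_funs_interval[OF b] by blast
    have b0: "b t = 0" if "t \<notin> {-R..R}" for t
      using R that by blast
    obtain c1 where c1: "\<And>t. t \<in> {..<-R} \<Longrightarrow> B t = c1"
      by (rule test_fun_antiderivative_const[OF B, of "{..<-R}"]) (auto intro: b0)
    obtain c2 where c2: "\<And>t. t \<in> {R<..} \<Longrightarrow> B t = c2"
      by (rule test_fun_antiderivative_const[OF B, of "{R<..}"]) (auto intro: b0)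
    define \<beta> where "\<beta> t = b (t + (-p)) - b (t + (-q))" for t
    define A where "A t = B (t + (-p)) - B (t + (-q))" for t
    define M where "M = \<bar>R\<bar> + \<bar>p\<bar> + \<bar>q\<bar>"
    have \<beta>: "\<beta> \<in> test_funs"
      unfolding \<beta>_def[abs_def] by (intro test_funs_diff test_funs_translate b)
    have A': "(A has_real_derivative \<beta> t) (at t)" for t
      unfolding A_def[abs_def] \<beta>_def
      by (rule DERIV_diff; rule DERIV_shift[THEN iffD1]; rule B)
    \<comment> \<open>\<open>A\<close> is put in front of the derivatives of \<open>\<beta>\<close>
      to form the ladder for \<open>smooth_realI\<close>.\<close>
    define g where "g n = (case n of 0 \<Rightarrow> A | Suc m \<Rightarrow> (dx ^^ m) \<beta>)" for n
    have "(g n has_real_derivative g (Suc n) t) (at t)" for n t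
      using A' smooth_has_deriv[OF test_funs_smooth[OF \<beta>]] by (cases n) (simp_all add: g_def)
    then have "smooth (g 0)"
      by (rule smooth_realI)
    then have "smooth A"
      by (simp add: g_def)
    moreover have "t \<in> {-M..M}" if nz: "A t \<noteq> 0" for t
    proof (rule ccontr)
      assume "t \<notin> {-M..M}"
      then have "t + (-p) \<in> {..<-R} \<and> t + (-q) \<in> {..<-R} \<or> t + (-p) \<in> {R<..} \<and> t + (-q) \<in> {R<..}"
        by (auto simp: M_def)
      then have "A t = 0"
        unfolding A_def using c1 c2 by fastforce
      with nz show False by simp
    qed
    ultimately have A: "A \<in> test_funs"
      by (intro test_funsI[of A "{-M..M}"]) auto
    have bW: "integrable lborel (\<lambda>t. W (t + s) * b t)" for s
    proof (rule integral_continuous_support(1))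
      show "continuous_on UNIV (\<lambda>t. W (t + s) * b t)"
        by (intro continuous_intros continuous_on_compose2[OF W] smooth_continuous test_funs_smooth b) auto
      show "t \<in> {-R..R}" if "W (t + s) * b t \<noteq> 0" for t
        using that R by auto
    qed
    have shift: "(LINT t|lborel. W (t + s) * b t) = (LINT t|lborel. W t * b (t + (-s)))"
      and shift_int: "integrable lborel (\<lambda>t. W t * b (t + (-s)))" for s
      using lborel_integral_real_affine[of 1 "\<lambda>t. W t * b (t + (-s))" s]
        lborel_integrable_real_affine_iff[of 1 "\<lambda>t. W t * b (t + (-s))" s] bW[of s]
      by (simp_all add: add.commute)
    have "(LINT t|lborel. (W (t + p) - W (t + q)) * b t) =
        (LINT t|lborel. W (t + p) * b t) - (LINT t|lborel. W (t + q) * b t)"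
      by (subst Bochner_Integration.integral_diff[symmetric]) (simp_all add: bW left_diff_distrib)
    also have "\<dots> = (LINT t|lborel. dx A t * W t)"
      unfolding shift using dx_eqI[OF A']
      by (subst Bochner_Integration.integral_diff[symmetric]) (simp_all add: shift_int[simplified] \<beta>_def right_diff_distrib mult.commute)
    also have "\<dots> = 0"
      by (rule zero[OF A])
    finally show ?thesis .
  qed
  note weak = this
  have cont: "continuous_on UNIV (\<lambda>t. W (t + s))" for s
    by (rule continuous_on_compose2[OF W]) (auto intro: continuous_intros)
  have "W (0 + p) - W (0 + q) = 0"
    by (rule continuous_weak_zero[OF continuous_on_diff[OF cont cont] weak])
  then show ?thesis by simp
qed

section \<open>Calculus of distribution-valued curves and their pairing with space-time test
  functions\<close>

lemma has_time_deriv_dist_deriv: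
  "has_time_deriv u v t \<Longrightarrow> has_time_deriv (\<lambda>s. dist_deriv w (u s)) (dist_deriv w v) t"
  unfolding has_time_deriv_def
  by (auto simp: pairing_dist_deriv intro!: derivative_intros test_funs_dir_deriv)

lemma has_time_deriv_scaleR:
  "has_time_deriv u v t \<Longrightarrow> has_time_deriv (\<lambda>s. a *\<^sub>R u s) (a *\<^sub>R v) t"
  unfolding has_time_deriv_def
  by (auto simp: scaleR_distribution.rep_eq intro!: derivative_eq_intros)

lemma pairing_diff_distribution: "pairing (S - T) \<phi> = pairing S \<phi> - pairing T \<phi>"
  unfolding minus_distribution_def plus_distribution.rep_eq uminus_distribution.rep_eq by simp

lemma has_time_deriv_diff:
  "has_time_deriv u v t \<Longrightarrow> has_time_deriv u' v' t \<Longrightarrow> has_time_deriv (\<lambda>s. u s - u' s) (v - v') t"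
  unfolding has_time_deriv_def
  by (auto simp: pairing_diff_distribution intro!: derivative_eq_intros)

lemma has_time_deriv_continuous:
  assumes "\<And>t. has_time_deriv u (v t) t" "\<phi> \<in> test_funs"
  shows "continuous_on A (\<lambda>t. pairing (u t) \<phi>)"
  using assms unfolding has_time_deriv_def
  by (intro continuous_at_imp_continuous_on ballI DERIV_isCont) blast

definition section_pairing :: "(real \<Rightarrow> real distribution) \<Rightarrow> (real \<times> real \<Rightarrow> real) \<Rightarrow> real \<Rightarrow> real"
  where "section_pairing u \<Phi> t = pairing (u t) (\<lambda>x. \<Phi> (t, x))"

lemma section_pairing_deriv:
  assumes "has_time_deriv u v t" "\<Phi> \<in> test_funs"
  shows "(section_pairing u \<Phi> has_real_derivative
    pairing v (\<lambda>x. \<Phi> (t, x)) + section_pairing u (dir_deriv (1, 0) \<Phi>) t) (at t)"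
  using pairing_curve_deriv[OF assms(1) section_curve[OF assms(2)]]
  by (simp add: section_pairing_def[abs_def])

lemma section_pairing_continuous:
  assumes "\<And>t. has_time_deriv u (v t) t" "\<Phi> \<in> test_funs"
  shows "continuous_on A (section_pairing u \<Phi>)"
  by (intro continuous_at_imp_continuous_on ballI DERIV_isCont[OF section_pairing_deriv[OF assms]])

lemma section_pairing_support:
  assumes "\<And>t x. \<Phi> (t, x) \<noteq> 0 \<Longrightarrow> t \<in> {-R..R} \<and> x \<in> {-R..R}" "section_pairing u \<Phi> t \<noteq> 0"
  shows "t \<in> {-R..R}"
proof (rule ccontr)
  assume "t \<notin> {-R..R}"
  then have "(\<lambda>x. \<Phi> (t, x)) = (\<lambda>x. 0 * 0)"
    using assms(1) by auto
  then show False
    using assms(2) pairing_cmult[OF test_funs_zero, of "u t" 0] by (simp add: section_pairing_def)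
qed

lemma section_pairing_integrable:
  assumes "\<And>t. has_time_deriv u (v t) t" "\<Phi> \<in> test_funs"
  shows "integrable lborel (section_pairing u \<Phi>)"
proof -
  obtain R where "\<And>t x. \<Phi> (t, x) \<noteq> 0 \<Longrightarrow> t \<in> {-R..R} \<and> x \<in> {-R..R}"
    using test_funs_box[OF assms(2)] by metis
  from section_pairing_support[OF this] show ?thesis
    by (rule integral_continuous_support(1)[OF section_pairing_continuous[OF assms]])
qed

text \<open>The product rule \<open>section_pairing_deriv\<close> is integrated over time; compact
  support in t removes the boundary terms. The derivative of \<open>v\<close> provides the
  continuity of the integrand.\<close>

lemma section_pairing_parts:
  assumes u: "\<And>t. has_time_deriv u (v t) t" and v: "\<And>t. has_time_deriv v (w t) t" and \<Phi>: "\<Phi> \<in> test_funs"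
  shows "(LINT t|lborel. section_pairing u (dir_deriv (1, 0) \<Phi>) t) = - (LINT t|lborel. section_pairing v \<Phi> t)"
proof -
  have \<Phi>': "dir_deriv (1, 0) \<Phi> \<in> test_funs"
    using \<Phi> by (rule test_funs_dir_deriv)
  obtain R where R: "R > 0" "\<And>t x. \<Phi> (t, x) \<noteq> 0 \<Longrightarrow> t \<in> {-R..R} \<and> x \<in> {-R..R}"
    using test_funs_box[OF \<Phi>] by metis
  have "(LINT t|lborel. section_pairing v \<Phi> t + section_pairing u (dir_deriv (1, 0) \<Phi>) t) = 0"
  proof (rule integral_deriv_zero)
    show "(section_pairing u \<Phi> has_real_derivative
        section_pairing v \<Phi> t + section_pairing u (dir_deriv (1, 0) \<Phi>) t) (at t)" for t
      using section_pairing_deriv[OF u \<Phi>] by (simp add: section_pairing_def)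
    show "t \<in> {-R..R}" if "section_pairing u \<Phi> t \<noteq> 0" for t
      using R(2) that by (rule section_pairing_support)
    show "continuous_on UNIV (\<lambda>t. section_pairing v \<Phi> t + section_pairing u (dir_deriv (1, 0) \<Phi>) t)"
      by (intro continuous_intros section_pairing_continuous[OF u \<Phi>'] section_pairing_continuous[OF v \<Phi>])
  qed (use R in simp)
  then show ?thesis
    by (subst (asm) Bochner_Integration.integral_add)
      (auto intro: section_pairing_integrable[OF u \<Phi>'] section_pairing_integrable[OF v \<Phi>])
qed

text \<open>Continuity is the delicate point. Along a null sequence the time integral is controlled
  by the largest section pairing, attained at some time \<open>\<tau> n\<close>. The sections at
  these times again form a null sequence and the \<open>u (\<tau> n)\<close> are pointwise bounded,
  so \<open>pairing_seq_null\<close> applies.\<close>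

lemma spacetime_distribution_exists:
  assumes u: "\<And>t. has_time_deriv u (v t) t"
  shows "\<exists>U. spacetime_distribution u U"
proof -
  define S where "S \<Phi> = (if \<Phi> \<in> test_funs then LINT t|lborel. section_pairing u \<Phi> t else 0)" for \<Phi>
  have "is_distribution S"
    unfolding is_distribution_def
  proof (intro conjI ballI allI impI)
    fix \<Phi> \<Psi> :: "real \<times> real \<Rightarrow> real" assume \<Phi>: "\<Phi> \<in> test_funs" and \<Psi>: "\<Psi> \<in> test_funs"
    have "section_pairing u (\<lambda>x. \<Phi> x + \<Psi> x) = (\<lambda>t. section_pairing u \<Phi> t + section_pairing u \<Psi> t)"
      unfolding section_pairing_def using \<Phi> \<Psi> by (simp add: pairing_add test_funs_section)
    then show "S (\<lambda>x. \<Phi> x + \<Psi> x) = S \<Phi> + S \<Psi>"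
      using \<Phi> \<Psi> by (simp add: S_def test_funs_add section_pairing_integrable[OF u])
  next
    fix a and \<Phi> :: "real \<times> real \<Rightarrow> real" assume \<Phi>: "\<Phi> \<in> test_funs"
    have "section_pairing u (\<lambda>x. a * \<Phi> x) = (\<lambda>t. a * section_pairing u \<Phi> t)"
      unfolding section_pairing_def using \<Phi> by (simp add: pairing_cmult test_funs_section)
    then show "S (\<lambda>x. a * \<Phi> x) = a * S \<Phi>"
      using \<Phi> by (simp add: S_def test_funs_cmult)
  next
    fix \<Phi> :: "nat \<Rightarrow> real \<times> real \<Rightarrow> real" assume null: "test_null_seq \<Phi>"
    have \<Phi>: "\<Phi> n \<in> test_funs" for n
      using null by (simp add: test_null_seq_def)
    obtain K where K: "compact K" "\<And>n. {p. \<Phi> n p \<noteq> 0} \<subseteq> K"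
      using null unfolding test_null_seq_def by blast
    obtain R where R: "R > 0" "fst ` K \<union> snd ` K \<subseteq> {-R..R}"
    proof (rule compact_real_interval)
      show "compact (fst ` K \<union> snd ` K)"
        by (intro compact_Un compact_continuous_image continuous_intros K)
    qed blast
    have box: "t \<in> {-R..R} \<and> x \<in> {-R..R}" if "\<Phi> n (t, x) \<noteq> 0" for n t x
      using that K(2)[of n] R(2) by force
    have "\<exists>\<tau>\<in>{-R..R}. \<forall>t\<in>{-R..R}. \<bar>section_pairing u (\<Phi> n) t\<bar> \<le> \<bar>section_pairing u (\<Phi> n) \<tau>\<bar>" for n
      using R by (intro continuous_attains_sup continuous_intros section_pairing_continuous[OF u \<Phi>]) auto
    then obtain \<tau> where \<tau>: "\<And>n. \<tau> n \<in> {-R..R}"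
      "\<And>n t. t \<in> {-R..R} \<Longrightarrow> \<bar>section_pairing u (\<Phi> n) t\<bar> \<le> \<bar>section_pairing u (\<Phi> n) (\<tau> n)\<bar>"
      by metis
    define Q where "Q n x = \<Phi> n (\<tau> n, x)" for n x
    have Q: "test_null_seq Q"
    proof (rule test_null_seq_realI)
      show "Q n \<in> test_funs" for n
        unfolding Q_def[abs_def] by (intro test_funs_section \<Phi>)
      show "x \<in> {-R..R}" if "Q n x \<noteq> 0" for n x
        using box[of n "\<tau> n" x] that by (simp add: Q_def)
      fix q
      have "uniform_limit UNIV (\<lambda>n. foldr dir_deriv (replicate q (0, 1)) (\<Phi> n)) (\<lambda>_. 0) sequentially"
        using null unfolding test_null_seq_def by blast
      then have lim: "uniform_limit UNIV (\<lambda>n. (dir_deriv (0, 1) ^^ q) (\<Phi> n)) (\<lambda>_. 0) sequentially"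
        by (simp only: foldr_replicate)
      have Q_deriv: "(dx ^^ q) (Q n) x = (dir_deriv (0, 1) ^^ q) (\<Phi> n) (\<tau> n, x)" for n x
        unfolding Q_def[abs_def] by (simp only: dx_pow_section[OF test_funs_smooth[OF \<Phi>]])
      show "uniform_limit UNIV (\<lambda>n. (dx ^^ q) (Q n)) (\<lambda>_. 0) sequentially"
      proof (rule uniform_limitI)
        fix e :: real assume "e > 0"
        from uniform_limitD[OF lim this]
        show "\<forall>\<^sub>F n in sequentially. \<forall>x\<in>UNIV. dist ((dx ^^ q) (Q n) x) 0 < e"
          by (rule eventually_mono) (simp only: Q_deriv UNIV_I ball_UNIV simp_thms)
      qed
    qed simp
    have "(\<lambda>n. pairing (u (\<tau> n)) (Q n)) \<longlonglongrightarrow> 0"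
    proof (rule pairing_seq_null[of "\<lambda>n. u (\<tau> n)", OF _ Q])
      fix \<phi> :: "real \<Rightarrow> real" assume \<phi>: "\<phi> \<in> test_funs"
      have "compact ((\<lambda>t. pairing (u t) \<phi>) ` {-R..R})"
        by (intro compact_continuous_image has_time_deriv_continuous[OF u \<phi>]) simp
      then obtain C where "\<And>t. t \<in> {-R..R} \<Longrightarrow> norm (pairing (u t) \<phi>) \<le> C"
        by (meson compact_imp_bounded bounded_iff imageI)
      then show "Bseq (\<lambda>n. pairing (u (\<tau> n)) \<phi>)"
        using \<tau>(1) by (intro BseqI') blast
    qed
    then have "(\<lambda>n. section_pairing u (\<Phi> n) (\<tau> n)) \<longlonglongrightarrow> 0"
      by (simp add: section_pairing_def Q_def[abs_def])
    then have lim: "(\<lambda>n. \<bar>section_pairing u (\<Phi> n) (\<tau> n)\<bar> * (R - (-R))) \<longlonglongrightarrow> 0"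
      by (intro tendsto_mult_left_zero tendsto_rabs_zero)
    have "\<bar>S (\<Phi> n)\<bar> \<le> \<bar>section_pairing u (\<Phi> n) (\<tau> n)\<bar> * (R - (-R))" for n
    proof -
      have supp: "t \<in> {-R..R}" if "section_pairing u (\<Phi> n) t \<noteq> 0" for t
        by (rule section_pairing_support[OF _ that]) (rule box)
      have "S (\<Phi> n) = (LINT t|lborel. section_pairing u (\<Phi> n) t)"
        by (simp add: S_def \<Phi>)
      also have "\<dots> = integral {-R..R} (section_pairing u (\<Phi> n))"
        by (rule integral_continuous_support(2)[OF section_pairing_continuous[OF u \<Phi>] supp])
      finally have "S (\<Phi> n) = integral {-R..R} (section_pairing u (\<Phi> n))" .
      moreover have "norm (integral {-R..R} (section_pairing u (\<Phi> n))) \<le> \<bar>section_pairing u (\<Phi> n) (\<tau> n)\<bar> * (R - (-R))"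
        using R \<tau>(2) by (intro integral_bound section_pairing_continuous[OF u \<Phi>]) auto
      ultimately show ?thesis by simp
    qed
    then show "(\<lambda>n. S (\<Phi> n)) \<longlonglongrightarrow> 0"
      by (intro Lim_null_comparison[OF _ lim]) auto
  qed (simp add: S_def)
  then have "pairing (Abs_distribution S) \<Phi> = S \<Phi>" for \<Phi>
    by (simp add: Abs_distribution_inverse)
  then show ?thesis
    unfolding spacetime_distribution_def section_pairing_def[symmetric]
    by (intro exI[of _ "Abs_distribution S"]) (simp add: S_def)
qed

section \<open>Equivalence of the weak equation with a first-order system in time\<close>

abbreviation dd :: "real distribution \<Rightarrow> real distribution"
  where "dd T \<equiv> dist_deriv 1 (dist_deriv 1 T)"

lemma pairing_dd: "\<phi> \<in> test_funs \<Longrightarrow> pairing (dd T) \<phi> = pairing T (dx (dx \<phi>))"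
  by (simp add: pairing_dist_deriv test_funs_dir_deriv)

lemma pairing_wave_operator:
  assumes "\<Phi> \<in> test_funs"
  shows "pairing (D_t (D_t U) + k *\<^sub>R D_t U) \<Phi> =
      pairing U (dir_deriv (1, 0) (dir_deriv (1, 0) \<Phi>)) - k * pairing U (dir_deriv (1, 0) \<Phi>)"
    and "pairing (c\<^sup>2 *\<^sub>R D_x (D_x U)) \<Phi> = c\<^sup>2 * pairing U (dir_deriv (0, 1) (dir_deriv (0, 1) \<Phi>))"
  using assms
  by (simp_all add: plus_distribution.rep_eq scaleR_distribution.rep_eq pairing_dist_deriv test_funs_dir_deriv)

text \<open>Each time derivative of \<Phi> is integrated by parts onto the curve, which replaces
  \<open>u\<close> by \<open>v\<close> and \<open>v\<close> by its derivative \<open>w\<close>; the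
  equation for \<open>w\<close> then holds section by section.\<close>

lemma classical_imp_weak:
  assumes u: "\<And>t. has_time_deriv u (v t) t"
    and v: "\<And>t. has_time_deriv v (c\<^sup>2 *\<^sub>R dd (u t) - k *\<^sub>R v t) t"
  shows "\<exists>U. spacetime_distribution u U \<and> D_t (D_t U) + k *\<^sub>R D_t U = c\<^sup>2 *\<^sub>R D_x (D_x U)"
proof -
  obtain U where U: "spacetime_distribution u U"
    using spacetime_distribution_exists[OF u] by blast
  have U_eq: "pairing U \<Phi> = (LINT t|lborel. section_pairing u \<Phi> t)" if "\<Phi> \<in> test_funs" for \<Phi>
    using U that by (simp add: spacetime_distribution_def section_pairing_def)
  define w where "w t = c\<^sup>2 *\<^sub>R dd (u t) - k *\<^sub>R v t" for t
  have v': "has_time_deriv v (w t) t" for t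
    using v by (simp add: w_def)
  \<comment> \<open>The second integration by parts asks for a derivative of \<open>w\<close>;
    differentiating the equation once more provides it.\<close>
  have w: "has_time_deriv w (c\<^sup>2 *\<^sub>R dd (v t) - k *\<^sub>R w t) t" for t
    unfolding w_def[abs_def]
    using v' by (intro has_time_deriv_diff has_time_deriv_scaleR has_time_deriv_dist_deriv u) (simp add: w_def)
  have "D_t (D_t U) + k *\<^sub>R D_t U = c\<^sup>2 *\<^sub>R D_x (D_x U)"
  proof (rule distribution_eqI)
    fix \<Phi> :: "real \<times> real \<Rightarrow> real" assume \<Phi>: "\<Phi> \<in> test_funs"
    let ?t = "dir_deriv (1, 0) \<Phi>" and ?xx = "dir_deriv (0, 1) (dir_deriv (0, 1) \<Phi>)"
    have \<Phi>': "?t \<in> test_funs" "dir_deriv (1, 0) ?t \<in> test_funs" "?xx \<in> test_funs"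
      using \<Phi> by (auto intro!: test_funs_dir_deriv)
    have sec: "section_pairing w \<Phi> t = c\<^sup>2 * section_pairing u ?xx t - k * section_pairing v \<Phi> t" for t
    proof -
      have "dx (dx (\<lambda>x. \<Phi> (t, x))) = (\<lambda>x. ?xx (t, x))"
        using dx_pow_section[OF test_funs_smooth[OF \<Phi>], of 2 t] by (simp add: numeral_2_eq_2)
      then show ?thesis
        using test_funs_section[OF \<Phi>]
        by (simp add: w_def section_pairing_def pairing_diff_distribution scaleR_distribution.rep_eq pairing_dd)
    qed
    have "pairing U (dir_deriv (1, 0) ?t) = (LINT t|lborel. section_pairing w \<Phi> t)"
      using section_pairing_parts[OF u v' \<Phi>'(1)] section_pairing_parts[OF v' w \<Phi>] by (simp add: U_eq \<Phi>')
    also have "\<dots> = c\<^sup>2 * (LINT t|lborel. section_pairing u ?xx t) - k * (LINT t|lborel. section_pairing v \<Phi> t)"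
      unfolding sec
      by (simp add: section_pairing_integrable[OF u \<Phi>'(3)] section_pairing_integrable[OF v' \<Phi>])
    also have "\<dots> = c\<^sup>2 * pairing U ?xx + k * pairing U ?t"
      using section_pairing_parts[OF u v' \<Phi>] by (simp add: U_eq \<Phi>')
    finally show "pairing (D_t (D_t U) + k *\<^sub>R D_t U) \<Phi> = pairing (c\<^sup>2 *\<^sub>R D_x (D_x U)) \<Phi>"
      by (simp add: pairing_wave_operator[OF \<Phi>])
  qed
  with U show ?thesis by blast
qed

lemma
  assumes a: "a \<in> test_funs" and \<phi>: "\<phi> \<in> test_funs"
  shows test_funs_tensor: "(\<lambda>p. a (fst p) * \<phi> (snd p)) \<in> test_funs"
    and dir_deriv_tensor: "dir_deriv (r, s) (\<lambda>p. a (fst p) * \<phi> (snd p)) =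
      (\<lambda>p. r * (dx a (fst p) * \<phi> (snd p)) + s * (a (fst p) * dx \<phi> (snd p)))"
proof -
  note sa = test_funs_smooth[OF a] and s\<phi> = test_funs_smooth[OF \<phi>]
  obtain R where R: "\<And>x. a x \<noteq> 0 \<Longrightarrow> x \<in> {-R..R}"
    using test_funs_interval[OF a] by metis
  obtain R' where R': "\<And>x. \<phi> x \<noteq> 0 \<Longrightarrow> x \<in> {-R'..R'}"
    using test_funs_interval[OF \<phi>] by metis
  show "(\<lambda>p. a (fst p) * \<phi> (snd p)) \<in> test_funs"
  proof (rule test_funsI)
    show "smooth (\<lambda>p. a (fst p) * \<phi> (snd p))"
      using smooth_mult[OF smooth_comp_affine[OF sa bounded_linear_fst, of 0] smooth_comp_affine[OF s\<phi> bounded_linear_snd, of 0]]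
      by simp
    show "compact ({-R..R} \<times> {-R'..R'})"
      by (intro compact_Times compact_Icc)
    show "p \<in> {-R..R} \<times> {-R'..R'}" if "a (fst p) * \<phi> (snd p) \<noteq> 0" for p
      using R[of "fst p"] R'[of "snd p"] that by (cases p) auto
  qed
  show "dir_deriv (r, s) (\<lambda>p. a (fst p) * \<phi> (snd p)) =
      (\<lambda>p. r * (dx a (fst p) * \<phi> (snd p)) + s * (a (fst p) * dx \<phi> (snd p)))"
  proof
    fix p :: "real \<times> real"
    have "((\<lambda>p. a (fst p + 0) * \<phi> (snd p + 0)) has_derivative
        (\<lambda>h. a (fst p + 0) * (snd h * dx \<phi> (snd p + 0)) + (fst h * dx a (fst p + 0)) * \<phi> (snd p + 0))) (at p)"
      by (intro has_derivative_mult has_derivative_comp_affine sa s\<phi> bounded_linear_fst bounded_linear_snd)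
    then show "dir_deriv (r, s) (\<lambda>p. a (fst p) * \<phi> (snd p)) p =
        r * (dx a (fst p) * \<phi> (snd p)) + s * (a (fst p) * dx \<phi> (snd p))"
      using dir_deriv_eqI by fastforce
  qed
qed

text \<open>Tensor products a(t) \<phi>(x) reduce the equation, for fixed \<phi>, to h'' + k h' =
  c^2 h2 in the weak sense in t. Its primitive \<open>W\<close> has weak derivative zero and is
  therefore constant; solving for \<open>h'\<close> exhibits it as differentiable.\<close>

lemma weak_imp_classical:
  assumes u: "\<And>t. has_time_deriv u (v t) t"
    and v: "\<And>\<phi>. \<phi> \<in> test_funs \<Longrightarrow> continuous_on UNIV (\<lambda>t. pairing (v t) \<phi>)"
    and U: "spacetime_distribution u U" "D_t (D_t U) + k *\<^sub>R D_t U = c\<^sup>2 *\<^sub>R D_x (D_x U)"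
  shows "has_time_deriv v (c\<^sup>2 *\<^sub>R dd (u t) - k *\<^sub>R v t) t"
  unfolding has_time_deriv_def
proof
  fix \<phi> :: "real \<Rightarrow> real" assume \<phi>: "\<phi> \<in> test_funs"
  define h where "h t = pairing (u t) \<phi>" for t
  define h' where "h' t = pairing (v t) \<phi>" for t
  define h2 where "h2 t = pairing (u t) (dx (dx \<phi>))" for t
  have \<phi>2: "dx (dx \<phi>) \<in> test_funs"
    using \<phi> by (intro test_funs_dir_deriv)
  have h: "(h has_real_derivative h' t) (at t)" for t
    using u[of t] \<phi> unfolding h_def[abs_def] h'_def has_time_deriv_def by blast
  have h_cont: "continuous_on UNIV h"
    unfolding h_def[abs_def] by (rule has_time_deriv_continuous[OF u \<phi>])
  have h'_cont: "continuous_on UNIV h'"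
    unfolding h'_def[abs_def] by (rule v[OF \<phi>])
  have h2_cont: "continuous_on UNIV h2"
    unfolding h2_def[abs_def] by (rule has_time_deriv_continuous[OF u \<phi>2])
  obtain G where G: "\<And>t. (G has_real_derivative h2 t) (at t)"
    using antiderivative[OF h2_cont] by blast
  have G_cont: "continuous_on UNIV G"
    using DERIV_isCont[OF G] by (simp add: continuous_at_imp_continuous_on)
  define W where "W t = h' t + k * h t - c\<^sup>2 * G t" for t
  have W_cont: "continuous_on UNIV W"
    unfolding W_def[abs_def] by (intro continuous_intros h_cont h'_cont G_cont)
  have prod_int: "integrable lborel (\<lambda>t. a t * f t)" if af: "a \<in> test_funs" "continuous_on UNIV f" for a f :: "real \<Rightarrow> real"
  proof -
    obtain R where R: "\<And>x. a x \<noteq> 0 \<Longrightarrow> x \<in> {-R..R}"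
      using test_funs_interval[OF af(1)] by metis
    show ?thesis
    proof (rule integral_continuous_support(1))
      show "continuous_on UNIV (\<lambda>t. a t * f t)"
        by (intro continuous_intros af smooth_continuous test_funs_smooth)
      show "t \<in> {-R..R}" if "a t * f t \<noteq> 0" for t
        using R[of t] that by auto
    qed
  qed
  have parts: "(LINT t|lborel. dx a t * f t) = - (LINT t|lborel. a t * f' t)"
    if a: "a \<in> test_funs" and f: "\<And>t. (f has_real_derivative f' t) (at t)" and f': "continuous_on UNIV f'" for a f f'
  proof -
    obtain R where R: "R > 0" "\<And>x. a x \<noteq> 0 \<Longrightarrow> x \<in> {-R..R}"
      using test_funs_interval[OF a] by metis
    have a': "dx a \<in> test_funs" using a by (rule test_funs_dir_deriv)
    have f_cont: "continuous_on UNIV f"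
      using DERIV_isCont[OF f] by (simp add: continuous_at_imp_continuous_on)
    have "(LINT t|lborel. dx a t * f t + a t * f' t) = 0"
    proof (rule integral_deriv_zero)
      show "((\<lambda>t. a t * f t) has_real_derivative dx a t * f t + a t * f' t) (at t)" for t
        using DERIV_mult[OF smooth_has_deriv_0[OF test_funs_smooth[OF a]] f, of t] by (simp add: mult.commute)
      show "t \<in> {-R..R}" if "a t * f t \<noteq> 0" for t
        using R(2)[of t] that by auto
      show "continuous_on UNIV (\<lambda>t. dx a t * f t + a t * f' t)"
        by (intro continuous_intros f_cont f' smooth_continuous test_funs_smooth a a')
    qed (use R in simp)
    then show ?thesis
      by (subst (asm) Bochner_Integration.integral_add) (auto intro: prod_int a a' f_cont f')
  qed
  have weak: "(LINT t|lborel. dx a t * W t) = 0" if a: "a \<in> test_funs" for a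
  proof -
    have a': "dx a \<in> test_funs" "dx (dx a) \<in> test_funs" and \<phi>': "dx \<phi> \<in> test_funs"
      using a \<phi> by (auto intro: test_funs_dir_deriv)
    have U_tensor: "pairing U (\<lambda>p. b (fst p) * \<psi> (snd p)) = (LINT t|lborel. b t * pairing (u t) \<psi>)"
      if "b \<in> test_funs" "\<psi> \<in> test_funs" for b \<psi>
      using U(1) test_funs_tensor[OF that] that by (simp add: spacetime_distribution_def pairing_cmult)
    define \<Phi> where "\<Phi> = (\<lambda>p. a (fst p) * \<phi> (snd p))"
    have \<Phi>: "\<Phi> \<in> test_funs"
      unfolding \<Phi>_def by (rule test_funs_tensor[OF a \<phi>])
    have "dir_deriv (1, 0) \<Phi> = (\<lambda>p. dx a (fst p) * \<phi> (snd p))"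
      "dir_deriv (0, 1) \<Phi> = (\<lambda>p. a (fst p) * dx \<phi> (snd p))"
      unfolding \<Phi>_def by (simp_all add: dir_deriv_tensor[OF a \<phi>])
    then have "pairing U (\<lambda>p. dx (dx a) (fst p) * \<phi> (snd p)) - k * pairing U (\<lambda>p. dx a (fst p) * \<phi> (snd p)) =
        c\<^sup>2 * pairing U (\<lambda>p. a (fst p) * dx (dx \<phi>) (snd p))"
      using pairing_wave_operator(1)[OF \<Phi>, of U k] pairing_wave_operator(2)[OF \<Phi>, of c U] U(2)
      by (simp add: dir_deriv_tensor[OF a'(1) \<phi>] dir_deriv_tensor[OF a \<phi>'])
    then have "(LINT t|lborel. dx (dx a) t * h t) - k * (LINT t|lborel. dx a t * h t) = c\<^sup>2 * (LINT t|lborel. a t * h2 t)"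
      using a a' \<phi> \<phi>2 by (simp add: U_tensor h_def h2_def)
    then have "(LINT t|lborel. dx a t * h' t) + k * (LINT t|lborel. dx a t * h t) - c\<^sup>2 * (LINT t|lborel. dx a t * G t) = 0"
      using parts[OF a'(1) h h'_cont] parts[OF a G h2_cont] by simp
    moreover have "(LINT t|lborel. dx a t * W t) =
        (LINT t|lborel. dx a t * h' t + k * (dx a t * h t) - c\<^sup>2 * (dx a t * G t))"
      by (intro Bochner_Integration.integral_cong) (simp_all add: W_def algebra_simps)
    ultimately show ?thesis
      using prod_int[OF a'(1) h_cont] prod_int[OF a'(1) h'_cont] prod_int[OF a'(1) G_cont] by simp
  qed
  have "h' t = W 0 - k * h t + c\<^sup>2 * G t" for t
    using du_bois_reymond[OF W_cont weak, of t 0] by (simp add: W_def)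
  then have "h' = (\<lambda>t. W 0 - k * h t + c\<^sup>2 * G t)"
    by blast
  moreover have "((\<lambda>t. W 0 - k * h t + c\<^sup>2 * G t) has_real_derivative (0 - k * h' t + c\<^sup>2 * h2 t)) (at t)"
    by (intro DERIV_add DERIV_diff DERIV_const DERIV_cmult h G)
  moreover have "pairing (c\<^sup>2 *\<^sub>R dd (u t) - k *\<^sub>R v t) \<phi> = 0 - k * h' t + c\<^sup>2 * h2 t"
    using \<phi> by (simp add: pairing_diff_distribution scaleR_distribution.rep_eq pairing_dd h2_def h'_def)
  ultimately show "((\<lambda>s. pairing (v s) \<phi>) has_real_derivative pairing (c\<^sup>2 *\<^sub>R dd (u t) - k *\<^sub>R v t) \<phi>) (at t)"
    by (simp add: h'_def[abs_def])
qed

lemma has_time_deriv_unique: "has_time_deriv u v t \<Longrightarrow> has_time_deriv u w t \<Longrightarrow> v = w"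
  unfolding has_time_deriv_def by (intro distribution_eqI) (blast intro: DERIV_unique)

lemma time_deriv_eq: "has_time_deriv u v t \<Longrightarrow> time_deriv u t = v"
  unfolding time_deriv_def using has_time_deriv_unique by blast

text \<open>Existence and uniqueness are proved for this system. Time derivatives are unique, so
  \<open>u\<close> determines \<open>v\<close>, and the condition on \<open>time_deriv\<close>
  becomes \<open>v 0 = g\<close>.\<close>

lemma is_solution_iff:
  "is_solution k c f g u \<longleftrightarrow> (\<exists>v. (\<forall>t. has_time_deriv u (v t) t) \<and>
    (\<forall>t. has_time_deriv v (c\<^sup>2 *\<^sub>R dd (u t) - k *\<^sub>R v t) t) \<and> u 0 = f \<and> v 0 = g)" (is "_ \<longleftrightarrow> ?R")
proof
  assume sol: "is_solution k c f g u"
  then obtain v where v: "\<And>t. has_time_deriv u (v t) t"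
    "\<And>\<phi>. \<phi> \<in> test_funs \<Longrightarrow> continuous_on UNIV (\<lambda>t. pairing (v t) \<phi>)"
    unfolding is_solution_def C1_distribution_def by blast
  obtain U where "spacetime_distribution u U" "D_t (D_t U) + k *\<^sub>R D_t U = c\<^sup>2 *\<^sub>R D_x (D_x U)"
    using sol unfolding is_solution_def by blast
  note weak_imp_classical[OF v this]
  moreover have "u 0 = f" "v 0 = g"
    using sol time_deriv_eq[OF v(1)] by (auto simp: is_solution_def)
  ultimately show ?R
    using v(1) by blast
next
  assume ?R
  then obtain v where v: "\<And>t. has_time_deriv u (v t) t"
    "\<And>t. has_time_deriv v (c\<^sup>2 *\<^sub>R dd (u t) - k *\<^sub>R v t) t" "u 0 = f" "v 0 = g"
    by blast
  have "C1_distribution u"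
    unfolding C1_distribution_def using v(1) has_time_deriv_continuous[OF v(2)] by blast
  then show "is_solution k c f g u"
    unfolding is_solution_def using classical_imp_weak[OF v(1,2)] time_deriv_eq[OF v(1)] v(3,4) by auto
qed

section \<open>The modified Bessel series\<close>

text \<open>With \<open>a = \<alpha>\<^sup>2\<close>, \<open>bessel a \<lambda>\<close> is \<open>I\<^sub>0 (2\<alpha>\<surd>\<lambda>)\<close>, written as an entire function of \<open>\<lambda>\<close>,
  and \<open>bessel' a \<lambda>\<close> is \<open>\<alpha> I\<^sub>0' (2\<alpha>\<surd>\<lambda>) / \<surd>\<lambda>\<close>.\<close>

definition bessel_coeff :: "real \<Rightarrow> nat \<Rightarrow> real"
  where "bessel_coeff a n = a ^ n / (fact n)\<^sup>2"

definition bessel :: "real \<Rightarrow> real \<Rightarrow> real"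
  where "bessel a x = (\<Sum>n. bessel_coeff a n * x ^ n)"

definition bessel' :: "real \<Rightarrow> real \<Rightarrow> real"
  where "bessel' a x = (\<Sum>n. diffs (bessel_coeff a) n * x ^ n)"

definition bessel'' :: "real \<Rightarrow> real \<Rightarrow> real"
  where "bessel'' a x = (\<Sum>n. diffs (diffs (bessel_coeff a)) n * x ^ n)"

lemma summable_bessel: "summable (\<lambda>n. bessel_coeff a n * x ^ n)"
proof (rule summable_comparison_test_ev)
  show "summable (\<lambda>n. inverse (fact n) * \<bar>a * x\<bar> ^ n)"
    by (rule summable_exp)
  show "\<forall>\<^sub>F n in sequentially. norm (bessel_coeff a n * x ^ n) \<le> inverse (fact n) * \<bar>a * x\<bar> ^ n"
  proof (intro always_eventually allI)
    fix n
    have "1 \<le> (fact n :: real)" by (rule fact_ge_1)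
    then have "inverse ((fact n)\<^sup>2) \<le> inverse (fact n :: real)"
      by (simp add: power2_eq_square field_simps)
    then have "inverse ((fact n)\<^sup>2) * \<bar>a * x\<bar> ^ n \<le> inverse (fact n) * \<bar>a * x\<bar> ^ n"
      by (rule mult_right_mono) simp
    then show "norm (bessel_coeff a n * x ^ n) \<le> inverse (fact n) * \<bar>a * x\<bar> ^ n"
      by (simp add: bessel_coeff_def abs_mult power_abs[symmetric] power_mult_distrib divide_inverse mult_ac)
  qed
qed

lemma summable_bessel': "summable (\<lambda>n. diffs (bessel_coeff a) n * x ^ n)"
  using summable_bessel by (rule termdiff_converges_all)

lemma summable_bessel'': "summable (\<lambda>n. diffs (diffs (bessel_coeff a)) n * x ^ n)"
  using summable_bessel' by (rule termdiff_converges_all)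

lemma bessel_deriv: "(bessel a has_real_derivative bessel' a x) (at x)"
  unfolding bessel_def[abs_def] bessel'_def
  by (rule termdiffs_strong_converges_everywhere[OF summable_bessel])

lemma bessel'_deriv: "(bessel' a has_real_derivative bessel'' a x) (at x)"
  unfolding bessel'_def[abs_def] bessel''_def
  by (rule termdiffs_strong_converges_everywhere[OF summable_bessel'])

lemma bessel_0: "bessel a 0 = 1"
  unfolding bessel_def powser_zero by (simp add: bessel_coeff_def)

text \<open>The coefficients satisfy (n + 1)^2 c(n+1) = a c(n). This is the modified Bessel equation
  in the variable \<lambda>, and it is the reason why the kernel solves the wave equation with its
  zero-order term.\<close>

lemma bessel_equation: "x * bessel'' a x + bessel' a x = a * bessel a x"
proof -
  have "(\<lambda>n. diffs (diffs (bessel_coeff a)) n * x ^ n * x) sums (bessel'' a x * x)"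
    unfolding bessel''_def by (intro sums_mult2 summable_sums summable_bessel'')
  \<comment> \<open>Multiplication by \<open>x\<close> raises the index by one. The missing term at
    index 0 carries the factor 0, so the series may be reindexed from 0.\<close>
  then have "(\<lambda>n. real (Suc n) * diffs (bessel_coeff a) (Suc n) * x ^ Suc n) sums (bessel'' a x * x)"
    by (simp add: diffs_def mult_ac)
  then have "(\<lambda>n. real n * diffs (bessel_coeff a) n * x ^ n) sums (bessel'' a x * x + 0)"
    by (subst (asm) sums_Suc_iff) simp
  moreover have "(\<lambda>n. diffs (bessel_coeff a) n * x ^ n) sums bessel' a x"
    unfolding bessel'_def by (intro summable_sums summable_bessel')
  ultimately have "(\<lambda>n. real n * diffs (bessel_coeff a) n * x ^ n + diffs (bessel_coeff a) n * x ^ n)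
      sums (bessel'' a x * x + 0 + bessel' a x)"
    by (rule sums_add)
  moreover have "real n * diffs (bessel_coeff a) n * x ^ n + diffs (bessel_coeff a) n * x ^ n =
      a * (bessel_coeff a n * x ^ n)" for n
  proof -
    have "(fact (Suc n) :: real) = (1 + real n) * fact n" by simp
    then have "(1 + real n) * diffs (bessel_coeff a) n = a * bessel_coeff a n"
      by (simp add: diffs_def bessel_coeff_def power2_eq_square divide_simps del: fact_Suc)
    then have "(1 + real n) * diffs (bessel_coeff a) n * x ^ n = a * bessel_coeff a n * x ^ n"
      by simp
    then show ?thesis
      by (simp add: algebra_simps)
  qed
  ultimately have "(\<lambda>n. a * (bessel_coeff a n * x ^ n)) sums (bessel'' a x * x + 0 + bessel' a x)"
    by simp
  moreover have "(\<lambda>n. a * (bessel_coeff a n * x ^ n)) sums (a * bessel a x)"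
    unfolding bessel_def by (intro sums_mult summable_sums summable_bessel)
  ultimately show ?thesis
    using sums_unique2 by (fastforce simp: mult.commute)
qed

lemma bessel_continuous [continuous_intros]:
  "continuous_on A f \<Longrightarrow> continuous_on A (\<lambda>x. bessel a (f x))"
  by (rule continuous_on_compose2[of UNIV "bessel a"])
    (auto intro!: continuous_at_imp_continuous_on DERIV_isCont bessel_deriv)

lemma bessel'_continuous [continuous_intros]:
  "continuous_on A f \<Longrightarrow> continuous_on A (\<lambda>x. bessel' a (f x))"
  by (rule continuous_on_compose2[of UNIV "bessel' a"])
    (auto intro!: continuous_at_imp_continuous_on DERIV_isCont bessel'_deriv)

lemma bessel''_continuous [continuous_intros]:
  assumes "continuous_on A f"
  shows "continuous_on A (\<lambda>x. bessel'' a (f x))"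
proof (rule continuous_on_compose2[of UNIV "bessel'' a"])
  have "((\<lambda>x. bessel'' a x) has_real_derivative (\<Sum>n. diffs (diffs (diffs (bessel_coeff a))) n * x ^ n)) (at x)" for x
    unfolding bessel''_def
    by (rule termdiffs_strong_converges_everywhere[OF summable_bessel''])
  then show "continuous_on UNIV (bessel'' a)"
    by (auto intro!: continuous_at_imp_continuous_on DERIV_isCont)
qed (use assms in auto)

section \<open>Averaging operators\<close>

text \<open>Two translations plus a kernel average over [x - s, x + s], rescaled to [-1, 1]. All
  wave operators below have this shape, so stability of test functions, continuity and L2 bounds are
  proved once. The shift \<open>s\<close> may be negative.\<close>

definition avg :: "real \<Rightarrow> real \<Rightarrow> real \<Rightarrow> (real \<Rightarrow> real) \<Rightarrow> (real \<Rightarrow> real) \<Rightarrow> real \<Rightarrow> real"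
  where "avg s p q \<kappa> \<phi> x = p * \<phi> (x + s) + q * \<phi> (x - s) + integral {-1..1} (\<lambda>r. \<kappa> r * \<phi> (x + s * r))"

lemma avg_integrable:
  fixes \<kappa> \<phi> :: "real \<Rightarrow> real"
  assumes "continuous_on {-1..1} \<kappa>" "continuous_on UNIV \<phi>"
  shows "(\<lambda>r. \<kappa> r * \<phi> (x + s * r)) integrable_on {-1..1}"
  by (intro integrable_continuous_interval continuous_intros assms continuous_on_compose2[OF assms(2)]) auto

lemma avg_add:
  assumes "continuous_on {-1..1} \<kappa>" "continuous_on UNIV \<phi>" "continuous_on UNIV \<psi>"
  shows "avg s p q \<kappa> (\<lambda>x. \<phi> x + \<psi> x) x = avg s p q \<kappa> \<phi> x + avg s p q \<kappa> \<psi> x"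
  unfolding avg_def using assms
  by (simp add: distrib_left Henstock_Kurzweil_Integration.integral_add avg_integrable)

lemma avg_cmult: "avg s p q \<kappa> (\<lambda>x. a * \<phi> x) x = a * avg s p q \<kappa> \<phi> x"
proof -
  have "(\<lambda>r. \<kappa> r * (a * \<phi> (x + s * r))) = (\<lambda>r. a * (\<kappa> r * \<phi> (x + s * r)))"
    by (simp add: mult_ac)
  then show ?thesis
    unfolding avg_def by (simp add: algebra_simps)
qed

lemma avg_bound:
  assumes \<kappa>: "continuous_on {-1..1} \<kappa>" "\<And>r. r \<in> {-1..1} \<Longrightarrow> \<bar>\<kappa> r\<bar> \<le> M"
    and \<phi>: "continuous_on UNIV \<phi>" "\<And>x. \<bar>\<phi> x\<bar> \<le> B"
  shows "\<bar>avg s p q \<kappa> \<phi> x\<bar> \<le> (\<bar>p\<bar> + \<bar>q\<bar> + 2 * M) * B"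
proof -
  have "norm (integral {-1..1} (\<lambda>r. \<kappa> r * \<phi> (x + s * r))) \<le> (M * B) * (1 - (-1))"
  proof (rule integral_bound)
    show "continuous_on {-1..1} (\<lambda>r. \<kappa> r * \<phi> (x + s * r))"
      by (intro continuous_intros \<kappa>(1) continuous_on_compose2[OF \<phi>(1)]) auto
    show "norm (\<kappa> r * \<phi> (x + s * r)) \<le> M * B" if "r \<in> {-1..1}" for r
      using \<kappa>(2)[OF that] \<phi>(2)[of "x + s * r"] by (simp add: abs_mult mult_mono')
  qed simp
  moreover have "\<bar>p * \<phi> (x + s)\<bar> \<le> \<bar>p\<bar> * B" "\<bar>q * \<phi> (x - s)\<bar> \<le> \<bar>q\<bar> * B"
    using \<phi>(2) by (simp_all add: abs_mult mult_left_mono)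
  ultimately show ?thesis
    unfolding avg_def by (simp add: algebra_simps)
qed

lemma avg_support:
  assumes \<phi>: "\<And>x. \<phi> x \<noteq> 0 \<Longrightarrow> x \<in> {-R..R}" and s: "\<bar>s\<bar> \<le> S" and nz: "avg s p q \<kappa> \<phi> x \<noteq> 0"
  shows "x \<in> {-(R + S)..R + S}"
proof (rule ccontr)
  assume x: "x \<notin> {-(R + S)..R + S}"
  have zero: "\<phi> (x + s * r) = 0" if "r \<in> {-1..1}" for r
  proof (rule ccontr)
    assume "\<phi> (x + s * r) \<noteq> 0"
    then have "x + s * r \<in> {-R..R}" by (rule \<phi>)
    moreover have "\<bar>s * r\<bar> \<le> S * 1"
      using s that unfolding abs_mult by (intro mult_mono) auto
    ultimately show False
      using x by auto
  qed
  have "integral {-1..1} (\<lambda>r. \<kappa> r * \<phi> (x + s * r)) = integral {-1..1} (\<lambda>r::real. 0)"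
    by (rule Henstock_Kurzweil_Integration.integral_cong) (simp add: zero)
  then show False
    using nz zero[of 1] zero[of "-1"] by (simp add: avg_def)
qed

lemma avg_has_deriv:
  assumes \<kappa>: "continuous_on {-1..1} \<kappa>" and \<phi>: "smooth \<phi>"
  shows "(avg s p q \<kappa> \<phi> has_real_derivative avg s p q \<kappa> (dx \<phi>) x) (at x)"
proof -
  have d: "((\<lambda>x. \<phi> (x + b)) has_real_derivative dx \<phi> (x + b)) (at x)" for b x
    using smooth_has_deriv_0[OF \<phi>, of "x + b"] by (simp add: DERIV_shift)
  have "((\<lambda>x. integral (cbox (-1) 1) (\<lambda>r. \<kappa> r * \<phi> (x + s * r))) has_real_derivative
      integral (cbox (-1) 1) (\<lambda>r. \<kappa> r * dx \<phi> (x + s * r))) (at x within UNIV)"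
  proof (rule leibniz_rule_field_derivative)
    show "((\<lambda>x. \<kappa> r * \<phi> (x + s * r)) has_real_derivative \<kappa> r * dx \<phi> (x + s * r)) (at x within UNIV)" for x r
      using d by (intro DERIV_cmult)
    show "(\<lambda>r. \<kappa> r * \<phi> (x + s * r)) integrable_on cbox (-1) 1" for x
      using avg_integrable[OF \<kappa> smooth_continuous[OF \<phi>]] by simp
    have "continuous_on (UNIV \<times> {-1..1}) (\<lambda>p. \<kappa> (snd p) * dx \<phi> (fst p + s * snd p))"
      by (intro continuous_intros continuous_on_compose2[OF \<kappa>]
          continuous_on_compose2[OF smooth_continuous[OF smooth_dir_deriv[OF \<phi>], of UNIV]]) auto
    then show "continuous_on (UNIV \<times> cbox (-1) 1) (\<lambda>(x, r). \<kappa> r * dx \<phi> (x + s * r))"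
      by (simp add: split_beta)
  qed auto
  then have "((\<lambda>x. p * \<phi> (x + s) + q * \<phi> (x + (-s)) + integral {-1..1} (\<lambda>r. \<kappa> r * \<phi> (x + s * r))) has_real_derivative
      p * dx \<phi> (x + s) + q * dx \<phi> (x + (-s)) + integral {-1..1} (\<lambda>r. \<kappa> r * dx \<phi> (x + s * r))) (at x)"
    by (intro DERIV_add DERIV_cmult d) simp
  then show ?thesis
    by (simp add: avg_def[abs_def])
qed

lemma
  assumes \<kappa>: "continuous_on {-1..1} \<kappa>" and \<phi>: "smooth \<phi>"
  shows avg_smooth: "smooth (avg s p q \<kappa> \<phi>)"
    and dx_pow_avg: "(dx ^^ n) (avg s p q \<kappa> \<phi>) = avg s p q \<kappa> ((dx ^^ n) \<phi>)"
proof -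
  define g where "g n = avg s p q \<kappa> ((dx ^^ n) \<phi>)" for n
  have g: "(g n has_real_derivative g (Suc n) x) (at x)" for n x
    unfolding g_def using avg_has_deriv[OF \<kappa> smooth_dx_pow[OF \<phi>]] by simp
  show "smooth (avg s p q \<kappa> \<phi>)"
    using smooth_realI[of g, OF g] by (simp add: g_def)
  show "(dx ^^ n) (avg s p q \<kappa> \<phi>) = avg s p q \<kappa> ((dx ^^ n) \<phi>)"
    using dx_pow_eq[of g n, OF g] by (simp add: g_def)
qed

lemma avg_test_funs:
  assumes \<kappa>: "continuous_on {-1..1} \<kappa>" and \<phi>: "\<phi> \<in> test_funs"
  shows "avg s p q \<kappa> \<phi> \<in> test_funs"
proof -
  obtain R where R: "\<And>x. \<phi> x \<noteq> 0 \<Longrightarrow> x \<in> {-R..R}"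
    using test_funs_interval[OF \<phi>] by metis
  show ?thesis
  proof (rule test_funsI[OF avg_smooth[OF \<kappa> test_funs_smooth[OF \<phi>]]])
    show "compact {-(R + \<bar>s\<bar>)..R + \<bar>s\<bar>}" by simp
    show "x \<in> {-(R + \<bar>s\<bar>)..R + \<bar>s\<bar>}" if "avg s p q \<kappa> \<phi> x \<noteq> 0" for x
      using R order_refl that by (rule avg_support)
  qed
qed

section \<open>Continuous operators on test functions and their transposes\<close>

definition test_op :: "((real \<Rightarrow> real) \<Rightarrow> real \<Rightarrow> real) \<Rightarrow> bool"
  where "test_op A \<longleftrightarrow> (\<forall>\<phi>\<in>test_funs. A \<phi> \<in> test_funs) \<and>
    (\<forall>\<phi>\<in>test_funs. \<forall>\<psi>\<in>test_funs. A (\<lambda>x. \<phi> x + \<psi> x) = (\<lambda>x. A \<phi> x + A \<psi> x)) \<and>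
    (\<forall>a. \<forall>\<phi>\<in>test_funs. A (\<lambda>x. a * \<phi> x) = (\<lambda>x. a * A \<phi> x)) \<and>
    (\<forall>\<phi>. test_null_seq \<phi> \<longrightarrow> test_null_seq (\<lambda>n. A (\<phi> n)))"

text \<open>Composition with \<open>A\<close>, set to 0 outside the test functions as
  \<open>is_distribution\<close> demands. For \<open>test_op A\<close> this is a distribution, which
  gives \<open>Abs_distribution\<close> its meaning here.\<close>

definition transpose_op :: "((real \<Rightarrow> real) \<Rightarrow> real \<Rightarrow> real) \<Rightarrow> real distribution \<Rightarrow> real distribution"
  where "transpose_op A T = Abs_distribution (\<lambda>\<phi>. if \<phi> \<in> test_funs then pairing T (A \<phi>) else 0)"

lemma pairing_transpose_op:
  assumes "test_op A" "\<phi> \<in> test_funs"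
  shows "pairing (transpose_op A T) \<phi> = pairing T (A \<phi>)"
proof -
  have "is_distribution (\<lambda>\<phi>. if \<phi> \<in> test_funs then pairing T (A \<phi>) else 0)"
    unfolding is_distribution_def
  proof (intro conjI ballI allI impI)
    fix \<phi> :: "nat \<Rightarrow> real \<Rightarrow> real" assume \<phi>: "test_null_seq \<phi>"
    then have "(\<lambda>n. pairing T (A (\<phi> n))) \<longlonglongrightarrow> 0"
      using assms(1) by (intro pairing_null_seq) (auto simp: test_op_def)
    moreover have "\<phi> n \<in> test_funs" for n
      using \<phi> by (simp add: test_null_seq_def)
    ultimately show "(\<lambda>n. if \<phi> n \<in> test_funs then pairing T (A (\<phi> n)) else 0) \<longlonglongrightarrow> 0"
      by simp
  qed (use assms(1) in \<open>simp_all add: test_op_def pairing_add pairing_cmult test_funs_add test_funs_cmult\<close>)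
  then show ?thesis
    using assms(2) by (simp add: transpose_op_def Abs_distribution_inverse)
qed

lemma test_op_avg:
  assumes \<kappa>: "continuous_on {-1..1} \<kappa>"
  shows "test_op (avg s p q \<kappa>)"
  unfolding test_op_def
proof (intro conjI ballI allI impI)
  fix \<phi> :: "nat \<Rightarrow> real \<Rightarrow> real" assume null: "test_null_seq \<phi>"
  then have \<phi>: "\<phi> n \<in> test_funs" for n
    by (simp add: test_null_seq_def)
  note s\<phi> = test_funs_smooth[OF \<phi>]
  obtain K where K: "compact K" "\<And>n. {x. \<phi> n x \<noteq> 0} \<subseteq> K"
    using null unfolding test_null_seq_def by blast
  obtain R where R: "K \<subseteq> {-R..R}"
    using compact_real_interval[OF K(1)] by blast
  obtain M where M: "\<And>r. r \<in> {-1..1} \<Longrightarrow> \<bar>\<kappa> r\<bar> \<le> M"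
    using compact_imp_bounded[OF compact_continuous_image[OF \<kappa> compact_Icc]]
    unfolding bounded_iff real_norm_def by blast
  have M0: "0 \<le> M" using M[of 0] by simp
  show "test_null_seq (\<lambda>n. avg s p q \<kappa> (\<phi> n))"
  proof (rule test_null_seq_realI)
    show "avg s p q \<kappa> (\<phi> n) \<in> test_funs" for n
      using \<kappa> \<phi> by (rule avg_test_funs)
    show "x \<in> {-(R + \<bar>s\<bar>)..R + \<bar>s\<bar>}" if "avg s p q \<kappa> (\<phi> n) x \<noteq> 0" for n x
      by (rule avg_support[OF _ order_refl that]) (use K(2)[of n] R in blast)
    fix m
    show "uniform_limit UNIV (\<lambda>n. (dx ^^ m) (avg s p q \<kappa> (\<phi> n))) (\<lambda>_. 0) sequentially"
    proof (rule uniform_limitI)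
      fix e :: real assume e: "e > 0"
      \<comment> \<open>The summand 1 keeps \<open>N\<close> positive and makes the final bound (N -
        1) e / N strictly smaller than e.\<close>
      define N where "N = \<bar>p\<bar> + \<bar>q\<bar> + 2 * M + 1"
      have N: "N > 0" using M0 by (simp add: N_def)
      have "\<forall>\<^sub>F n in sequentially. \<forall>x\<in>UNIV. dist ((dx ^^ m) (\<phi> n) x) 0 < e / N"
        using uniform_limitD[OF test_null_seq_dx_pow[OF null]] e N by simp
      then show "\<forall>\<^sub>F n in sequentially. \<forall>x\<in>UNIV. dist ((dx ^^ m) (avg s p q \<kappa> (\<phi> n)) x) 0 < e"
      proof (rule eventually_mono)
        fix n assume *: "\<forall>x\<in>UNIV. dist ((dx ^^ m) (\<phi> n) x) 0 < e / N"
        have b: "\<bar>(dx ^^ m) (\<phi> n) x\<bar> \<le> e / N" for x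
          using * by (simp add: dist_real_def less_imp_le)
        have "\<bar>avg s p q \<kappa> ((dx ^^ m) (\<phi> n)) x\<bar> \<le> (N - 1) * (e / N)" for x
          unfolding N_def add_diff_cancel_right'
          by (rule avg_bound[OF \<kappa> M smooth_continuous[OF smooth_dx_pow[OF s\<phi>]] b[unfolded N_def]])
        also have "(N - 1) * (e / N) < e"
          using N e by (simp add: field_simps)
        finally show "\<forall>x\<in>UNIV. dist ((dx ^^ m) (avg s p q \<kappa> (\<phi> n)) x) 0 < e"
          by (simp add: dx_pow_avg[OF \<kappa> s\<phi>] dist_real_def)
      qed
    qed
  qed simp
next
  fix \<phi> \<psi> :: "real \<Rightarrow> real" assume "\<phi> \<in> test_funs" "\<psi> \<in> test_funs"
  then show "avg s p q \<kappa> (\<lambda>x. \<phi> x + \<psi> x) = (\<lambda>x. avg s p q \<kappa> \<phi> x + avg s p q \<kappa> \<psi> x)"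
    using avg_add[OF \<kappa>] by (intro ext) (simp add: smooth_continuous test_funs_smooth)
qed (simp_all add: avg_test_funs[OF \<kappa>] avg_cmult fun_eq_iff)

section \<open>The fundamental solution acting on test functions\<close>

text \<open>\<open>wave_sin k c t \<phi>\<close> and \<open>wave_cos k c t \<phi>\<close> solve \<open>w\<^sub>t\<^sub>t = c\<^sup>2 w\<^sub>x\<^sub>x + (k/2)\<^sup>2 w\<close> with initial data
  \<open>(0, \<phi>)\<close> and \<open>(\<phi>, 0)\<close>; they come from the formula for \<open>u\<close> by substituting \<open>y = x + ctr\<close>.\<close>

definition bessel_arg :: "real \<Rightarrow> real \<Rightarrow> real \<Rightarrow> real"
  where "bessel_arg c t r = (c * t)\<^sup>2 * (1 - r\<^sup>2)"

text \<open>This is \<alpha>^2 with \<alpha> = k / (4 c), and \<open>bessel_arg\<close> is \<lambda>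
  at y = x + c t r.\<close>

definition wave_const :: "real \<Rightarrow> real \<Rightarrow> real"
  where "wave_const k c = (k / (4 * c))\<^sup>2"

definition wave_sin :: "real \<Rightarrow> real \<Rightarrow> real \<Rightarrow> (real \<Rightarrow> real) \<Rightarrow> real \<Rightarrow> real"
  where "wave_sin k c t = avg (c * t) 0 0 (\<lambda>r. t / 2 * bessel (wave_const k c) (bessel_arg c t r))"

definition wave_cos :: "real \<Rightarrow> real \<Rightarrow> real \<Rightarrow> (real \<Rightarrow> real) \<Rightarrow> real \<Rightarrow> real"
  where "wave_cos k c t = avg (c * t) (1/2) (1/2) (\<lambda>r. (c * t)\<^sup>2 * bessel' (wave_const k c) (bessel_arg c t r))"

text \<open>This is \<open>wave_sin\<close> after \<open>dx\<close> with the derivative moved from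
  the function to the kernel, see \<open>dx_wave_sin\<close>. No derivative of the argument is left,
  so its transpose is bounded on L2.\<close>

definition wave_sin_dx :: "real \<Rightarrow> real \<Rightarrow> real \<Rightarrow> (real \<Rightarrow> real) \<Rightarrow> real \<Rightarrow> real"
  where "wave_sin_dx k c t = avg (c * t) (1 / (2 * c)) (- 1 / (2 * c))
    (\<lambda>r. c * t\<^sup>2 * r * bessel' (wave_const k c) (bessel_arg c t r))"

text \<open>The spatial operator in the equation for exp(k t / 2) u; the exponential trades the
  damping for the term with (k / 2)^2.\<close>

definition wave_gen :: "real \<Rightarrow> real \<Rightarrow> (real \<Rightarrow> real) \<Rightarrow> real \<Rightarrow> real"
  where "wave_gen k c \<phi> x = c\<^sup>2 * dx (dx \<phi>) x + (k / 2)\<^sup>2 * \<phi> x"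

lemma bessel_arg_continuous [continuous_intros]:
  assumes "continuous_on A f" "continuous_on A g"
  shows "continuous_on A (\<lambda>x. bessel_arg c (f x) (g x))"
  unfolding bessel_arg_def by (intro continuous_intros assms)

lemma
  shows wave_sin_kernel: "continuous_on A (\<lambda>r. t / 2 * bessel (wave_const k c) (bessel_arg c t r))"
    and wave_cos_kernel: "continuous_on A (\<lambda>r. (c * t)\<^sup>2 * bessel' (wave_const k c) (bessel_arg c t r))"
    and wave_sin_dx_kernel: "continuous_on A (\<lambda>r. c * t\<^sup>2 * r * bessel' (wave_const k c) (bessel_arg c t r))"
  by (intro continuous_intros)+

lemma shifted_deriv:
  assumes "smooth \<phi>" "(f has_real_derivative f') (at r)"
  shows "((\<lambda>r. \<phi> (f r)) has_real_derivative dx \<phi> (f r) * f') (at r)"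
  using smooth_has_deriv_0[OF assms(1)] assms(2) by (rule DERIV_chain2)

lemma bessel_arg_deriv_r: "(bessel_arg c t has_real_derivative (c * t)\<^sup>2 * (- 2 * r)) (at r)"
  unfolding bessel_arg_def[abs_def] by (auto intro!: derivative_eq_intros)

lemma bessel_arg_deriv_t: "((\<lambda>t. bessel_arg c t r) has_real_derivative 2 * c\<^sup>2 * t * (1 - r\<^sup>2)) (at t)"
  unfolding bessel_arg_def by (auto intro!: derivative_eq_intros simp: power2_eq_square)

lemma smooth_shift_continuous:
  assumes "smooth \<phi>" "continuous_on A f"
  shows "continuous_on A (\<lambda>x. \<phi> (f x))"
  by (rule continuous_on_compose2[OF smooth_continuous[OF assms(1), of UNIV] assms(2)]) simp

lemma bessel_arg_1: "bessel_arg c t 1 = 0" "bessel_arg c t (-1) = 0"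
  by (simp_all add: bessel_arg_def)

lemma bessel_wave_deriv_r:
  assumes "smooth \<phi>"
  shows "((\<lambda>r. bessel a (bessel_arg c t r) * \<phi> (x + c * t * r)) has_real_derivative
    bessel' a (bessel_arg c t r) * ((c * t)\<^sup>2 * (- 2 * r)) * \<phi> (x + c * t * r)
      + bessel a (bessel_arg c t r) * (dx \<phi> (x + c * t * r) * (c * t))) (at r)"
proof -
  have "((\<lambda>r. \<phi> (x + c * t * r)) has_real_derivative dx \<phi> (x + c * t * r) * (c * t)) (at r)"
    by (rule shifted_deriv[OF assms]) (auto intro!: derivative_eq_intros)
  from DERIV_mult[OF DERIV_chain2[OF bessel_deriv bessel_arg_deriv_r] this]
  show ?thesis
    by (rule DERIV_cong) (simp add: mult_ac)
qed

lemma wave_deriv_t: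
  assumes \<phi>: "smooth \<phi>" and b: "\<And>z. (b has_real_derivative b' z) (at z)"
    and g: "(g has_real_derivative g') (at t)"
  shows "((\<lambda>t. g t * b (bessel_arg c t r) * \<phi> (x + c * t * r)) has_real_derivative
    g' * b (bessel_arg c t r) * \<phi> (x + c * t * r)
      + g t * (b' (bessel_arg c t r) * (2 * c\<^sup>2 * t * (1 - r\<^sup>2)) * \<phi> (x + c * t * r)
        + b (bessel_arg c t r) * (dx \<phi> (x + c * t * r) * (c * r)))) (at t)"
proof -
  have "((\<lambda>t. \<phi> (x + c * t * r)) has_real_derivative dx \<phi> (x + c * t * r) * (c * r)) (at t)"
    by (rule shifted_deriv[OF \<phi>]) (auto intro!: derivative_eq_intros)
  from DERIV_mult[OF DERIV_mult[OF g DERIV_chain2[OF b bessel_arg_deriv_t]] this]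
  show ?thesis
    by (rule DERIV_cong) (simp add: distrib_left distrib_right mult_ac)
qed

text \<open>Both integrations by parts move the \<open>x\<close>-derivative from \<open>\<phi>\<close> onto the kernel; the
  boundary terms are the travelling waves.\<close>

lemma integral_by_parts_even:
  assumes "smooth \<phi>"
  shows "integral {-1..1} (\<lambda>r. 1/2 * bessel a (bessel_arg c t r) * \<phi> (x + c * t * r)
      + r / 2 * (bessel' a (bessel_arg c t r) * ((c * t)\<^sup>2 * (- 2 * r)) * \<phi> (x + c * t * r)
        + bessel a (bessel_arg c t r) * (dx \<phi> (x + c * t * r) * (c * t)))) =
    1/2 * \<phi> (x + c * t) + 1/2 * \<phi> (x - c * t)"
proof -
  \<comment> \<open>The weight r/2 equals 1/2 and -1/2 at the endpoints, so the boundary terms add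
    up to the mean of the two waves instead of their difference.\<close>
  have "((\<lambda>r. r / 2 * (bessel a (bessel_arg c t r) * \<phi> (x + c * t * r))) has_real_derivative
      1/2 * bessel a (bessel_arg c t r) * \<phi> (x + c * t * r)
      + r / 2 * (bessel' a (bessel_arg c t r) * ((c * t)\<^sup>2 * (- 2 * r)) * \<phi> (x + c * t * r)
        + bessel a (bessel_arg c t r) * (dx \<phi> (x + c * t * r) * (c * t)))) (at r)" for r
    by (rule DERIV_cong[OF DERIV_mult[OF _ bessel_wave_deriv_r[OF assms]]], rule DERIV_cdivide, rule DERIV_ident)
      (simp add: mult_ac add_ac)
  then have "integral {-1..1} (\<lambda>r. 1/2 * bessel a (bessel_arg c t r) * \<phi> (x + c * t * r)
      + r / 2 * (bessel' a (bessel_arg c t r) * ((c * t)\<^sup>2 * (- 2 * r)) * \<phi> (x + c * t * r)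
        + bessel a (bessel_arg c t r) * (dx \<phi> (x + c * t * r) * (c * t)))) =
      1 / 2 * (bessel a (bessel_arg c t 1) * \<phi> (x + c * t * 1)) - (-1) / 2 * (bessel a (bessel_arg c t (-1)) * \<phi> (x + c * t * (-1)))"
    by (intro integral_unique fundamental_theorem_of_calculus)
      (auto simp: has_real_derivative_iff_has_vector_derivative[symmetric] intro: has_field_derivative_at_within)
  then show ?thesis
    by (simp add: bessel_arg_1 bessel_0)
qed

lemma integral_by_parts_odd:
  assumes "smooth \<phi>"
  shows "integral {-1..1} (\<lambda>r. bessel' a (bessel_arg c t r) * ((c * t)\<^sup>2 * (- 2 * r)) * \<phi> (x + c * t * r)
        + bessel a (bessel_arg c t r) * (dx \<phi> (x + c * t * r) * (c * t))) =
    \<phi> (x + c * t) - \<phi> (x - c * t)"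
proof -
  have "((\<lambda>r. bessel a (bessel_arg c t r) * \<phi> (x + c * t * r)) has_real_derivative
      bessel' a (bessel_arg c t r) * ((c * t)\<^sup>2 * (- 2 * r)) * \<phi> (x + c * t * r)
        + bessel a (bessel_arg c t r) * (dx \<phi> (x + c * t * r) * (c * t))) (at r)" for r
    by (rule bessel_wave_deriv_r[OF assms])
  then have "integral {-1..1} (\<lambda>r. bessel' a (bessel_arg c t r) * ((c * t)\<^sup>2 * (- 2 * r)) * \<phi> (x + c * t * r)
        + bessel a (bessel_arg c t r) * (dx \<phi> (x + c * t * r) * (c * t))) =
      bessel a (bessel_arg c t 1) * \<phi> (x + c * t * 1) - bessel a (bessel_arg c t (-1)) * \<phi> (x + c * t * (-1))"
    by (intro integral_unique fundamental_theorem_of_calculus)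
      (auto simp: has_real_derivative_iff_has_vector_derivative[symmetric] intro: has_field_derivative_at_within)
  then show ?thesis
    by (simp add: bessel_arg_1 bessel_0)
qed

context
  fixes k c :: real
  assumes c: "c > 0"
begin

lemma wave_sin_has_dt:
  assumes \<phi>: "smooth \<phi>"
  shows "((\<lambda>t. wave_sin k c t \<phi> x) has_real_derivative wave_cos k c t \<phi> x) (at t)"
proof -
  define a where "a = wave_const k c"
  define f where "f t r = t / 2 * bessel a (bessel_arg c t r) * \<phi> (x + c * t * r)" for t r
  define ft where "ft t r = 1/2 * bessel a (bessel_arg c t r) * \<phi> (x + c * t * r)
    + t / 2 * (bessel' a (bessel_arg c t r) * (2 * c\<^sup>2 * t * (1 - r\<^sup>2)) * \<phi> (x + c * t * r)
      + bessel a (bessel_arg c t r) * (dx \<phi> (x + c * t * r) * (c * r)))" for t r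
  have d: "((\<lambda>t. f t r) has_real_derivative ft t r) (at t)" for t r
    unfolding f_def ft_def
    by (rule wave_deriv_t[OF \<phi> bessel_deriv]) (rule DERIV_cdivide, rule DERIV_ident)
  have "((\<lambda>t. integral (cbox (-1) 1) (f t)) has_real_derivative integral (cbox (-1) 1) (ft t)) (at t within UNIV)"
  proof (rule leibniz_rule_field_derivative)
    show "((\<lambda>t. f t r) has_real_derivative ft t r) (at t within UNIV)" for t r
      using d by simp
    show "f t integrable_on cbox (-1) 1" for t
      unfolding f_def by (intro integrable_continuous continuous_intros smooth_shift_continuous[OF \<phi>])
    have "continuous_on (UNIV \<times> cbox (-1) 1) (\<lambda>p. ft (fst p) (snd p))"
      unfolding ft_def by (intro continuous_intros smooth_shift_continuous[OF \<phi>] smooth_shift_continuous[OF smooth_dir_deriv[OF \<phi>]]) auto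
    then show "continuous_on (UNIV \<times> cbox (-1) 1) (\<lambda>(t, r). ft t r)"
      by (simp add: split_beta)
  qed auto
  moreover have "integral (cbox (-1) 1) (f s) = wave_sin k c s \<phi> x" for s
    unfolding wave_sin_def avg_def f_def a_def by simp
  moreover have "integral (cbox (-1) 1) (ft t) = wave_cos k c t \<phi> x"
  proof -
    \<comment> \<open>The factor 1 - r^2 from differentiating \<open>bessel_arg\<close> in t is
      split. Its r^2 part completes \<open>P\<close> to an exact r-derivative, whose integral is the
      travelling waves; the remaining 1 gives the kernel \<open>Q\<close> of
      \<open>wave_cos\<close>.\<close>
    define P where "P r = 1/2 * bessel a (bessel_arg c t r) * \<phi> (x + c * t * r)
      + r / 2 * (bessel' a (bessel_arg c t r) * ((c * t)\<^sup>2 * (- 2 * r)) * \<phi> (x + c * t * r)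
        + bessel a (bessel_arg c t r) * (dx \<phi> (x + c * t * r) * (c * t)))" for r
    define Q where "Q r = (c * t)\<^sup>2 * bessel' a (bessel_arg c t r) * \<phi> (x + c * t * r)" for r
    have "ft t = (\<lambda>r. P r + Q r)"
      unfolding ft_def P_def Q_def by (rule ext) (simp add: algebra_simps power2_eq_square)
    moreover have "P integrable_on {-1..1}"
      unfolding P_def
      by (intro integrable_continuous_interval continuous_intros smooth_shift_continuous[OF \<phi>] smooth_shift_continuous[OF smooth_dir_deriv[OF \<phi>]]) auto
    moreover have "Q integrable_on {-1..1}"
      unfolding Q_def
      by (intro integrable_continuous_interval continuous_intros smooth_shift_continuous[OF \<phi>])
    ultimately have "integral {-1..1} (ft t) = integral {-1..1} P + integral {-1..1} Q"
      by (simp add: Henstock_Kurzweil_Integration.integral_add)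
    also have "integral {-1..1} P = 1/2 * \<phi> (x + c * t) + 1/2 * \<phi> (x - c * t)"
      unfolding P_def by (rule integral_by_parts_even[OF \<phi>])
    finally show ?thesis
      unfolding wave_cos_def avg_def Q_def a_def by simp
  qed
  ultimately show ?thesis by simp
qed

text \<open>Up to the factor c t, the x-derivative of \<phi> (x + c t r) is an r-derivative, so
  integration by parts in r trades it for a derivative of the Bessel kernel. The factor
  \<open>t / 2\<close> of the kernel cancels t, so t = 0 is included. This gain of one derivative
  underlies the L2 bounds for u_t and u_x.\<close>

lemma dx_wave_sin:
  assumes \<phi>: "smooth \<phi>"
  shows "wave_sin k c t (dx \<phi>) = wave_sin_dx k c t \<phi>"
proof
  fix x
  define a where "a = wave_const k c"
  define P where "P r = bessel' a (bessel_arg c t r) * ((c * t)\<^sup>2 * (- 2 * r)) * \<phi> (x + c * t * r)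
    + bessel a (bessel_arg c t r) * (dx \<phi> (x + c * t * r) * (c * t))" for r
  define Q where "Q r = c * t\<^sup>2 * r * bessel' a (bessel_arg c t r) * \<phi> (x + c * t * r)" for r
  have eq: "(\<lambda>r. t / 2 * bessel a (bessel_arg c t r) * dx \<phi> (x + c * t * r)) = (\<lambda>r. 1 / (2 * c) * P r + Q r)"
    unfolding P_def Q_def using c by (intro ext) (simp add: field_simps power2_eq_square)
  have P: "(\<lambda>r. 1 / (2 * c) * P r) integrable_on {-1..1}"
    unfolding P_def
    by (intro integrable_continuous_interval continuous_intros smooth_shift_continuous[OF \<phi>] smooth_shift_continuous[OF smooth_dir_deriv[OF \<phi>]])
  have Q: "Q integrable_on {-1..1}"
    unfolding Q_def
    by (intro integrable_continuous_interval continuous_intros smooth_shift_continuous[OF \<phi>])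
  have "integral {-1..1} (\<lambda>r. t / 2 * bessel a (bessel_arg c t r) * dx \<phi> (x + c * t * r)) =
      integral {-1..1} (\<lambda>r. 1 / (2 * c) * P r) + integral {-1..1} Q"
    unfolding eq by (rule Henstock_Kurzweil_Integration.integral_add[OF P Q])
  also have "integral {-1..1} (\<lambda>r. 1 / (2 * c) * P r) = 1 / (2 * c) * integral {-1..1} P"
    by (rule Henstock_Kurzweil_Integration.integral_mult_right)
  also have "integral {-1..1} P = \<phi> (x + c * t) - \<phi> (x - c * t)"
    unfolding P_def by (rule integral_by_parts_odd[OF \<phi>])
  finally show "wave_sin k c t (dx \<phi>) x = wave_sin_dx k c t \<phi> x"
    unfolding wave_sin_def wave_sin_dx_def avg_def Q_def a_def by (simp add: right_diff_distrib)
qed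

lemma wave_gen_smooth: "smooth \<phi> \<Longrightarrow> smooth (wave_gen k c \<phi>)"
  unfolding wave_gen_def[abs_def] by (intro smooth_add smooth_cmult smooth_dir_deriv)

lemma wave_gen_test_funs: "\<phi> \<in> test_funs \<Longrightarrow> wave_gen k c \<phi> \<in> test_funs"
  unfolding wave_gen_def[abs_def] by (intro test_funs_add test_funs_cmult test_funs_dir_deriv)

lemma wave_sin_gen:
  assumes \<phi>: "smooth \<phi>"
  shows "wave_sin k c t (wave_gen k c \<phi>) x = c\<^sup>2 * wave_sin_dx k c t (dx \<phi>) x + (k / 2)\<^sup>2 * wave_sin k c t \<phi> x"
proof -
  have "wave_sin k c t (wave_gen k c \<phi>) x =
      c\<^sup>2 * wave_sin k c t (dx (dx \<phi>)) x + (k / 2)\<^sup>2 * wave_sin k c t \<phi> x"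
    unfolding wave_gen_def[abs_def] wave_sin_def
    by (subst avg_add[OF wave_sin_kernel])
      (auto simp: avg_cmult intro!: smooth_continuous smooth_cmult smooth_dir_deriv \<phi>)
  then show ?thesis
    by (simp add: dx_wave_sin smooth_dir_deriv \<phi>)
qed

text \<open>Differentiating the kernel brings in \<open>bessel''\<close>; the Bessel equation
  combines it with \<open>bessel'\<close> into a multiple of \<open>bessel\<close>, which is the
  zero-order term. The terms with \<open>dx \<phi>\<close>, together with the differentiated
  travelling waves, form c^2 \<open>wave_sin_dx\<close> of \<open>dx \<phi>\<close>, the
  second-order part according to \<open>wave_sin_gen\<close>.\<close>

lemma wave_cos_has_dt:
  assumes \<phi>: "smooth \<phi>"
  shows "((\<lambda>t. wave_cos k c t \<phi> x) has_real_derivative wave_sin k c t (wave_gen k c \<phi>) x) (at t)"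
proof -
  define a where "a = wave_const k c"
  define f where "f t r = (c * t)\<^sup>2 * bessel' a (bessel_arg c t r) * \<phi> (x + c * t * r)" for t r
  define ft where "ft t r = 2 * c\<^sup>2 * t * bessel' a (bessel_arg c t r) * \<phi> (x + c * t * r)
    + (c * t)\<^sup>2 * (bessel'' a (bessel_arg c t r) * (2 * c\<^sup>2 * t * (1 - r\<^sup>2)) * \<phi> (x + c * t * r)
      + bessel' a (bessel_arg c t r) * (dx \<phi> (x + c * t * r) * (c * r)))" for t r
  have d: "((\<lambda>t. f t r) has_real_derivative ft t r) (at t)" for t r
    unfolding f_def ft_def
    by (rule wave_deriv_t[OF \<phi> bessel'_deriv]) (auto intro!: derivative_eq_intros simp: power2_eq_square)
  have "((\<lambda>t. integral (cbox (-1) 1) (f t)) has_real_derivative integral (cbox (-1) 1) (ft t)) (at t within UNIV)"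
  proof (rule leibniz_rule_field_derivative)
    show "((\<lambda>t. f t r) has_real_derivative ft t r) (at t within UNIV)" for t r
      using d by simp
    show "f t integrable_on cbox (-1) 1" for t
      unfolding f_def by (intro integrable_continuous continuous_intros smooth_shift_continuous[OF \<phi>])
    have "continuous_on (UNIV \<times> cbox (-1) 1) (\<lambda>p. ft (fst p) (snd p))"
      unfolding ft_def
      by (intro continuous_on_add continuous_on_mult continuous_on_diff continuous_on_power continuous_on_const
          bessel'_continuous bessel''_continuous bessel_arg_continuous continuous_on_fst continuous_on_snd continuous_on_id
          smooth_shift_continuous[OF \<phi>] smooth_shift_continuous[OF smooth_dir_deriv[OF \<phi>]])
    then show "continuous_on (UNIV \<times> cbox (-1) 1) (\<lambda>(t, r). ft t r)"
      by (simp add: split_beta)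
  qed auto
  then have i: "((\<lambda>t. integral {-1..1} (f t)) has_real_derivative integral {-1..1} (ft t)) (at t)"
    by simp
  have p1: "((\<lambda>t. \<phi> (x + c * t)) has_real_derivative dx \<phi> (x + c * t) * c) (at t)"
    by (rule shifted_deriv[OF \<phi>]) (auto intro!: derivative_eq_intros)
  have p2: "((\<lambda>t. \<phi> (x - c * t)) has_real_derivative dx \<phi> (x - c * t) * (- c)) (at t)"
    by (rule shifted_deriv[OF \<phi>]) (auto intro!: derivative_eq_intros)
  have "((\<lambda>t. 1/2 * \<phi> (x + c * t) + 1/2 * \<phi> (x - c * t) + integral {-1..1} (f t)) has_real_derivative
      1/2 * (dx \<phi> (x + c * t) * c) + 1/2 * (dx \<phi> (x - c * t) * (- c)) + integral {-1..1} (ft t)) (at t)"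
    by (intro DERIV_add DERIV_cmult p1 p2 i)
  moreover have "integral {-1..1} (ft t) =
      c\<^sup>2 * integral {-1..1} (\<lambda>r. c * t\<^sup>2 * r * bessel' a (bessel_arg c t r) * dx \<phi> (x + c * t * r))
      + (k / 2)\<^sup>2 * integral {-1..1} (\<lambda>r. t / 2 * bessel a (bessel_arg c t r) * \<phi> (x + c * t * r))"
  proof -
    have "ft t r = c\<^sup>2 * (c * t\<^sup>2 * r * bessel' a (bessel_arg c t r) * dx \<phi> (x + c * t * r))
        + (k / 2)\<^sup>2 * (t / 2 * bessel a (bessel_arg c t r) * \<phi> (x + c * t * r))" for r
    proof -
      define z where "z = bessel_arg c t r"
      have "ft t r = c\<^sup>2 * (c * t\<^sup>2 * r * bessel' a z * dx \<phi> (x + c * t * r))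
          + 2 * c\<^sup>2 * t * (z * bessel'' a z + bessel' a z) * \<phi> (x + c * t * r)"
        unfolding ft_def z_def[symmetric] unfolding z_def bessel_arg_def
        by (simp add: algebra_simps power2_eq_square)
      also have "z * bessel'' a z + bessel' a z = a * bessel a z"
        by (rule bessel_equation)
      also have "2 * c\<^sup>2 * t * (a * bessel a z) * \<phi> (x + c * t * r) = (k / 2)\<^sup>2 * (t / 2 * bessel a z * \<phi> (x + c * t * r))"
      proof -
        \<comment> \<open>Here the choice \<alpha> = k / (4 c) enters.\<close>
        have "2 * c\<^sup>2 * a = (k / 2)\<^sup>2 / 2"
          using c by (simp add: a_def wave_const_def power2_eq_square field_simps)
        then have "(2 * c\<^sup>2 * a) * (t * bessel a z * \<phi> (x + c * t * r)) = (k / 2)\<^sup>2 / 2 * (t * bessel a z * \<phi> (x + c * t * r))"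
          by simp
        then show ?thesis
          by (simp add: algebra_simps)
      qed
      finally show ?thesis
        by (simp add: z_def)
    qed
    then have eq: "ft t = (\<lambda>r. c\<^sup>2 * (c * t\<^sup>2 * r * bessel' a (bessel_arg c t r) * dx \<phi> (x + c * t * r))
        + (k / 2)\<^sup>2 * (t / 2 * bessel a (bessel_arg c t r) * \<phi> (x + c * t * r)))"
      by blast
    have "(\<lambda>r. c * t\<^sup>2 * r * bessel' a (bessel_arg c t r) * dx \<phi> (x + c * t * r)) integrable_on {-1..1}"
      by (intro integrable_continuous_interval continuous_intros smooth_shift_continuous[OF \<phi>] smooth_shift_continuous[OF smooth_dir_deriv[OF \<phi>]])
    moreover have "(\<lambda>r. t / 2 * bessel a (bessel_arg c t r) * \<phi> (x + c * t * r)) integrable_on {-1..1}"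
      by (intro integrable_continuous_interval continuous_intros smooth_shift_continuous[OF \<phi>])
    ultimately show ?thesis
      unfolding eq
      by (subst Henstock_Kurzweil_Integration.integral_add)
        (auto intro: integrable_on_mult_right simp del: times_divide_eq_left)
  qed
  moreover have "wave_cos k c s \<phi> x = 1/2 * \<phi> (x + c * s) + 1/2 * \<phi> (x - c * s) + integral {-1..1} (f s)" for s
    unfolding wave_cos_def avg_def f_def a_def by simp
  ultimately show ?thesis
    using c unfolding wave_sin_gen[OF \<phi>] unfolding wave_sin_def wave_sin_dx_def avg_def a_def
    by (simp add: algebra_simps power2_eq_square)
qed

end

section \<open>Existence and uniqueness of the solution\<close>

lemma pairing_zero: "pairing T (\<lambda>x. 0) = 0"
  using pairing_cmult[OF test_funs_zero, of T 0] by simp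

lemma test_op_wave:
  shows test_op_wave_sin: "test_op (wave_sin k c t)"
    and test_op_wave_cos: "test_op (wave_cos k c t)"
    and test_op_wave_sin_dx: "test_op (wave_sin_dx k c t)"
  unfolding wave_sin_def wave_cos_def wave_sin_dx_def
  by (intro test_op_avg wave_sin_kernel wave_cos_kernel wave_sin_dx_kernel)+

lemma test_op_test_funs: "test_op A \<Longrightarrow> \<phi> \<in> test_funs \<Longrightarrow> A \<phi> \<in> test_funs"
  by (simp add: test_op_def)

lemmas wave_test_funs = test_op_wave[THEN test_op_test_funs]

lemma wave_sin_0: "wave_sin k c 0 \<phi> = (\<lambda>x. 0)" and wave_cos_0: "wave_cos k c 0 \<phi> = \<phi>"
  by (simp_all add: wave_sin_def wave_cos_def avg_def fun_eq_iff)

lemma avg_reflect: "avg (- s) p q \<kappa> \<phi> x = avg s q p (\<lambda>r. \<kappa> (- r)) \<phi> x"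
  using Henstock_Kurzweil_Integration.integral_reflect_real[of 1 "-1" "\<lambda>r. \<kappa> (- r) * \<phi> (x + s * r)"]
  by (simp add: avg_def)

lemma bessel_arg_minus: "bessel_arg c (- t) r = bessel_arg c t r" "bessel_arg c t (- r) = bessel_arg c t r"
  by (simp_all add: bessel_arg_def)

text \<open>Reversing time reflects r, and the Bessel factor is even in t and in r; only the
  prefactor t changes sign. Parity serves to read the adjoint evolution at time -T.\<close>

lemma wave_sin_minus: "wave_sin k c (- t) \<phi> x = - wave_sin k c t \<phi> x"
  unfolding wave_sin_def by (simp add: avg_reflect bessel_arg_minus) (simp add: avg_def)

lemma wave_cos_minus: "wave_cos k c (- t) \<phi> x = wave_cos k c t \<phi> x"
  unfolding wave_cos_def by (simp add: avg_reflect bessel_arg_minus)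

lemma dx_pow_wave:
  assumes "smooth \<phi>"
  shows dx_pow_wave_sin: "(dx ^^ q) (wave_sin k c t \<phi>) = wave_sin k c t ((dx ^^ q) \<phi>)"
    and dx_pow_wave_cos: "(dx ^^ q) (wave_cos k c t \<phi>) = wave_cos k c t ((dx ^^ q) \<phi>)"
  unfolding wave_sin_def wave_cos_def
  by (intro dx_pow_avg assms wave_sin_kernel wave_cos_kernel)+

lemma dx_pow_wave_gen:
  assumes "smooth \<phi>"
  shows "(dx ^^ q) (wave_gen k c \<phi>) = wave_gen k c ((dx ^^ q) \<phi>)"
proof -
  have s: "smooth (dx (dx \<phi>))"
    by (intro smooth_dir_deriv assms)
  have "(dx ^^ q) (wave_gen k c \<phi>) = (\<lambda>x. c\<^sup>2 * (dx ^^ q) (dx (dx \<phi>)) x + (k / 2)\<^sup>2 * (dx ^^ q) \<phi> x)"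
    unfolding wave_gen_def[abs_def]
    by (simp add: dx_pow_add[OF smooth_cmult[OF s] smooth_cmult[OF assms]] dx_pow_cmult[OF s] dx_pow_cmult[OF assms])
  then show ?thesis
    by (simp add: wave_gen_def[abs_def] funpow_swap1)
qed

lemma test_op_gen:
  assumes A: "test_op A" and \<phi>: "\<phi> \<in> test_funs"
    and comm: "dx (dx (A \<phi>)) = A (dx (dx \<phi>))"
  shows "A (wave_gen k c \<phi>) = wave_gen k c (A \<phi>)"
proof -
  have "dx (dx \<phi>) \<in> test_funs"
    using \<phi> by (intro test_funs_dir_deriv)
  then show ?thesis
    using A \<phi> unfolding wave_gen_def[abs_def] comm
    by (simp add: test_op_def test_funs_cmult)
qed

lemma
  assumes "\<phi> \<in> test_funs"
  shows wave_sin_gen_comm: "wave_sin k c t (wave_gen k c \<phi>) = wave_gen k c (wave_sin k c t \<phi>)"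
    and wave_cos_gen_comm: "wave_cos k c t (wave_gen k c \<phi>) = wave_gen k c (wave_cos k c t \<phi>)"
  using dx_pow_wave_sin[OF test_funs_smooth[OF assms], of 2 k c t]
    dx_pow_wave_cos[OF test_funs_smooth[OF assms], of 2 k c t]
  by (intro test_op_gen test_op_wave assms; simp add: numeral_2_eq_2)+

lemma avg_curve_bound:
  assumes \<kappa>: "continuous_on ({-T..T} \<times> {-1..1}) (\<lambda>p. \<kappa> (fst p) (snd p))" and \<phi>: "\<phi> \<in> test_funs"
  shows "\<exists>C. \<forall>t x. \<bar>t\<bar> \<le> T \<longrightarrow> \<bar>avg (c * t) p q (\<kappa> t) \<phi> x\<bar> \<le> C"
proof -
  obtain B where B: "\<And>x. \<bar>\<phi> x\<bar> \<le> B"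
    using test_funs_bounded[OF \<phi>] by metis
  have "bounded ((\<lambda>p. \<kappa> (fst p) (snd p)) ` ({-T..T} \<times> {-1..1}))"
    by (intro compact_imp_bounded compact_continuous_image \<kappa> compact_Times compact_Icc)
  then obtain M where M': "\<And>p. p \<in> {-T..T} \<times> {-1..1} \<Longrightarrow> \<bar>\<kappa> (fst p) (snd p)\<bar> \<le> M"
    unfolding bounded_iff real_norm_def by blast
  have M: "\<bar>\<kappa> t r\<bar> \<le> M" if "\<bar>t\<bar> \<le> T" "r \<in> {-1..1}" for t r
    using M'[of "(t, r)"] that by (simp add: abs_le_iff)
  have cont: "continuous_on {-1..1} (\<kappa> t)" if "\<bar>t\<bar> \<le> T" for t
  proof -
    have "(\<lambda>r. (t, r)) ` {-1..1} \<subseteq> {-T..T} \<times> {-1..1}"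
      using that by (auto simp: abs_le_iff)
    moreover have "continuous_on {-1..1} (\<lambda>r. (t, r))"
      by (intro continuous_on_Pair continuous_on_const continuous_on_id)
    ultimately show ?thesis
      using continuous_on_compose2[OF \<kappa>] by fastforce
  qed
  have "\<bar>avg (c * t) p q (\<kappa> t) \<phi> x\<bar> \<le> (\<bar>p\<bar> + \<bar>q\<bar> + 2 * M) * B" if "\<bar>t\<bar> \<le> T" for t x
    by (rule avg_bound[OF cont[OF that] M[OF that] smooth_continuous[OF test_funs_smooth[OF \<phi>]] B])
  then show ?thesis by blast
qed

lemma wave_bounds:
  assumes "\<phi> \<in> test_funs"
  shows "\<exists>C. \<forall>t x. \<bar>t\<bar> \<le> T \<longrightarrow> \<bar>wave_sin k c t \<phi> x\<bar> \<le> C"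
    and "\<exists>C. \<forall>t x. \<bar>t\<bar> \<le> T \<longrightarrow> \<bar>wave_cos k c t \<phi> x\<bar> \<le> C"
proof -
  have "continuous_on A (\<lambda>p. fst p / 2 * bessel (wave_const k c) (bessel_arg c (fst p) (snd p)))"
    "continuous_on A (\<lambda>p. (c * fst p)\<^sup>2 * bessel' (wave_const k c) (bessel_arg c (fst p) (snd p)))"
    for A :: "(real \<times> real) set"
    by (auto intro!: continuous_intros)
  then show "\<exists>C. \<forall>t x. \<bar>t\<bar> \<le> T \<longrightarrow> \<bar>wave_sin k c t \<phi> x\<bar> \<le> C"
    "\<exists>C. \<forall>t x. \<bar>t\<bar> \<le> T \<longrightarrow> \<bar>wave_cos k c t \<phi> x\<bar> \<le> C"
    unfolding wave_sin_def wave_cos_def by (intro avg_curve_bound assms; simp)+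
qed

lemma wave_support:
  assumes "\<phi> \<in> test_funs"
  shows "\<exists>K. compact K \<and> (\<forall>t x. \<bar>t\<bar> \<le> T \<and> x \<notin> K \<longrightarrow> wave_sin k c t \<phi> x = 0 \<and> wave_cos k c t \<phi> x = 0)"
proof -
  obtain R where R: "\<And>x. \<phi> x \<noteq> 0 \<Longrightarrow> x \<in> {-R..R}"
    using test_funs_interval[OF assms] by metis
  define S where "S = \<bar>c\<bar> * T"
  have S: "\<bar>c * t\<bar> \<le> S" if "\<bar>t\<bar> \<le> T" for t
    using that by (simp add: S_def abs_mult mult_left_mono)
  have "wave_sin k c t \<phi> x = 0 \<and> wave_cos k c t \<phi> x = 0" if "\<bar>t\<bar> \<le> T" "x \<notin> {-(R + S)..R + S}" for t x
    unfolding wave_sin_def wave_cos_def using avg_support[OF R S[OF that(1)]] that(2) by blast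
  then show ?thesis
    by (intro exI[of _ "{-(R + S)..R + S}"]) simp
qed

context
  fixes k c :: real
  assumes c: "c > 0"
begin

text \<open>The x-derivatives commute with the wave operators, so the time derivatives of all orders
  in x follow from those of the operators themselves; \<open>wave_gen\<close> supplies the second
  time derivative that \<open>test_curveI\<close> has to bound.\<close>

lemma wave_sin_curve:
  assumes \<phi>: "\<phi> \<in> test_funs"
  shows "test_curve (\<lambda>t. wave_sin k c t \<phi>) (\<lambda>t. wave_cos k c t \<phi>)"
proof (rule test_curveI[where \<psi>'' = "\<lambda>t. wave_sin k c t (wave_gen k c \<phi>)"])
  note s = test_funs_smooth[OF \<phi>]
  show "((\<lambda>t. (dx ^^ q) (wave_sin k c t \<phi>) x) has_real_derivative (dx ^^ q) (wave_cos k c t \<phi>) x) (at t)" for q t x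
    unfolding dx_pow_wave[OF s] by (rule wave_sin_has_dt[OF c smooth_dx_pow[OF s]])
  show "((\<lambda>t. (dx ^^ q) (wave_cos k c t \<phi>) x) has_real_derivative (dx ^^ q) (wave_sin k c t (wave_gen k c \<phi>)) x) (at t)" for q t x
    unfolding dx_pow_wave[OF s] dx_pow_wave[OF wave_gen_smooth[OF c s]] dx_pow_wave_gen[OF s]
    by (rule wave_cos_has_dt[OF c smooth_dx_pow[OF s]])
  show "\<exists>C. \<forall>t x. \<bar>t\<bar> \<le> T \<longrightarrow> \<bar>(dx ^^ q) (wave_sin k c t (wave_gen k c \<phi>)) x\<bar> \<le> C" for q T
    unfolding dx_pow_wave[OF wave_gen_smooth[OF c s]]
    by (intro wave_bounds test_funs_dx_pow wave_gen_test_funs[OF c] \<phi>)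
qed (rule wave_test_funs[OF \<phi>] wave_support[OF \<phi>])+

lemma wave_cos_curve:
  assumes \<phi>: "\<phi> \<in> test_funs"
  shows "test_curve (\<lambda>t. wave_cos k c t \<phi>) (\<lambda>t. wave_sin k c t (wave_gen k c \<phi>))"
proof (rule test_curveI[where \<psi>'' = "\<lambda>t. wave_cos k c t (wave_gen k c \<phi>)"])
  note s = test_funs_smooth[OF \<phi>]
  note \<phi>' = wave_gen_test_funs[OF c \<phi>]
  note s' = test_funs_smooth[OF \<phi>']
  show "((\<lambda>t. (dx ^^ q) (wave_cos k c t \<phi>) x) has_real_derivative (dx ^^ q) (wave_sin k c t (wave_gen k c \<phi>)) x) (at t)" for q t x
    unfolding dx_pow_wave[OF s] dx_pow_wave[OF s'] dx_pow_wave_gen[OF s]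
    by (rule wave_cos_has_dt[OF c smooth_dx_pow[OF s]])
  show "((\<lambda>t. (dx ^^ q) (wave_sin k c t (wave_gen k c \<phi>)) x) has_real_derivative (dx ^^ q) (wave_cos k c t (wave_gen k c \<phi>)) x) (at t)" for q t x
    unfolding dx_pow_wave[OF s'] by (rule wave_sin_has_dt[OF c smooth_dx_pow[OF s']])
  show "\<exists>C. \<forall>t x. \<bar>t\<bar> \<le> T \<longrightarrow> \<bar>(dx ^^ q) (wave_cos k c t (wave_gen k c \<phi>)) x\<bar> \<le> C" for q T
    unfolding dx_pow_wave[OF s'] by (intro wave_bounds test_funs_dx_pow \<phi>')
  show "\<exists>K. compact K \<and> (\<forall>t x. \<bar>t\<bar> \<le> T \<and> x \<notin> K \<longrightarrow> wave_cos k c t \<phi> x = 0 \<and> wave_sin k c t (wave_gen k c \<phi>) x = 0)" for T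
  proof -
    obtain K K' where K: "compact K" "\<And>t x. \<bar>t\<bar> \<le> T \<Longrightarrow> x \<notin> K \<Longrightarrow> wave_cos k c t \<phi> x = 0"
      "compact K'" "\<And>t x. \<bar>t\<bar> \<le> T \<Longrightarrow> x \<notin> K' \<Longrightarrow> wave_sin k c t (wave_gen k c \<phi>) x = 0"
      using wave_support[OF \<phi>, of T k c] wave_support[OF \<phi>', of T k c] by metis
    then show ?thesis
      by (intro exI[of _ "K \<union> K'"] conjI allI impI compact_Un) simp_all
  qed
qed (rule wave_test_funs[OF \<phi>] wave_test_funs[OF wave_gen_test_funs[OF c \<phi>]])+

end

section \<open>The explicit solution and the duality argument\<close>

lemma test_curve_shift:
  assumes "test_curve \<psi> \<psi>'"
  shows "test_curve (\<lambda>t. \<psi> (t - T)) (\<lambda>t. \<psi>' (t - T))"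
proof -
  have "t + d - T = t - T + d" for t d :: real by simp
  then show ?thesis
    using assms unfolding test_curve_def by (simp only:) blast
qed

text \<open>The transpose of \<open>wave_gen\<close>; its form is the same because the second
  derivative is symmetric.\<close>

definition gen_dist :: "real \<Rightarrow> real \<Rightarrow> real distribution \<Rightarrow> real distribution"
  where "gen_dist k c T = c\<^sup>2 *\<^sub>R dd T + (k / 2)\<^sup>2 *\<^sub>R T"

lemma pairing_linear:
  "pairing (S + T) \<phi> = pairing S \<phi> + pairing T \<phi>"
  "pairing (S - T) \<phi> = pairing S \<phi> - pairing T \<phi>"
  "pairing (a *\<^sub>R T) \<phi> = a * pairing T \<phi>"
  "pairing 0 \<phi> = 0"
  by (simp_all add: plus_distribution.rep_eq pairing_diff_distribution scaleR_distribution.rep_eq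
      zero_distribution.rep_eq)

lemma pairing_wave_gen:
  assumes "\<phi> \<in> test_funs"
  shows "pairing T (wave_gen k c \<phi>) = pairing (gen_dist k c T) \<phi>"
proof -
  have "dx (dx \<phi>) \<in> test_funs"
    using assms by (intro test_funs_dir_deriv)
  then show ?thesis
    using assms unfolding wave_gen_def[abs_def] gen_dist_def
    by (simp add: pairing_linear pairing_add pairing_cmult test_funs_cmult pairing_dd)
qed

text \<open>This is exp(k t / 2) times the solution. Its initial value is f and its initial velocity
  is g + (k / 2) f, which explains the argument of the second operator.\<close>

definition wave_part :: "real \<Rightarrow> real \<Rightarrow> real distribution \<Rightarrow> real distribution \<Rightarrow> real \<Rightarrow> real distribution"
  where "wave_part k c f g t =
    transpose_op (wave_cos k c t) f + transpose_op (wave_sin k c t) (g + (k / 2) *\<^sub>R f)"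

definition wave_part_dt :: "real \<Rightarrow> real \<Rightarrow> real distribution \<Rightarrow> real distribution \<Rightarrow> real \<Rightarrow> real distribution"
  where "wave_part_dt k c f g t =
    transpose_op (wave_sin k c t) (gen_dist k c f) + transpose_op (wave_cos k c t) (g + (k / 2) *\<^sub>R f)"

definition wave_u :: "real \<Rightarrow> real \<Rightarrow> real distribution \<Rightarrow> real distribution \<Rightarrow> real \<Rightarrow> real distribution"
  where "wave_u k c f g t = exp (- (k / 2) * t) *\<^sub>R wave_part k c f g t"

definition wave_v :: "real \<Rightarrow> real \<Rightarrow> real distribution \<Rightarrow> real distribution \<Rightarrow> real \<Rightarrow> real distribution"
  where "wave_v k c f g t =
    exp (- (k / 2) * t) *\<^sub>R (wave_part_dt k c f g t - (k / 2) *\<^sub>R wave_part k c f g t)"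

lemmas pairing_wave = pairing_transpose_op[OF test_op_wave_sin] pairing_transpose_op[OF test_op_wave_cos]

text \<open>Uniqueness by duality: along a solution \<open>(u, v)\<close>, the expression \<open>E\<close> below, which pairs
  the solution with the adjoint solution vanishing at time \<open>T\<close>, is constant.\<close>

lemma solution_formula:
  assumes c: "c > 0" and sol: "is_solution k c f g u"
  shows "u = wave_u k c f g"
proof (intro ext distribution_eqI)
  fix T and \<phi> :: "real \<Rightarrow> real" assume \<phi>: "\<phi> \<in> test_funs"
  obtain v where u: "\<And>t. has_time_deriv u (v t) t"
    and v: "\<And>t. has_time_deriv v (c\<^sup>2 *\<^sub>R dd (u t) - k *\<^sub>R v t) t" and init: "u 0 = f" "v 0 = g"
    using sol unfolding is_solution_iff by blast
  define m where "m = k / 2"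
  define \<psi> where "\<psi> t = wave_sin k c (t - T) \<phi>" for t
  define \<psi>' where "\<psi>' t = wave_cos k c (t - T) \<phi>" for t
  define \<psi>'' where "\<psi>'' t = wave_gen k c (\<psi> t)" for t
  have \<psi>: "test_curve \<psi> \<psi>'" "test_curve \<psi>' \<psi>''"
    using test_curve_shift[OF wave_sin_curve[OF c \<phi>], of k T] test_curve_shift[OF wave_cos_curve[OF c \<phi>], of k T]
    by (simp_all add: \<psi>_def[abs_def] \<psi>'_def[abs_def] \<psi>''_def[abs_def] wave_sin_gen_comm[OF \<phi>])
  have \<psi>_test: "\<psi> t \<in> test_funs" for t
    unfolding \<psi>_def by (intro wave_test_funs \<phi>)
  \<comment> \<open>With w = exp(m t) u this is the Wronskian w_t(\<psi>) - w(\<psi>'). It is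
    constant because w and \<psi> solve the same equation, whose spatial operator is
    symmetric.\<close>
  define E where "E t = exp (m * t) * (pairing (v t) (\<psi> t) + m * pairing (u t) (\<psi> t) - pairing (u t) (\<psi>' t))" for t
  have "(E has_real_derivative 0) (at t)" for t
  proof -
    have "(E has_real_derivative
        exp (m * t) * m * (pairing (v t) (\<psi> t) + m * pairing (u t) (\<psi> t) - pairing (u t) (\<psi>' t))
        + (pairing (c\<^sup>2 *\<^sub>R dd (u t) - k *\<^sub>R v t) (\<psi> t) + pairing (v t) (\<psi>' t)
          + m * (pairing (v t) (\<psi> t) + pairing (u t) (\<psi>' t))
          - (pairing (v t) (\<psi>' t) + pairing (u t) (\<psi>'' t))) * exp (m * t)) (at t)"
      unfolding E_def[abs_def]
      by (intro DERIV_mult DERIV_diff DERIV_add DERIV_cmult pairing_curve_deriv[OF v \<psi>(1)]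
          pairing_curve_deriv[OF u \<psi>(1)] pairing_curve_deriv[OF u \<psi>(2)])
        (auto intro!: derivative_eq_intros)
    moreover have "pairing (u t) (\<psi>'' t) = c\<^sup>2 * pairing (dd (u t)) (\<psi> t) + m\<^sup>2 * pairing (u t) (\<psi> t)"
      unfolding \<psi>''_def pairing_wave_gen[OF \<psi>_test] by (simp add: gen_dist_def pairing_linear m_def)
    moreover have "k = 2 * m"
      by (simp add: m_def)
    ultimately show ?thesis
      by (simp add: pairing_linear algebra_simps power2_eq_square)
  qed
  then have "E T = E 0"
    by (rule DERIV_isconst_all[rule_format])
  \<comment> \<open>At t = T the pair (\<psi>, \<psi>') is (0, \<phi>), so only the wanted value of
    \<open>u T\<close> survives; at t = 0 only the initial data enter.\<close>
  moreover have "E T = - (exp (m * T) * pairing (u T) \<phi>)"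
    by (simp add: pairing_zero E_def \<psi>_def \<psi>'_def wave_sin_0 wave_cos_0)
  moreover have "E 0 = - (pairing (wave_part k c f g T) \<phi>)"
  proof -
    have "\<psi> 0 = (\<lambda>x. (-1) * wave_sin k c T \<phi> x)" "\<psi>' 0 = wave_cos k c T \<phi>"
      using wave_sin_minus[of k c T \<phi>] wave_cos_minus[of k c T \<phi>] by (auto simp: \<psi>_def \<psi>'_def)
    then have "E 0 = pairing g (\<lambda>x. (-1) * wave_sin k c T \<phi> x) + m * pairing f (\<lambda>x. (-1) * wave_sin k c T \<phi> x) - pairing f (wave_cos k c T \<phi>)"
      by (simp only: E_def init) simp
    also have "\<dots> = - (pairing (wave_part k c f g T) \<phi>)"
      by (simp only: wave_part_def pairing_linear pairing_wave[OF \<phi>] pairing_cmult[OF wave_test_funs(1)[OF \<phi>]])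
        (simp add: m_def algebra_simps)
    finally show ?thesis .
  qed
  ultimately have "exp (m * T) * pairing (u T) \<phi> = pairing (wave_part k c f g T) \<phi>"
    by simp
  then have "pairing (u T) \<phi> = exp (- (m * T)) * pairing (wave_part k c f g T) \<phi>"
    by (simp add: exp_minus field_simps)
  then show "pairing (u T) \<phi> = pairing (wave_u k c f g T) \<phi>"
    by (simp add: wave_u_def pairing_linear m_def)
qed

lemma has_time_deriv_transpose:
  assumes curve: "\<And>\<phi>. \<phi> \<in> test_funs \<Longrightarrow> test_curve (\<lambda>t. A t \<phi>) (\<lambda>t. A' t \<phi>)"
    and A: "\<And>t. test_op (A t)"
    and S: "\<And>\<phi>. \<phi> \<in> test_funs \<Longrightarrow> pairing S \<phi> = pairing T (A' t \<phi>)"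
  shows "has_time_deriv (\<lambda>t. transpose_op (A t) T) S t"
  unfolding has_time_deriv_def
proof
  fix \<phi> :: "real \<Rightarrow> real" assume \<phi>: "\<phi> \<in> test_funs"
  \<comment> \<open>For a constant curve of distributions the product rule differentiates only the
    test function.\<close>
  have "has_time_deriv (\<lambda>t. T) 0 t"
    by (simp add: has_time_deriv_def pairing_linear)
  from pairing_curve_deriv[OF this curve[OF \<phi>]]
  show "((\<lambda>t. pairing (transpose_op (A t) T) \<phi>) has_real_derivative pairing S \<phi>) (at t)"
    by (simp add: pairing_transpose_op[OF A \<phi>] S[OF \<phi>] pairing_linear)
qed

lemma has_time_deriv_add:
  "has_time_deriv u v t \<Longrightarrow> has_time_deriv u' v' t \<Longrightarrow> has_time_deriv (\<lambda>s. u s + u' s) (v + v') t"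
  unfolding has_time_deriv_def by (auto simp: pairing_linear intro!: DERIV_add)

lemma has_time_deriv_exp:
  assumes "has_time_deriv w w' t"
  shows "has_time_deriv (\<lambda>s. exp (- m * s) *\<^sub>R w s) (exp (- m * t) *\<^sub>R (w' - m *\<^sub>R w t)) t"
  unfolding has_time_deriv_def
proof
  fix \<phi> :: "real \<Rightarrow> real" assume "\<phi> \<in> test_funs"
  then have d: "((\<lambda>s. pairing (w s) \<phi>) has_real_derivative pairing w' \<phi>) (at t)"
    using assms by (simp add: has_time_deriv_def)
  have "((\<lambda>s. exp (- m * s)) has_real_derivative exp (- m * t) * (- m)) (at t)"
    by (auto intro!: derivative_eq_intros)
  from DERIV_mult[OF this d]
  show "((\<lambda>s. pairing (exp (- m * s) *\<^sub>R w s) \<phi>) has_real_derivative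
      pairing (exp (- m * t) *\<^sub>R (w' - m *\<^sub>R w t)) \<phi>) (at t)"
    unfolding pairing_linear by (rule DERIV_cong) (simp add: algebra_simps)
qed

lemma wave_transpose_deriv:
  assumes c: "c > 0"
  shows "has_time_deriv (\<lambda>t. transpose_op (wave_cos k c t) T) (transpose_op (wave_sin k c t) (gen_dist k c T)) t"
    and "has_time_deriv (\<lambda>t. transpose_op (wave_sin k c t) T) (transpose_op (wave_cos k c t) T) t"
proof -
  show "has_time_deriv (\<lambda>t. transpose_op (wave_cos k c t) T) (transpose_op (wave_sin k c t) (gen_dist k c T)) t"
    by (rule has_time_deriv_transpose[OF wave_cos_curve[OF c] test_op_wave_cos])
      (simp_all add: pairing_wave wave_sin_gen_comm pairing_wave_gen wave_test_funs)
  show "has_time_deriv (\<lambda>t. transpose_op (wave_sin k c t) T) (transpose_op (wave_cos k c t) T) t"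
    by (rule has_time_deriv_transpose[OF wave_sin_curve[OF c] test_op_wave_sin])
      (simp_all add: pairing_wave)
qed

lemma transpose_gen:
  "transpose_op (wave_sin k c t) (gen_dist k c T) = gen_dist k c (transpose_op (wave_sin k c t) T)"
  "transpose_op (wave_cos k c t) (gen_dist k c T) = gen_dist k c (transpose_op (wave_cos k c t) T)"
proof -
  have gen: "wave_gen k c \<phi> \<in> test_funs" if "\<phi> \<in> test_funs" for \<phi>
    unfolding wave_gen_def[abs_def] using that by (intro test_funs_add test_funs_cmult test_funs_dir_deriv)
  show "transpose_op (wave_sin k c t) (gen_dist k c T) = gen_dist k c (transpose_op (wave_sin k c t) T)"
    "transpose_op (wave_cos k c t) (gen_dist k c T) = gen_dist k c (transpose_op (wave_cos k c t) T)"
    by (rule distribution_eqI, simp add: pairing_wave pairing_wave_gen[symmetric] wave_test_funs gen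
        wave_sin_gen_comm wave_cos_gen_comm)+
qed

text \<open>The transposes commute with \<open>gen_dist\<close>, so w = \<open>wave_part\<close>
  satisfies w'' = \<open>gen_dist\<close> w. After multiplication by exp(-(k / 2) t) the terms with
  (k / 2)^2 cancel and the damping term appears.\<close>

lemma
  assumes c: "c > 0"
  shows wave_u_dt: "has_time_deriv (wave_u k c f g) (wave_v k c f g t) t"
    and wave_v_dt: "has_time_deriv (wave_v k c f g) (c\<^sup>2 *\<^sub>R dd (wave_u k c f g t) - k *\<^sub>R wave_v k c f g t) t"
proof -
  note d = wave_transpose_deriv[OF c]
  have w: "has_time_deriv (wave_part k c f g) (wave_part_dt k c f g t) t" for t
    unfolding wave_part_def[abs_def] wave_part_dt_def by (intro has_time_deriv_add d)
  define w2 where "w2 t = transpose_op (wave_cos k c t) (gen_dist k c f)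
    + transpose_op (wave_sin k c t) (gen_dist k c (g + (k / 2) *\<^sub>R f))" for t
  have w1: "has_time_deriv (wave_part_dt k c f g) (w2 t) t" for t
    unfolding wave_part_dt_def[abs_def] w2_def by (intro has_time_deriv_add d)
  show "has_time_deriv (wave_u k c f g) (wave_v k c f g t) t"
    unfolding wave_u_def[abs_def] wave_v_def by (intro has_time_deriv_exp w)
  have "has_time_deriv (wave_v k c f g) (exp (- (k / 2) * t) *\<^sub>R
      ((w2 t - (k / 2) *\<^sub>R wave_part_dt k c f g t)
        - (k / 2) *\<^sub>R (wave_part_dt k c f g t - (k / 2) *\<^sub>R wave_part k c f g t))) t"
    unfolding wave_v_def[abs_def]
    by (intro has_time_deriv_exp has_time_deriv_diff has_time_deriv_scaleR w w1)
  moreover have "exp (- (k / 2) * t) *\<^sub>R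
      ((w2 t - (k / 2) *\<^sub>R wave_part_dt k c f g t)
        - (k / 2) *\<^sub>R (wave_part_dt k c f g t - (k / 2) *\<^sub>R wave_part k c f g t)) =
      c\<^sup>2 *\<^sub>R dd (wave_u k c f g t) - k *\<^sub>R wave_v k c f g t"
  proof (rule distribution_eqI)
    fix \<phi> :: "real \<Rightarrow> real" assume \<phi>: "\<phi> \<in> test_funs"
    have "pairing (w2 t) \<phi> = c\<^sup>2 * pairing (wave_part k c f g t) (dx (dx \<phi>)) + (k / 2)\<^sup>2 * pairing (wave_part k c f g t) \<phi>"
      unfolding w2_def transpose_gen unfolding gen_dist_def wave_part_def
      by (simp add: pairing_linear pairing_dd[OF \<phi>] algebra_simps)
    then show "pairing (exp (- (k / 2) * t) *\<^sub>R
        ((w2 t - (k / 2) *\<^sub>R wave_part_dt k c f g t)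
          - (k / 2) *\<^sub>R (wave_part_dt k c f g t - (k / 2) *\<^sub>R wave_part k c f g t))) \<phi> =
        pairing (c\<^sup>2 *\<^sub>R dd (wave_u k c f g t) - k *\<^sub>R wave_v k c f g t) \<phi>"
      by (simp add: wave_u_def wave_v_def pairing_linear pairing_dd[OF \<phi>] algebra_simps power2_eq_square)
  qed
  ultimately show "has_time_deriv (wave_v k c f g) (c\<^sup>2 *\<^sub>R dd (wave_u k c f g t) - k *\<^sub>R wave_v k c f g t) t"
    by simp
qed

lemma wave_initial: "wave_u k c f g 0 = f" "wave_v k c f g 0 = g"
proof -
  have "transpose_op (wave_cos k c 0) T = T" "transpose_op (wave_sin k c 0) T = 0" for T
    by (auto intro!: distribution_eqI simp: pairing_zero pairing_wave wave_cos_0 wave_sin_0 pairing_linear)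
  then show "wave_u k c f g 0 = f" "wave_v k c f g 0 = g"
    by (simp_all add: wave_u_def wave_v_def wave_part_def wave_part_dt_def)
qed

lemma
  assumes c: "c > 0"
  shows solution_eq: "solution k c f g = wave_u k c f g"
    and time_deriv_solution: "time_deriv (solution k c f g) t = wave_v k c f g t"
proof -
  have sol: "is_solution k c f g (wave_u k c f g)"
    unfolding is_solution_iff using wave_u_dt[OF c] wave_v_dt[OF c] wave_initial by blast
  show eq: "solution k c f g = wave_u k c f g"
    unfolding solution_def by (rule the_equality[of "is_solution k c f g", OF sol solution_formula[OF c]])
  show "time_deriv (solution k c f g) t = wave_v k c f g t"
    unfolding eq by (rule time_deriv_eq[OF wave_u_dt[OF c]])
qed

lemma has_time_deriv_shift: "has_time_deriv u v (t + s) \<Longrightarrow> has_time_deriv (\<lambda>t. u (t + s)) v t"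
  unfolding has_time_deriv_def by (simp add: DERIV_shift)

lemma wave_semigroup:
  assumes c: "c > 0"
  shows "wave_u k c (wave_u k c f g s) (wave_v k c f g s) t = wave_u k c f g (t + s)"
    and "wave_v k c (wave_u k c f g s) (wave_v k c f g s) t = wave_v k c f g (t + s)"
proof -
  let ?u = "\<lambda>t. wave_u k c f g (t + s)" and ?v = "\<lambda>t. wave_v k c f g (t + s)"
  have u: "has_time_deriv ?u (?v t) t" for t
    by (rule has_time_deriv_shift[OF wave_u_dt[OF c]])
  have "has_time_deriv ?v (c\<^sup>2 *\<^sub>R dd (?u t) - k *\<^sub>R ?v t) t" for t
    by (rule has_time_deriv_shift[OF wave_v_dt[OF c]])
  with u have "is_solution k c (wave_u k c f g s) (wave_v k c f g s) ?u"
    unfolding is_solution_iff by (intro exI[of _ ?v]) simp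
  from solution_formula[OF c this]
  have eq: "wave_u k c (wave_u k c f g s) (wave_v k c f g s) = ?u" ..
  then show "wave_u k c (wave_u k c f g s) (wave_v k c f g s) t = wave_u k c f g (t + s)"
    by simp
  show "wave_v k c (wave_u k c f g s) (wave_v k c f g s) t = wave_v k c f g (t + s)"
    using has_time_deriv_unique[OF wave_u_dt[OF c, of k "wave_u k c f g s" "wave_v k c f g s" t, unfolded eq] u] .
qed

section \<open>Boundedness on \<open>L\<^sup>2(\<real>)\<close>\<close>

lemma square_integrable_translate:
  assumes "square_integrable f"
  shows "square_integrable (\<lambda>x. f (x + s))" "(LINT x|lborel. (f (x + s))\<^sup>2) = (LINT x|lborel. (f x)\<^sup>2)"
proof -
  have "(\<lambda>x. f (x + s)) \<in> borel_measurable borel"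
    using square_integrable_measurable[OF assms] by measurable
  moreover have "integrable lborel (\<lambda>x. (f (s + 1 * x))\<^sup>2)"
    using assms by (intro lborel_integrable_real_affine) (auto simp: square_integrable_def)
  ultimately show "square_integrable (\<lambda>x. f (x + s))"
    by (simp add: square_integrable_def add.commute)
  show "(LINT x|lborel. (f (x + s))\<^sup>2) = (LINT x|lborel. (f x)\<^sup>2)"
    using lborel_integral_real_affine[of 1 "\<lambda>x. (f x)\<^sup>2" s] by (simp add: add.commute)
qed

lemma lborel_integral_translate:
  fixes f :: "real \<Rightarrow> real"
  shows "(LINT x|lborel. f (x + s)) = (LINT x|lborel. f x)"
  using lborel_integral_real_affine[of 1 f s] by (simp add: add.commute)

text \<open>The inequality is the nonnegativity of the integral of (b - \<mu>)^2 over [-1, 1], with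
  \<mu> the mean of \<open>b\<close> there; the constant 2 is the length of the interval.\<close>

lemma jensen_interval:
  fixes b :: "real \<Rightarrow> real"
  assumes [measurable]: "b \<in> borel_measurable borel" and supp: "\<And>r. r \<notin> {-1..1} \<Longrightarrow> b r = 0"
    and sq: "integrable lborel (\<lambda>r. (b r)\<^sup>2)"
  shows "(LINT r|lborel. b r)\<^sup>2 \<le> 2 * (LINT r|lborel. (b r)\<^sup>2)"
proof -
  let ?I = "indicator {-1..1} :: real \<Rightarrow> real"
  have I: "integrable lborel ?I" "(LINT r|lborel. ?I r) = 2"
    by (auto simp: integrable_indicator_iff)
  have b_eq: "b r = ?I r * b r" for r
    using supp[of r] by (auto simp: indicator_def)
  have b: "integrable lborel b"
  proof (rule Bochner_Integration.integrable_bound)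
    show "integrable lborel (\<lambda>r. ?I r + (b r)\<^sup>2)"
      using I(1) sq by (rule Bochner_Integration.integrable_add)
    have "\<bar>b r\<bar> \<le> ?I r + (b r)\<^sup>2" for r
    proof (cases "r \<in> {-1..1}")
      case True
      have "0 \<le> (\<bar>b r\<bar> - 1)\<^sup>2" by simp
      then have "2 * \<bar>b r\<bar> \<le> 1 + (b r)\<^sup>2"
        by (simp add: power2_diff)
      then show ?thesis
        using True by simp
    qed (simp add: supp)
    then show "AE r in lborel. norm (b r) \<le> norm (?I r + (b r)\<^sup>2)"
      by (simp add: order_trans[OF _ abs_ge_self])
  qed simp
  define \<mu> where "\<mu> = (LINT r|lborel. b r) / 2"
  have "0 \<le> (LINT r|lborel. (b r - \<mu> * ?I r)\<^sup>2)"
    by simp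
  also have "(LINT r|lborel. (b r - \<mu> * ?I r)\<^sup>2) = (LINT r|lborel. (b r)\<^sup>2 - 2 * \<mu> * b r + \<mu>\<^sup>2 * ?I r)"
    using b_eq by (intro Bochner_Integration.integral_cong) (auto simp: indicator_def power2_diff)
  also have "\<dots> = (LINT r|lborel. (b r)\<^sup>2) - 2 * \<mu> * (LINT r|lborel. b r) + \<mu>\<^sup>2 * 2"
    using b sq I by simp
  also have "\<dots> = (LINT r|lborel. (b r)\<^sup>2) - (LINT r|lborel. b r)\<^sup>2 / 2"
    by (simp add: \<mu>_def power2_eq_square field_simps)
  finally show ?thesis
    by (simp add: field_simps)
qed

text \<open>For fixed r in [-1, 1] the integral in x is that of f^2 by translation invariance, hence
  constant in r. This square dominates the integrands whose order of integration is exchanged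
  below.\<close>

lemma integrable_strip:
  assumes f: "square_integrable f"
  shows "integrable (lborel \<Otimes>\<^sub>M lborel) (\<lambda>(r, x). indicator {-1..1} r * (f (x + s * r))\<^sup>2 :: real)"
proof -
  define F where "F = (\<lambda>(r, x). indicator {-1..1} r * (f (x + s * r))\<^sup>2 :: real)"
  note [measurable] = square_integrable_measurable[OF f]
  have "integrable (lborel \<Otimes>\<^sub>M lborel) F"
  proof (rule lborel_pair.Fubini_integrable)
    show "F \<in> borel_measurable (lborel \<Otimes>\<^sub>M lborel)"
      unfolding F_def by measurable
    have "integrable lborel (\<lambda>r. indicator {-1..1::real} r * (LINT x|lborel. (f x)\<^sup>2) :: real)"
      by (auto simp: integrable_indicator_iff)
    then show "integrable lborel (\<lambda>r. LINT x|lborel. norm (F (r, x)))"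
      by (simp add: F_def abs_mult square_integrable_translate(2)[OF f])
    show "AE r in lborel. integrable lborel (\<lambda>x. F (r, x))"
      using square_integrable_translate(1)[OF f] by (auto simp: F_def square_integrable_def)
  qed
  then show ?thesis
    by (simp add: F_def)
qed

lemma L2_repr_translate:
  assumes "L2_repr T f"
  shows "L2_repr (transpose_op (avg s 1 0 (\<lambda>_. 0)) T) (\<lambda>x. f (x + (- s)))"
  unfolding L2_repr_def
proof (intro conjI ballI)
  have f: "square_integrable f"
    using assms by (simp add: L2_repr_def)
  show "square_integrable (\<lambda>x. f (x + (- s)))"
    by (rule square_integrable_translate(1)[OF f])
  fix \<phi> :: "real \<Rightarrow> real" assume \<phi>: "\<phi> \<in> test_funs"
  have op: "test_op (avg s 1 0 (\<lambda>_. 0))"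
    by (rule test_op_avg) simp
  have "pairing (transpose_op (avg s 1 0 (\<lambda>_. 0)) T) \<phi> = (LINT x|lborel. f x * avg s 1 0 (\<lambda>_. 0) \<phi> x)"
    using assms test_op_test_funs[OF op \<phi>] by (simp add: pairing_transpose_op[OF op \<phi>] L2_repr_def)
  also have "\<dots> = (LINT x|lborel. f x * \<phi> (x + s))"
    by (simp add: avg_def)
  also have "\<dots> = (LINT x|lborel. f (x + (- s)) * \<phi> (x + (- s) + s))"
    by (rule lborel_integral_translate[symmetric])
  finally show "pairing (transpose_op (avg s 1 0 (\<lambda>_. 0)) T) \<phi> = (LINT x|lborel. f (x + (- s)) * \<phi> x)"
    by simp
qed

text \<open>The transpose of translation by s r is translation by -s r, so \<open>h\<close> averages
  \<open>f\<close> with the reflected shift. Jensen at almost every x and then Fubini give 2 M^2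
  times the strip integral, which is twice the integral of f^2; hence the constant (2 M)^2.\<close>

lemma L2_repr_average:
  assumes T: "L2_repr T f" and \<kappa>: "continuous_on {-1..1} \<kappa>" and M: "\<And>r. r \<in> {-1..1} \<Longrightarrow> \<bar>\<kappa> r\<bar> \<le> M"
  shows "\<exists>h. L2_repr (transpose_op (avg s 0 0 \<kappa>) T) h \<and>
    (LINT x|lborel. (h x)\<^sup>2) \<le> (2 * M)\<^sup>2 * (LINT x|lborel. (f x)\<^sup>2)"
proof -
  have f: "square_integrable f"
    using T by (simp add: L2_repr_def)
  note [measurable] = square_integrable_measurable[OF f]
  define \<kappa>0 where "\<kappa>0 r = indicator {-1..1} r *\<^sub>R \<kappa> r" for r
  have [measurable]: "\<kappa>0 \<in> borel_measurable borel"
    using borel_measurable_continuous_on_indicator[OF _ \<kappa>] by (simp add: \<kappa>0_def[abs_def])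
  have \<kappa>0_M: "\<bar>\<kappa>0 r\<bar> \<le> M * indicator {-1..1} r" for r
    using M[of r] by (auto simp: \<kappa>0_def indicator_def)
  define h where "h x = (LINT r|lborel. \<kappa>0 r * f (x + (- s) * r))" for x
  define G where "G x = (LINT r|lborel. indicator {-1..1} r * (f (x + (- s) * r))\<^sup>2 :: real)" for x
  note strip = integrable_strip[OF f, of "- s"]
  have G: "integrable lborel G" "(LINT x|lborel. G x) = 2 * (LINT x|lborel. (f x)\<^sup>2)"
  proof -
    show "integrable lborel G"
      unfolding G_def using lborel_pair.integrable_snd[OF strip] by simp
    have "(LINT x|lborel. G x) = (LINT r|lborel. LINT x|lborel. indicator {-1..1} r * (f (x + (- s) * r))\<^sup>2)"
      unfolding G_def by (rule lborel_pair.Fubini_integral[OF strip])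
    also have "\<dots> = (LINT r|lborel. indicator {-1..1::real} r * (LINT x|lborel. (f x)\<^sup>2))"
      by (simp only: integral_mult_right_zero square_integrable_translate(2)[OF f])
    finally show "(LINT x|lborel. G x) = 2 * (LINT x|lborel. (f x)\<^sup>2)"
      by simp
  qed
  have h_meas [measurable]: "h \<in> borel_measurable borel"
    unfolding h_def[abs_def] by measurable
  have "AE x in lborel. integrable lborel (\<lambda>r. indicator {-1..1} r * (f (x + (- s) * r))\<^sup>2 :: real)"
    using lborel_pair.AE_integrable_snd[OF strip] by simp
  then have h_le: "AE x in lborel. (h x)\<^sup>2 \<le> 2 * M\<^sup>2 * G x"
  proof (rule eventually_mono)
    fix x assume int: "integrable lborel (\<lambda>r. indicator {-1..1} r * (f (x + (- s) * r))\<^sup>2 :: real)"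
    have le: "(\<kappa>0 r * f (x + (- s) * r))\<^sup>2 \<le> M\<^sup>2 * (indicator {-1..1} r * (f (x + (- s) * r))\<^sup>2)" for r
    proof (cases "r \<in> {-1..1}")
      case True
      then have "(\<kappa>0 r)\<^sup>2 \<le> M\<^sup>2"
        using \<kappa>0_M[of r] by (simp add: abs_le_square_iff[symmetric])
      then show ?thesis
        using True by (simp add: power_mult_distrib mult_right_mono)
    qed (simp add: \<kappa>0_def)
    have int2: "integrable lborel (\<lambda>r. (\<kappa>0 r * f (x + (- s) * r))\<^sup>2)"
    proof (rule Bochner_Integration.integrable_bound)
      show "integrable lborel (\<lambda>r. M\<^sup>2 * (indicator {-1..1} r * (f (x + (- s) * r))\<^sup>2) :: real)"
        using int by (rule integrable_mult_right)
      show "AE r in lborel. norm ((\<kappa>0 r * f (x + (- s) * r))\<^sup>2) \<le> norm (M\<^sup>2 * (indicator {-1..1} r * (f (x + (- s) * r))\<^sup>2) :: real)"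
        using le by (intro always_eventually allI) (metis abs_ge_self order_trans real_norm_def abs_power2)
    qed simp
    have "(h x)\<^sup>2 \<le> 2 * (LINT r|lborel. (\<kappa>0 r * f (x + (- s) * r))\<^sup>2)"
      unfolding h_def
    proof (rule jensen_interval[OF _ _ int2])
      show "(\<lambda>r. \<kappa>0 r * f (x + (- s) * r)) \<in> borel_measurable borel"
        by measurable
    qed (simp add: \<kappa>0_def)
    also have "(LINT r|lborel. (\<kappa>0 r * f (x + (- s) * r))\<^sup>2) \<le> (LINT r|lborel. M\<^sup>2 * (indicator {-1..1} r * (f (x + (- s) * r))\<^sup>2))"
      using int2 int le by (intro integral_mono) auto
    finally show "(h x)\<^sup>2 \<le> 2 * M\<^sup>2 * G x"
      by (simp add: G_def mult.assoc)
  qed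
  have h_sq: "integrable lborel (\<lambda>x. (h x)\<^sup>2)"
  proof (rule Bochner_Integration.integrable_bound)
    show "integrable lborel (\<lambda>x. 2 * M\<^sup>2 * G x)"
      using G(1) by simp
    show "AE x in lborel. norm ((h x)\<^sup>2) \<le> norm (2 * M\<^sup>2 * G x)"
      using h_le by (rule eventually_mono) simp
  qed simp
  have h_bound: "(LINT x|lborel. (h x)\<^sup>2) \<le> (2 * M)\<^sup>2 * (LINT x|lborel. (f x)\<^sup>2)"
  proof -
    have "(LINT x|lborel. (h x)\<^sup>2) \<le> (LINT x|lborel. 2 * M\<^sup>2 * G x)"
      using h_sq G(1) h_le by (intro integral_mono_AE) auto
    then show ?thesis
      by (simp add: G(2) power_mult_distrib)
  qed
  have "pairing (transpose_op (avg s 0 0 \<kappa>) T) \<phi> = (LINT x|lborel. h x * \<phi> x)" if \<phi>: "\<phi> \<in> test_funs" for \<phi>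
  proof -
    note sq_\<phi> = square_integrable_test_funs[OF \<phi>]
    note [measurable] = square_integrable_measurable[OF sq_\<phi>]
    have op: "test_op (avg s 0 0 \<kappa>)"
      using \<kappa> by (rule test_op_avg)
    have young: "\<bar>\<kappa>0 r * a * b\<bar> \<le> M * (indicator {-1..1} r * a\<^sup>2 + indicator {-1..1} r * b\<^sup>2)" for r a b :: real
    proof -
      have "0 \<le> (\<bar>a\<bar> - \<bar>b\<bar>)\<^sup>2" by simp
      then have "2 * (\<bar>a\<bar> * \<bar>b\<bar>) \<le> a\<^sup>2 + b\<^sup>2"
        by (simp add: power2_diff)
      then have "\<bar>a * b\<bar> \<le> a\<^sup>2 + b\<^sup>2"
        unfolding abs_mult by (smt (verit) mult_nonneg_nonneg abs_ge_zero)
      then have "\<bar>\<kappa>0 r\<bar> * \<bar>a * b\<bar> \<le> (M * indicator {-1..1} r) * (a\<^sup>2 + b\<^sup>2)"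
        using \<kappa>0_M[of r] by (intro mult_mono) auto
      then show ?thesis
        by (simp add: abs_mult algebra_simps)
    qed
    \<comment> \<open>By \<open>young\<close> the product of an L2 function and a test function is
      bounded by squares on the strip, which justifies both exchanges of integrals. Writing
      \<open>x + 0 * r\<close> lets \<open>integrable_strip\<close> cover the unshifted factor as
      well.\<close>
    have int1: "integrable (lborel \<Otimes>\<^sub>M lborel) (\<lambda>(r, x). \<kappa>0 r * f (x + (- s) * r) * \<phi> x)"
    proof (rule Bochner_Integration.integrable_bound)
      show "integrable (lborel \<Otimes>\<^sub>M lborel) (\<lambda>p. M * ((case p of (r, x) \<Rightarrow> indicator {-1..1} r * (f (x + (- s) * r))\<^sup>2)
          + (case p of (r, x) \<Rightarrow> indicator {-1..1} r * (\<phi> (x + 0 * r))\<^sup>2)) :: real)"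
        by (intro integrable_mult_right Bochner_Integration.integrable_add strip integrable_strip[OF sq_\<phi>])
      show "(\<lambda>(r, x). \<kappa>0 r * f (x + (- s) * r) * \<phi> x) \<in> borel_measurable (lborel \<Otimes>\<^sub>M lborel)"
        by measurable
      show "AE p in lborel \<Otimes>\<^sub>M lborel. norm (case p of (r, x) \<Rightarrow> \<kappa>0 r * f (x + (- s) * r) * \<phi> x) \<le>
          norm (M * ((case p of (r, x) \<Rightarrow> indicator {-1..1} r * (f (x + (- s) * r))\<^sup>2)
          + (case p of (r, x) \<Rightarrow> indicator {-1..1} r * (\<phi> (x + 0 * r))\<^sup>2)) :: real)"
        using order_trans[OF young abs_ge_self] by (intro always_eventually allI) (auto split: prod.split)
    qed
    have int2: "integrable (lborel \<Otimes>\<^sub>M lborel) (\<lambda>(r, x). \<kappa>0 r * f x * \<phi> (x + s * r))"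
    proof (rule Bochner_Integration.integrable_bound)
      show "integrable (lborel \<Otimes>\<^sub>M lborel) (\<lambda>p. M * ((case p of (r, x) \<Rightarrow> indicator {-1..1} r * (f (x + 0 * r))\<^sup>2)
          + (case p of (r, x) \<Rightarrow> indicator {-1..1} r * (\<phi> (x + s * r))\<^sup>2)) :: real)"
        by (intro integrable_mult_right Bochner_Integration.integrable_add integrable_strip[OF sq_\<phi>] integrable_strip[OF f])
      show "(\<lambda>(r, x). \<kappa>0 r * f x * \<phi> (x + s * r)) \<in> borel_measurable (lborel \<Otimes>\<^sub>M lborel)"
        by measurable
      show "AE p in lborel \<Otimes>\<^sub>M lborel. norm (case p of (r, x) \<Rightarrow> \<kappa>0 r * f x * \<phi> (x + s * r)) \<le>
          norm (M * ((case p of (r, x) \<Rightarrow> indicator {-1..1} r * (f (x + 0 * r))\<^sup>2)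
          + (case p of (r, x) \<Rightarrow> indicator {-1..1} r * (\<phi> (x + s * r))\<^sup>2)) :: real)"
        using order_trans[OF young abs_ge_self] by (intro always_eventually allI) (auto split: prod.split)
    qed
    have avg_eq: "avg s 0 0 \<kappa> \<phi> x = (LINT r|lborel. \<kappa>0 r * \<phi> (x + s * r))" for x
    proof -
      have "set_integrable lborel {-1..1} (\<lambda>r. \<kappa> r * \<phi> (x + s * r))"
        unfolding set_integrable_def
        by (intro borel_integrable_compact continuous_on_mult \<kappa> smooth_shift_continuous[OF test_funs_smooth[OF \<phi>]]
            continuous_intros) simp
      from set_borel_integral_eq_integral(2)[OF this]
      show ?thesis
        by (simp add: avg_def set_lebesgue_integral_def \<kappa>0_def mult.assoc)
    qed
    have "pairing (transpose_op (avg s 0 0 \<kappa>) T) \<phi> = (LINT x|lborel. f x * avg s 0 0 \<kappa> \<phi> x)"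
      using T test_op_test_funs[OF op \<phi>] by (simp add: pairing_transpose_op[OF op \<phi>] L2_repr_def)
    also have "\<dots> = (LINT x|lborel. LINT r|lborel. \<kappa>0 r * f x * \<phi> (x + s * r))"
      unfolding avg_eq by (simp flip: integral_mult_right_zero add: mult_ac)
    also have "\<dots> = (LINT r|lborel. LINT x|lborel. \<kappa>0 r * f x * \<phi> (x + s * r))"
      by (rule lborel_pair.Fubini_integral[OF int2])
    also have "\<dots> = (LINT r|lborel. LINT x|lborel. \<kappa>0 r * f (x + (- s) * r) * \<phi> x)"
    proof (rule Bochner_Integration.integral_cong[OF refl])
      fix r
      show "(LINT x|lborel. \<kappa>0 r * f x * \<phi> (x + s * r)) = (LINT x|lborel. \<kappa>0 r * f (x + (- s) * r) * \<phi> x)"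
        using lborel_integral_translate[of "\<lambda>x. \<kappa>0 r * f x * \<phi> (x + s * r)" "(- s) * r"] by simp
    qed
    also have "\<dots> = (LINT x|lborel. LINT r|lborel. \<kappa>0 r * f (x + (- s) * r) * \<phi> x)"
      by (rule lborel_pair.Fubini_integral[OF int1, symmetric])
    also have "\<dots> = (LINT x|lborel. h x * \<phi> x)"
      unfolding h_def by simp
    finally show ?thesis .
  qed
  then have "L2_repr (transpose_op (avg s 0 0 \<kappa>) T) h"
    using h_sq by (simp add: L2_repr_def square_integrable_def)
  with h_bound show ?thesis by blast
qed

definition L2_bounded :: "((real \<Rightarrow> real) \<Rightarrow> real \<Rightarrow> real) \<Rightarrow> bool"
  where "L2_bounded A \<longleftrightarrow>
    (\<exists>C\<ge>0. \<forall>T\<in>L2. transpose_op A T \<in> L2 \<and> L2_norm (transpose_op A T) \<le> C * L2_norm T)"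

lemma L2_bounded_avg:
  assumes \<kappa>: "continuous_on {-1..1} \<kappa>"
  shows "L2_bounded (avg s p q \<kappa>)"
proof -
  have "bounded (\<kappa> ` {-1..1})"
    by (intro compact_imp_bounded compact_continuous_image \<kappa> compact_Icc)
  then obtain M where M: "\<And>r. r \<in> {-1..1} \<Longrightarrow> \<bar>\<kappa> r\<bar> \<le> M"
    unfolding bounded_iff real_norm_def by blast
  have M0: "0 \<le> M" using M[of 0] by simp
  \<comment> \<open>Each use of \<open>L2_norm_add\<close> costs a factor 2: the inner one joins the
    two translations, which are isometries, and the outer one adds the kernel average with its bound
    2 M.\<close>
  define C where "C = 2 * (2 * (\<bar>p\<bar> + \<bar>q\<bar>) + 2 * M)"
  have "transpose_op (avg s p q \<kappa>) T \<in> L2 \<and> L2_norm (transpose_op (avg s p q \<kappa>) T) \<le> C * L2_norm T"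
    if T: "T \<in> L2" for T
  proof -
    obtain f where f: "L2_repr T f"
      using T by (auto simp: L2_def)
    define n where "n = L2_norm T"
    define A where "A = transpose_op (avg s 1 0 (\<lambda>_. 0)) T"
    define B where "B = transpose_op (avg (- s) 1 0 (\<lambda>_. 0)) T"
    define D where "D = transpose_op (avg s 0 0 \<kappa>) T"
    have sf: "square_integrable f"
      using f by (simp add: L2_repr_def)
    have transl: "transpose_op (avg a 1 0 (\<lambda>_. 0)) T \<in> L2" "L2_norm (transpose_op (avg a 1 0 (\<lambda>_. 0)) T) = n" for a
    proof -
      note t = L2_repr_translate[OF f, of a]
      show "transpose_op (avg a 1 0 (\<lambda>_. 0)) T \<in> L2"
        using t by (auto simp only: L2_def)
      show "L2_norm (transpose_op (avg a 1 0 (\<lambda>_. 0)) T) = n"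
        unfolding n_def L2_norm_eq[OF t] L2_norm_eq[OF f] square_integrable_translate(2)[OF sf] ..
    qed
    have A: "A \<in> L2" "L2_norm A = n" and B: "B \<in> L2" "L2_norm B = n"
      unfolding A_def B_def by (rule transl)+
    obtain h where h: "L2_repr D h" "(LINT x|lborel. (h x)\<^sup>2) \<le> (2 * M)\<^sup>2 * (LINT x|lborel. (f x)\<^sup>2)"
      unfolding D_def using L2_repr_average[OF f \<kappa> M] by blast
    have D: "D \<in> L2" "L2_norm D \<le> 2 * M * n"
    proof -
      show "D \<in> L2" using h by (auto simp: L2_def)
      show "L2_norm D \<le> 2 * M * n"
        using h M0 L2_norm_nonneg[of T]
        by (intro L2_norm_leI[OF h(1)]) (auto simp: L2_norm_sq[OF f] power_mult_distrib n_def)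
    qed
    have eq: "transpose_op (avg s p q \<kappa>) T = (p *\<^sub>R A + q *\<^sub>R B) + D"
    proof (rule distribution_eqI)
      fix \<phi> :: "real \<Rightarrow> real" assume \<phi>: "\<phi> \<in> test_funs"
      have ops: "test_op (avg s 1 0 (\<lambda>_. 0))" "test_op (avg (- s) 1 0 (\<lambda>_. 0))" "test_op (avg s 0 0 \<kappa>)" "test_op (avg s p q \<kappa>)"
        by (intro test_op_avg \<kappa> continuous_on_const)+
      note mem = ops(1-3)[THEN test_op_test_funs, OF \<phi>]
      have "avg s p q \<kappa> \<phi> = (\<lambda>x. (p * avg s 1 0 (\<lambda>_. 0) \<phi> x + q * avg (- s) 1 0 (\<lambda>_. 0) \<phi> x) + avg s 0 0 \<kappa> \<phi> x)"
        by (simp add: avg_def fun_eq_iff)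
      then have "pairing (transpose_op (avg s p q \<kappa>) T) \<phi> = (p * pairing T (avg s 1 0 (\<lambda>_. 0) \<phi>)
          + q * pairing T (avg (- s) 1 0 (\<lambda>_. 0) \<phi>)) + pairing T (avg s 0 0 \<kappa> \<phi>)"
        by (simp add: pairing_transpose_op[OF ops(4) \<phi>] pairing_add pairing_cmult mem test_funs_add test_funs_cmult)
      then show "pairing (transpose_op (avg s p q \<kappa>) T) \<phi> = pairing (p *\<^sub>R A + q *\<^sub>R B + D) \<phi>"
        by (simp add: pairing_linear A_def B_def D_def ops[THEN pairing_transpose_op, OF \<phi>])
    qed
    have pA: "p *\<^sub>R A \<in> L2" and qB: "q *\<^sub>R B \<in> L2"
      using A B by (auto intro: L2_scaleR)
    have "L2_norm ((p *\<^sub>R A + q *\<^sub>R B) + D) \<le> 2 * (L2_norm (p *\<^sub>R A + q *\<^sub>R B) + L2_norm D)"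
      by (rule L2_norm_add[OF L2_add[OF pA qB] D(1)])
    moreover have "L2_norm (p *\<^sub>R A + q *\<^sub>R B) \<le> 2 * (\<bar>p\<bar> * n + \<bar>q\<bar> * n)"
      using L2_norm_add[OF pA qB] A B by (simp add: L2_norm_scaleR)
    ultimately have "L2_norm ((p *\<^sub>R A + q *\<^sub>R B) + D) \<le> C * n"
      using D(2) by (simp add: C_def algebra_simps)
    then show ?thesis
      unfolding eq n_def using L2_add[OF L2_add[OF pA qB] D(1)] by simp
  qed
  moreover have "0 \<le> C" using M0 by (simp add: C_def)
  ultimately show ?thesis
    unfolding L2_bounded_def by blast
qed

section \<open>Estimates on \<open>X\<close> and the semigroup\<close>

lemma L2_bounded_wave:
  shows "L2_bounded (wave_sin k c t)"
    and "L2_bounded (wave_cos k c t)"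
    and "L2_bounded (wave_sin_dx k c t)"
  unfolding wave_sin_def wave_cos_def wave_sin_dx_def
  by (intro L2_bounded_avg wave_sin_kernel wave_cos_kernel wave_sin_dx_kernel)+

text \<open>The notion is stable under sums, multiples and bounded transposes, so estimates for
  composite expressions are assembled from those for f, g and f'. Positivity of \<open>M\<close>
  matches the positive constants to be produced.\<close>

definition X_bounded ::
    "(real distribution \<Rightarrow> real distribution \<Rightarrow> real) \<Rightarrow> (real distribution \<Rightarrow> real distribution \<Rightarrow> real distribution) \<Rightarrow> bool"
  where "X_bounded w F \<longleftrightarrow>
    (\<exists>M>0. \<forall>f g. (f, g) \<in> X \<longrightarrow> F f g \<in> L2 \<and> L2_norm (F f g) \<le> M * w f g)"

text \<open>Two weights are kept apart because the bound for u itself must not involve f'.\<close>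

definition weight0 :: "real distribution \<Rightarrow> real distribution \<Rightarrow> real"
  where "weight0 f g = L2_norm f + L2_norm g"

definition weight1 :: "real distribution \<Rightarrow> real distribution \<Rightarrow> real"
  where "weight1 f g = L2_norm f + L2_norm g + L2_norm (dist_deriv 1 f)"

lemma weight_nonneg: "0 \<le> weight0 f g" "weight0 f g \<le> weight1 f g" "0 \<le> weight1 f g"
  by (simp_all add: weight0_def weight1_def L2_norm_nonneg)

lemma X_bounded_leI:
  assumes "\<And>f g. (f, g) \<in> X \<Longrightarrow> F f g \<in> L2" "\<And>f g. (f, g) \<in> X \<Longrightarrow> L2_norm (F f g) \<le> C * w f g" "\<And>f g. 0 \<le> w f g"
  shows "X_bounded w F"
  unfolding X_bounded_def
proof (intro exI[of _ "\<bar>C\<bar> + 1"] conjI allI impI)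
  fix f g assume X: "(f, g) \<in> X"
  have "C * w f g \<le> (\<bar>C\<bar> + 1) * w f g"
    using assms(3) by (intro mult_right_mono) auto
  then show "L2_norm (F f g) \<le> (\<bar>C\<bar> + 1) * w f g"
    using assms(2)[OF X] by linarith
qed (use assms(1) in auto)

lemma X_bounded_add:
  assumes "X_bounded w F" "X_bounded w G"
  shows "X_bounded w (\<lambda>f g. F f g + G f g)"
proof -
  obtain M N where M: "M > 0" "\<And>f g. (f, g) \<in> X \<Longrightarrow> F f g \<in> L2 \<and> L2_norm (F f g) \<le> M * w f g"
    and N: "N > 0" "\<And>f g. (f, g) \<in> X \<Longrightarrow> G f g \<in> L2 \<and> L2_norm (G f g) \<le> N * w f g"
    using assms unfolding X_bounded_def by metis
  show ?thesis
    unfolding X_bounded_def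
  proof (intro exI[of _ "2 * (M + N)"] conjI allI impI)
    fix f g assume X: "(f, g) \<in> X"
    note FG = conjunct1[OF M(2)[OF X]] conjunct1[OF N(2)[OF X]]
    show "F f g + G f g \<in> L2"
      by (rule L2_add[OF FG])
    have "L2_norm (F f g + G f g) \<le> 2 * (L2_norm (F f g) + L2_norm (G f g))"
      by (rule L2_norm_add[OF FG])
    also have "\<dots> \<le> 2 * (M * w f g + N * w f g)"
      using M(2)[OF X] N(2)[OF X] by simp
    finally show "L2_norm (F f g + G f g) \<le> 2 * (M + N) * w f g"
      by (simp add: algebra_simps)
  qed (use M N in simp)
qed

lemma X_bounded_scaleR:
  assumes "X_bounded w F" "\<And>f g. 0 \<le> w f g"
  shows "X_bounded w (\<lambda>f g. a *\<^sub>R F f g)"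
proof -
  obtain M where M: "M > 0" "\<And>f g. (f, g) \<in> X \<Longrightarrow> F f g \<in> L2 \<and> L2_norm (F f g) \<le> M * w f g"
    using assms unfolding X_bounded_def by metis
  show ?thesis
  proof (rule X_bounded_leI[where C = "\<bar>a\<bar> * M"])
    fix f g assume X: "(f, g) \<in> X"
    note F = conjunct1[OF M(2)[OF X]]
    show "a *\<^sub>R F f g \<in> L2"
      by (rule L2_scaleR[OF F])
    have "\<bar>a\<bar> * L2_norm (F f g) \<le> \<bar>a\<bar> * (M * w f g)"
      using M(2)[OF X] by (intro mult_left_mono) auto
    then show "L2_norm (a *\<^sub>R F f g) \<le> \<bar>a\<bar> * M * w f g"
      by (simp add: L2_norm_scaleR[OF F] mult.assoc)
  qed (rule assms)
qed

lemma X_bounded_transpose: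
  assumes "X_bounded w F" "L2_bounded A" "\<And>f g. 0 \<le> w f g"
  shows "X_bounded w (\<lambda>f g. transpose_op A (F f g))"
proof -
  obtain M where M: "M > 0" "\<And>f g. (f, g) \<in> X \<Longrightarrow> F f g \<in> L2 \<and> L2_norm (F f g) \<le> M * w f g"
    using assms(1) unfolding X_bounded_def by metis
  obtain C where C: "C \<ge> 0" "\<And>T. T \<in> L2 \<Longrightarrow> transpose_op A T \<in> L2 \<and> L2_norm (transpose_op A T) \<le> C * L2_norm T"
    using assms(2) unfolding L2_bounded_def by metis
  show ?thesis
  proof (rule X_bounded_leI[where C = "C * M"])
    fix f g assume X: "(f, g) \<in> X"
    note F = conjunct1[OF M(2)[OF X]]
    show "transpose_op A (F f g) \<in> L2"
      using C(2)[OF F] ..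
    have "L2_norm (transpose_op A (F f g)) \<le> C * L2_norm (F f g)"
      using C(2)[OF F] ..
    also have "\<dots> \<le> C * (M * w f g)"
      using M(2)[OF X] C(1) by (intro mult_left_mono) auto
    finally show "L2_norm (transpose_op A (F f g)) \<le> C * M * w f g"
      by (simp add: mult.assoc)
  qed (rule assms)
qed

lemma X_mem: "(f, g) \<in> X \<longleftrightarrow> f \<in> L2 \<and> dist_deriv 1 f \<in> L2 \<and> g \<in> L2"
  by (auto simp: X_def H1_def)

lemma X_bounded_base:
  "X_bounded weight0 (\<lambda>f g. f)" "X_bounded weight0 (\<lambda>f g. g)" "X_bounded weight1 (\<lambda>f g. dist_deriv 1 f)"
  by (rule X_bounded_leI[where C = 1]; simp add: X_mem weight_nonneg; simp add: weight0_def weight1_def L2_norm_nonneg)+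

lemma X_bounded_weight1: 
  assumes "X_bounded weight0 F"
  shows "X_bounded weight1 F"
proof -
  obtain M where M: "M > 0" "\<And>f g. (f, g) \<in> X \<Longrightarrow> F f g \<in> L2 \<and> L2_norm (F f g) \<le> M * weight0 f g"
    using assms unfolding X_bounded_def by metis
  show ?thesis
  proof (rule X_bounded_leI[where C = M])
    fix f g assume X: "(f, g) \<in> X"
    show "F f g \<in> L2" using M(2)[OF X] ..
    have "M * weight0 f g \<le> M * weight1 f g"
      using M(1) weight_nonneg by (intro mult_left_mono) auto
    then show "L2_norm (F f g) \<le> M * weight1 f g"
      using M(2)[OF X] by linarith
  qed (rule weight_nonneg)
qed

lemma wave_part_bounded: "X_bounded weight0 (\<lambda>f g. wave_part k c f g t)"
  unfolding wave_part_def
  by (intro X_bounded_add X_bounded_transpose X_bounded_scaleR X_bounded_base L2_bounded_wave weight_nonneg)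

lemma dx_wave_sin_test:
  assumes "c > 0" "\<phi> \<in> test_funs"
  shows "dx (wave_sin k c t \<phi>) = wave_sin_dx k c t \<phi>"
  using dx_pow_wave_sin[OF test_funs_smooth[OF assms(2)], of 1 k c t]
    dx_wave_sin[OF assms(1) test_funs_smooth[OF assms(2)], of k t] by simp

lemmas pairing_wave_sin_dx = pairing_transpose_op[OF test_op_wave_sin_dx]

text \<open>In the cosine part the derivative goes to f, which lies in H1. In the sine part g is
  only in L2, so the derivative is absorbed into the kernel.\<close>

lemma wave_part_dx:
  assumes c: "c > 0"
  shows "dist_deriv 1 (wave_part k c f g t) = transpose_op (wave_cos k c t) (dist_deriv 1 f)
    + (-1) *\<^sub>R transpose_op (wave_sin_dx k c t) (g + (k / 2) *\<^sub>R f)"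
proof (rule distribution_eqI)
  fix \<phi> :: "real \<Rightarrow> real" assume \<phi>: "\<phi> \<in> test_funs"
  have \<phi>': "dx \<phi> \<in> test_funs"
    using \<phi> by (rule test_funs_dir_deriv)
  have cos: "wave_cos k c t (dx \<phi>) = dx (wave_cos k c t \<phi>)"
    using dx_pow_wave_cos[OF test_funs_smooth[OF \<phi>], of 1 k c t] by simp
  show "pairing (dist_deriv 1 (wave_part k c f g t)) \<phi> = pairing (transpose_op (wave_cos k c t) (dist_deriv 1 f)
    + (-1) *\<^sub>R transpose_op (wave_sin_dx k c t) (g + (k / 2) *\<^sub>R f)) \<phi>"
    unfolding wave_part_def pairing_dist_deriv[OF \<phi>] pairing_linear pairing_wave[OF \<phi>'] pairing_wave[OF \<phi>]
      pairing_wave_sin_dx[OF \<phi>] pairing_dist_deriv[OF wave_test_funs(2)[OF \<phi>]] cos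
      dx_wave_sin[OF c test_funs_smooth[OF \<phi>]]
    by simp
qed

lemma wave_part_dx_bounded:
  assumes "c > 0"
  shows "X_bounded weight1 (\<lambda>f g. dist_deriv 1 (wave_part k c f g t))"
  unfolding wave_part_dx[OF assms]
  by (intro X_bounded_add X_bounded_transpose X_bounded_scaleR X_bounded_base L2_bounded_wave weight_nonneg
      X_bounded_weight1[OF X_bounded_base(1)] X_bounded_weight1[OF X_bounded_base(2)])

text \<open>For f in H1 the term f'' inside \<open>gen_dist\<close> is only a distribution. One of
  its derivatives is moved onto the kernel, which turns \<open>wave_sin\<close> into
  \<open>wave_sin_dx\<close> and leaves f'; the sign is that of \<open>dist_deriv\<close>.\<close>

lemma wave_part_dt_eq:
  assumes c: "c > 0"
  shows "wave_part_dt k c f g t = (- c\<^sup>2) *\<^sub>R transpose_op (wave_sin_dx k c t) (dist_deriv 1 f)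
    + ((k / 2)\<^sup>2 *\<^sub>R transpose_op (wave_sin k c t) f + transpose_op (wave_cos k c t) (g + (k / 2) *\<^sub>R f))"
proof (rule distribution_eqI)
  fix \<phi> :: "real \<Rightarrow> real" assume \<phi>: "\<phi> \<in> test_funs"
  note \<phi>s = wave_test_funs[OF \<phi>]
  show "pairing (wave_part_dt k c f g t) \<phi> = pairing ((- c\<^sup>2) *\<^sub>R transpose_op (wave_sin_dx k c t) (dist_deriv 1 f)
    + ((k / 2)\<^sup>2 *\<^sub>R transpose_op (wave_sin k c t) f + transpose_op (wave_cos k c t) (g + (k / 2) *\<^sub>R f))) \<phi>"
    unfolding wave_part_dt_def gen_dist_def pairing_linear pairing_wave[OF \<phi>] pairing_wave_sin_dx[OF \<phi>]
      pairing_dist_deriv[OF \<phi>s(1)] dx_wave_sin_test[OF c \<phi>]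
    by simp
qed

lemma wave_part_dt_bounded:
  assumes "c > 0"
  shows "X_bounded weight1 (\<lambda>f g. wave_part_dt k c f g t - (k / 2) *\<^sub>R wave_part k c f g t)"
proof -
  have "X_bounded weight1 (\<lambda>f g. wave_part_dt k c f g t + (- (k / 2)) *\<^sub>R wave_part k c f g t)"
    unfolding wave_part_dt_eq[OF assms]
    by (intro X_bounded_add X_bounded_transpose X_bounded_scaleR X_bounded_base L2_bounded_wave weight_nonneg
        X_bounded_weight1[OF X_bounded_base(1)] X_bounded_weight1[OF X_bounded_base(2)] X_bounded_weight1[OF wave_part_bounded])
  then show ?thesis
    by simp
qed

lemma dist_deriv_scaleR: "dist_deriv v (a *\<^sub>R T) = a *\<^sub>R dist_deriv v T"
  by (rule distribution_eqI) (simp add: pairing_dist_deriv scaleR_distribution.rep_eq)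

text \<open>The factor \<open>e\<close> is carried in the weight with the same constant
  \<open>M\<close>, so the exponential stays visible as a separate factor of the estimates.\<close>

lemma X_bounded_scaled_weight:
  assumes F: "X_bounded w F" and e: "e > 0"
  shows "X_bounded (\<lambda>f g. e * w f g) (\<lambda>f g. e *\<^sub>R F f g)"
proof -
  obtain M where M: "M > 0" "\<And>f g. (f, g) \<in> X \<Longrightarrow> F f g \<in> L2 \<and> L2_norm (F f g) \<le> M * w f g"
    using F unfolding X_bounded_def by metis
  show ?thesis
    unfolding X_bounded_def
  proof (intro exI[of _ M] conjI allI impI)
    fix f g assume X: "(f, g) \<in> X"
    note F = conjunct1[OF M(2)[OF X]]
    show "e *\<^sub>R F f g \<in> L2"
      by (rule L2_scaleR[OF F])
    show "L2_norm (e *\<^sub>R F f g) \<le> M * (e * w f g)"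
      using M(2)[OF X] e by (simp add: L2_norm_scaleR[OF F] mult.left_commute)
  qed (rule M(1))
qed

lemma wave_u_bounded:
  "X_bounded (\<lambda>f g. exp (- (k / 2) * t) * weight0 f g) (\<lambda>f g. wave_u k c f g t)"
  unfolding wave_u_def by (intro X_bounded_scaled_weight wave_part_bounded exp_gt_zero)

lemma
  assumes "c > 0"
  shows wave_v_bounded: "X_bounded (\<lambda>f g. exp (- (k / 2) * t) * weight1 f g) (\<lambda>f g. wave_v k c f g t)"
    and wave_u_dx_bounded:
      "X_bounded (\<lambda>f g. exp (- (k / 2) * t) * weight1 f g) (\<lambda>f g. dist_deriv 1 (wave_u k c f g t))"
  unfolding wave_u_def wave_v_def dist_deriv_scaleR
  by (intro X_bounded_scaled_weight wave_part_dt_bounded wave_part_dx_bounded assms exp_gt_zero)+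

lemma
  assumes c: "c > 0"
  shows wave_X: "(f, g) \<in> X \<Longrightarrow> (wave_u k c f g t, wave_v k c f g t) \<in> X"
    and wave_X_norm: "\<exists>B. \<forall>f g. (f, g) \<in> X \<longrightarrow> X_norm (wave_u k c f g t, wave_v k c f g t) \<le> B * X_norm (f, g)"
proof -
  define e where "e = exp (- (k / 2) * t)"
  obtain M1 where M1: "M1 > 0" and est1: "\<And>f g. (f, g) \<in> X \<Longrightarrow>
      wave_u k c f g t \<in> L2 \<and> L2_norm (wave_u k c f g t) \<le> M1 * (e * weight0 f g)"
    using wave_u_bounded[of k t c] unfolding X_bounded_def e_def by metis
  obtain M2 where M2: "M2 > 0" and est2: "\<And>f g. (f, g) \<in> X \<Longrightarrow>
      wave_v k c f g t \<in> L2 \<and> L2_norm (wave_v k c f g t) \<le> M2 * (e * weight1 f g)"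
    using wave_v_bounded[OF c, of k t] unfolding X_bounded_def e_def by metis
  obtain M3 where M3: "M3 > 0" and est3: "\<And>f g. (f, g) \<in> X \<Longrightarrow> dist_deriv 1 (wave_u k c f g t) \<in> L2 \<and>
      L2_norm (dist_deriv 1 (wave_u k c f g t)) \<le> M3 * (e * weight1 f g)"
    using wave_u_dx_bounded[OF c, of k t] unfolding X_bounded_def e_def by metis
  have e: "e > 0" by (simp add: e_def)
  show "(f, g) \<in> X \<Longrightarrow> (wave_u k c f g t, wave_v k c f g t) \<in> X"
    unfolding X_mem[of "wave_u k c f g t"] using est1 est2 est3 by simp
  have sqrt3: "sqrt (x\<^sup>2 + y\<^sup>2 + z\<^sup>2) \<le> x + y + z" if "0 \<le> x" "0 \<le> y" "0 \<le> z" for x y z :: real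
    using that by (intro real_le_lsqrt) (auto simp: power2_eq_square algebra_simps)
  \<comment> \<open>The constant is 3 because each of the three L2 norms is at most their Euclidean
    combination.\<close>
  have weight_le: "weight1 f g \<le> 3 * X_norm (f, g)" for f g
  proof -
    have "x \<le> sqrt (x\<^sup>2 + y\<^sup>2)" for x y :: real
      by (rule real_le_rsqrt) simp
    then have "L2_norm f \<le> X_norm (f, g)" "L2_norm (dist_deriv 1 f) \<le> X_norm (f, g)" "L2_norm g \<le> X_norm (f, g)"
      unfolding X_norm_def by (auto intro!: real_le_rsqrt)
    then show ?thesis by (simp add: weight1_def)
  qed
  show "\<exists>B. \<forall>f g. (f, g) \<in> X \<longrightarrow> X_norm (wave_u k c f g t, wave_v k c f g t) \<le> B * X_norm (f, g)"
  proof (intro exI[of _ "e * (M1 + M3 + M2) * 3"] allI impI)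
    fix f g assume X: "(f, g) \<in> X"
    have "X_norm (wave_u k c f g t, wave_v k c f g t) \<le>
        L2_norm (wave_u k c f g t) + L2_norm (dist_deriv 1 (wave_u k c f g t)) + L2_norm (wave_v k c f g t)"
      unfolding X_norm_def by (simp add: sqrt3 L2_norm_nonneg)
    also have "\<dots> \<le> M1 * (e * weight1 f g) + M3 * (e * weight1 f g) + M2 * (e * weight1 f g)"
    proof (intro add_mono)
      have "M1 * (e * weight0 f g) \<le> M1 * (e * weight1 f g)"
        using e M1 weight_nonneg by (intro mult_left_mono) auto
      then show "L2_norm (wave_u k c f g t) \<le> M1 * (e * weight1 f g)"
        using est1[OF X] by linarith
    qed (use est2[OF X] est3[OF X] in auto)
    also have "\<dots> = e * (M1 + M3 + M2) * weight1 f g"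
      by (simp add: algebra_simps)
    also have "\<dots> \<le> e * (M1 + M3 + M2) * (3 * X_norm (f, g))"
      using weight_le e M1 M2 M3 by (intro mult_left_mono) auto
    finally show "X_norm (wave_u k c f g t, wave_v k c f g t) \<le> e * (M1 + M3 + M2) * 3 * X_norm (f, g)"
      by (simp only: mult.assoc)
  qed
qed

section \<open>Linearity of the evolution and the operators \<open>Gam\<close>\<close>

lemma pairing_gen_dist: "\<phi> \<in> test_funs \<Longrightarrow> pairing (gen_dist k c T) \<phi> = c\<^sup>2 * pairing T (dx (dx \<phi>)) + (k / 2)\<^sup>2 * pairing T \<phi>"
  by (simp add: gen_dist_def pairing_linear pairing_dd)

lemma wave_part_add:
  "wave_part k c (f + f') (g + g') t = wave_part k c f g t + wave_part k c f' g' t"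
  "wave_part_dt k c (f + f') (g + g') t = wave_part_dt k c f g t + wave_part_dt k c f' g' t"
  by (rule distribution_eqI; simp add: wave_part_def wave_part_dt_def pairing_linear pairing_wave pairing_gen_dist
      wave_test_funs; simp add: algebra_simps)+

lemma wave_part_scaleR:
  "wave_part k c (a *\<^sub>R f) (a *\<^sub>R g) t = a *\<^sub>R wave_part k c f g t"
  "wave_part_dt k c (a *\<^sub>R f) (a *\<^sub>R g) t = a *\<^sub>R wave_part_dt k c f g t"
  by (rule distribution_eqI; simp add: wave_part_def wave_part_dt_def pairing_linear pairing_wave pairing_gen_dist
      wave_test_funs; simp add: algebra_simps)+

lemma Gam_eq: "c > 0 \<Longrightarrow> Gam k c t (f, g) = (wave_u k c f g t, wave_v k c f g t)"
  by (simp add: Gam_def time_deriv_solution) (simp add: solution_eq)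

lemma Gam_bounded_operator:
  assumes c: "c > 0"
  shows "bounded_operator_on X X_norm (Gam k c t)"
  unfolding bounded_operator_on_def
proof (intro conjI ballI allI)
  fix p assume "p \<in> X"
  then show "Gam k c t p \<in> X"
    by (cases p) (simp add: Gam_eq[OF c] wave_X[OF c])
next
  fix p q :: "real distribution \<times> real distribution"
  show "Gam k c t (p + q) = Gam k c t p + Gam k c t q"
    by (cases p, cases q)
      (simp add: Gam_eq[OF c] wave_u_def wave_v_def wave_part_add scaleR_add_right scaleR_diff_right)
next
  fix a and p :: "real distribution \<times> real distribution"
  show "Gam k c t (a *\<^sub>R p) = a *\<^sub>R Gam k c t p"
    by (cases p)
      (simp add: Gam_eq[OF c] wave_u_def wave_v_def wave_part_scaleR scaleR_diff_right mult.commute)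
next
  show "\<exists>B. \<forall>p\<in>X. X_norm (Gam k c t p) \<le> B * X_norm p"
  proof -
    obtain B where B: "\<And>f g. (f, g) \<in> X \<Longrightarrow> X_norm (wave_u k c f g t, wave_v k c f g t) \<le> B * X_norm (f, g)"
      using wave_X_norm[OF c, of k t] by blast
    have "X_norm (Gam k c t p) \<le> B * X_norm p" if "p \<in> X" for p
      using B that by (cases p) (simp add: Gam_eq[OF c])
    then show ?thesis by blast
  qed
qed

theorem theorem5p3:
  fixes k c :: real
  assumes "k > 0" and "c > 0"
  shows
    "(\<forall>(f, g)\<in>X. \<forall>t\<ge>0. Gam k c t (f, g) \<in> X) \<and>
     semigroup_property X X_norm (Gam k c) \<and>
     (\<forall>t::real. \<exists>M1>0. \<exists>M2>0. \<exists>M3>0. \<exists>N1>0. \<exists>N2>0. \<exists>N3>0. \<exists>P1>0. \<exists>P2>0.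
        \<forall>(f, g)\<in>X.
          let u = solution k c f g t;
              u_t = time_deriv (solution k c f g) t;
              u_x = dist_deriv 1 u;
              f' = dist_deriv 1 f
          in u \<in> L2 \<and> u_t \<in> L2 \<and> u_x \<in> L2 \<and>
             L2_norm u \<le> exp (- (k / 2) * t) * (M1 * L2_norm f + N1 * L2_norm g) \<and>
             L2_norm u_t \<le> exp (- (k / 2) * t) *
               (M2 * L2_norm f + N2 * L2_norm g + P1 * L2_norm f') \<and>
             L2_norm u_x \<le> exp (- (k / 2) * t) *
               (M3 * L2_norm f + N3 * L2_norm g + P2 * L2_norm f'))"
proof (intro conjI allI)
  note c = assms(2)
  show "\<forall>(f, g)\<in>X. \<forall>t\<ge>0. Gam k c t (f, g) \<in> X"
    by (auto simp: Gam_eq[OF c] wave_X[OF c])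
  show "semigroup_property X X_norm (Gam k c)"
    unfolding semigroup_property_def
  proof (intro conjI allI impI ballI)
    show "bounded_operator_on X X_norm (Gam k c t)" for t
      by (rule Gam_bounded_operator[OF c])
    show "Gam k c 0 p = p" for p
      by (cases p) (simp add: Gam_eq[OF c] wave_initial)
    show "Gam k c t (Gam k c s p) = Gam k c (t + s) p" for t s p
      by (cases p) (simp add: Gam_eq[OF c] wave_semigroup[OF c])
  qed
  fix t :: real
  obtain M1 where M1: "M1 > 0" and est1: "\<And>f g. (f, g) \<in> X \<Longrightarrow> wave_u k c f g t \<in> L2 \<and>
      L2_norm (wave_u k c f g t) \<le> M1 * (exp (- (k / 2) * t) * weight0 f g)"
    using wave_u_bounded[of k t c] unfolding X_bounded_def by metis
  obtain M2 where M2: "M2 > 0" and est2: "\<And>f g. (f, g) \<in> X \<Longrightarrow> wave_v k c f g t \<in> L2 \<and>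
      L2_norm (wave_v k c f g t) \<le> M2 * (exp (- (k / 2) * t) * weight1 f g)"
    using wave_v_bounded[OF c, of k t] unfolding X_bounded_def by metis
  obtain M3 where M3: "M3 > 0" and est3: "\<And>f g. (f, g) \<in> X \<Longrightarrow> dist_deriv 1 (wave_u k c f g t) \<in> L2 \<and>
      L2_norm (dist_deriv 1 (wave_u k c f g t)) \<le> M3 * (exp (- (k / 2) * t) * weight1 f g)"
    using wave_u_dx_bounded[OF c, of k t] unfolding X_bounded_def by metis
  note M = M1 M2 M3
  show "\<exists>M1>0. \<exists>M2>0. \<exists>M3>0. \<exists>N1>0. \<exists>N2>0. \<exists>N3>0. \<exists>P1>0. \<exists>P2>0.
        \<forall>(f, g)\<in>X.
          let u = solution k c f g t;
              u_t = time_deriv (solution k c f g) t;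
              u_x = dist_deriv 1 u;
              f' = dist_deriv 1 f
          in u \<in> L2 \<and> u_t \<in> L2 \<and> u_x \<in> L2 \<and>
             L2_norm u \<le> exp (- (k / 2) * t) * (M1 * L2_norm f + N1 * L2_norm g) \<and>
             L2_norm u_t \<le> exp (- (k / 2) * t) *
               (M2 * L2_norm f + N2 * L2_norm g + P1 * L2_norm f') \<and>
             L2_norm u_x \<le> exp (- (k / 2) * t) *
               (M3 * L2_norm f + N3 * L2_norm g + P2 * L2_norm f')"
  \<comment> \<open>\<open>X_bounded\<close> bounds by one multiple of a sum of norms, so M1 also
    serves as N1, M2 as N2 and P1, and M3 as N3 and P2.\<close>
  proof (rule exI[of _ M1], rule conjI[OF M(1)], rule exI[of _ M2], rule conjI[OF M(2)],
      rule exI[of _ M3], rule conjI[OF M(3)], rule exI[of _ M1], rule conjI[OF M(1)],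
      rule exI[of _ M2], rule conjI[OF M(2)], rule exI[of _ M3], rule conjI[OF M(3)],
      rule exI[of _ M2], rule conjI[OF M(2)], rule exI[of _ M3], rule conjI[OF M(3)], rule ballI)
    fix p :: "real distribution \<times> real distribution" assume p: "p \<in> X"
    obtain f g where fg: "p = (f, g)" by force
    note X = p[unfolded fg]
    show "case p of (f, g) \<Rightarrow>
          let u = solution k c f g t;
              u_t = time_deriv (solution k c f g) t;
              u_x = dist_deriv 1 u;
              f' = dist_deriv 1 f
          in u \<in> L2 \<and> u_t \<in> L2 \<and> u_x \<in> L2 \<and>
             L2_norm u \<le> exp (- (k / 2) * t) * (M1 * L2_norm f + M1 * L2_norm g) \<and>
             L2_norm u_t \<le> exp (- (k / 2) * t) *
               (M2 * L2_norm f + M2 * L2_norm g + M2 * L2_norm f') \<and>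
             L2_norm u_x \<le> exp (- (k / 2) * t) *
               (M3 * L2_norm f + M3 * L2_norm g + M3 * L2_norm f')"
      using est1[OF X] est2[OF X] est3[OF X]
      unfolding fg prod.case Let_def time_deriv_solution[OF c] weight0_def weight1_def
        mult.left_commute[of _ "exp (- (k / 2) * t)"] distrib_left[of M1] distrib_left[of M2] distrib_left[of M3]
      unfolding solution_eq[OF c] by blast
  qed
qed

end
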